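(* Every $5$-oriented Spherical Diagram has at least eight arcs; every $5$-oriented Spherical Occlusion Diagram has at least nine arcs.
   Context: A geodesic arc on the unit sphere in $\mathbb R^3$ is the unique shortest curve joining two non-antipodal points. An arc $a$ blocks an arc $b$ (equivalently, $b$ hits $a$) if an endpoint of $b$ lies in the relative interior of $a$. A Spherical Diagram (SD) is a finite non-empty collection $\mathcal D$ of pairwise interior-disjoint geodesic arcs on the unit sphere such that each arc of $\mathcal D$ is blocked by arcs of $\mathcal D$ at each of its endpoints. A Spherical Occlusion Diagram (SOD) is an SD such that all arcs of $\mathcal D$ that hit the same arc of $\mathcal D$ reach it from the same side. An SD $\mathcal D$ is $k$-oriented if there exist a set $P$ of $k$ points on the unit sphere (poles), no two antipodal, and a function $f\colon\mathcal D\to P$ such that each arc $a\in\mathcal D$ lies on a great circle through $f(a)$ but contains neither $f(a)$ nor its antipode $-f(a)$. *)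

theory Defs
  imports "HOL-Analysis.Analysis"
begin

text \<open>Points of the unit sphere are unit vectors of real^3. An arc is represented
by the ordered pair of its endpoints (p, q); the arc is the shortest great-circle
arc between them, parametrised by normalising the chord.\<close>

type_synonym pt = "real^3"
type_synonym arc = "pt \<times> pt"

definition valid_arc :: "arc \<Rightarrow> bool" where
  "valid_arc a \<longleftrightarrow> norm (fst a) = 1 \<and> norm (snd a) = 1 \<and> fst a \<noteq> snd a \<and> fst a \<noteq> - snd a"

definition arc_pt :: "arc \<Rightarrow> real \<Rightarrow> pt" where
  "arc_pt a t = sgn ((1 - t) *\<^sub>R fst a + t *\<^sub>R snd a)"

definition arc_set :: "arc \<Rightarrow> pt set" where
  "arc_set a = arc_pt a ` {0..1}"

definition arc_relint :: "arc \<Rightarrow> pt set" where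
  "arc_relint a = arc_pt a ` {0<..<1}"

definition arc_normal :: "arc \<Rightarrow> pt" where
  "arc_normal a = (let p = fst a; q = snd a in
     vector [p$2*q$3 - p$3*q$2, p$3*q$1 - p$1*q$3, p$1*q$2 - p$2*q$1])"

definition blocks :: "arc \<Rightarrow> arc \<Rightarrow> bool" where
  "blocks a b \<longleftrightarrow> fst b \<in> arc_relint a \<or> snd b \<in> arc_relint a"

definition spherical_diagram :: "arc set \<Rightarrow> bool" where
  "spherical_diagram D \<longleftrightarrow> finite D \<and> D \<noteq> {} \<and> (\<forall>a\<in>D. valid_arc a) \<and>
     (\<forall>a\<in>D. \<forall>b\<in>D. a \<noteq> b \<longrightarrow> arc_relint a \<inter> arc_relint b = {}) \<and>
     (\<forall>b\<in>D. (\<exists>a\<in>D. fst b \<in> arc_relint a) \<and> (\<exists>a\<in>D. snd b \<in> arc_relint a))"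

text \<open>An arc b hitting a at an endpoint reaches a from the side (open hemisphere
bounded by the great circle of a) containing its other endpoint; the side is
recorded as the sign of the inner product with the normal of a.\<close>
definition spherical_occlusion_diagram :: "arc set \<Rightarrow> bool" where
  "spherical_occlusion_diagram D \<longleftrightarrow> spherical_diagram D \<and>
     (\<forall>a\<in>D. \<exists>s::real. \<forall>b\<in>D.
        (fst b \<in> arc_relint a \<longrightarrow> sgn (arc_normal a \<bullet> snd b) = s) \<and>
        (snd b \<in> arc_relint a \<longrightarrow> sgn (arc_normal a \<bullet> fst b) = s))"

definition k_oriented :: "nat \<Rightarrow> arc set \<Rightarrow> bool" where
  "k_oriented k D \<longleftrightarrow> (\<exists>P f. finite P \<and> card P = k \<and> (\<forall>x\<in>P. norm x = 1) \<and>
     (\<forall>x\<in>P. \<forall>y\<in>P. x \<noteq> - y) \<and>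
     (\<forall>a\<in>D. f a \<in> P \<and> f a \<in> span {fst a, snd a} \<and>
              f a \<notin> arc_set a \<and> - f a \<notin> arc_set a))"

end

theory Submission
  imports Defs
begin

text \<open>Work with the cones in real^3 spanned by the arcs. For every point p, a maximal open convex cone that
misses all arcs and has p in its closure is bounded by at least three arcs (its sides). This tile meets
the great circle of a side only within the side itself, so no arc with pole p is a side of a tile at p or
at -p. Let N and S be the sides of tiles at p and -p. Two common sides never touch, while each side
touches two others in its tile; hence at most five sides occur only for two triangles with one common
side, and then all five sides need different poles, a sixth pole being p. Thus N and S have
at least six members, and a diagram with m arcs of pole p has at least 6 + m arcs, whence at least 8.

An occlusion diagram with eight arcs has three poles used by exactly two arcs each. One-sidedness
forces the two tiles at such a pole and its antipode to be disjoint triangles. These six triangles pairwise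
share at most one side, so their corners give 18 distinct blocking pairs, more than the 16 ends of arcs.\<close>

text \<open>Tiles come from Zorn's lemma and not from components of the complement, so convexity is
  given and the topology of a union of arcs never enters. The price is the face property, that a
  tile meets the plane of a side only within the side. An end of the side strictly between a contact
  point and an outside point of the tile would be blocked by another side; its plane supports the
  tile, so it would contain the whole first side.

  The numbers: with d arcs, a pole serves at most d - 6 of them, so d \<le> 5 (d - 6), which forces
  d \<ge> 8. If d = 8, no pole serves more than two arcs, so at least three poles serve exactly two,
  and there |N| + |S| = 6 + |N \<inter> S|. One-sidedness gives |N \<inter> S| \<le> 1, so besides
  two disjoint triangles only a triangle and a four-sided tile with a common side c remain. Refuting
  this is the longest part: depending on the side from which c is hit, chains of blocking arcs are
  followed until two arcs cross or block each other.\<close>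

section \<open>Linear algebra in three dimensions\<close>

lemma plane_span_cross:
  fixes x y z \<nu> :: "real^3"
  assumes "\<nu> \<noteq> 0" "\<nu> \<bullet> x = 0" "\<nu> \<bullet> y = 0" "\<nu> \<bullet> z = 0" "cross3 x y \<noteq> 0"
  obtains g h where "z = g *\<^sub>R x + h *\<^sub>R y"
proof -
  let ?n = "cross3 x y"
  have nn: "?n \<bullet> ?n \<noteq> 0" using assms(5) by simp
  \<comment> \<open>Since \<nu> is orthogonal to x and y, it is parallel to their cross product, so
    \<open>?n\<close> inherits orthogonality to z.\<close>
  have "cross3 \<nu> ?n = 0"
    by (simp add: Lagrange assms(2,3))
  then have "(\<nu> \<bullet> ?n) *\<^sub>R \<nu> = (\<nu> \<bullet> \<nu>) *\<^sub>R ?n"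
    using Lagrange[of \<nu> \<nu> ?n] by simp
  then have "(\<nu> \<bullet> ?n) * (\<nu> \<bullet> z) = (\<nu> \<bullet> \<nu>) * (?n \<bullet> z)"
    by (metis inner_scaleR_left)
  then have nz: "?n \<bullet> z = 0" using assms by simp
  \<comment> \<open>Cramer's rule for z in the basis x, y, \<open>?n\<close>, multiplied by the
    determinant \<open>?n \<bullet> ?n\<close>.\<close>
  have "(?n \<bullet> ?n) *\<^sub>R z = (cross3 z y \<bullet> ?n) *\<^sub>R x + (cross3 x z \<bullet> ?n) *\<^sub>R y + (?n \<bullet> z) *\<^sub>R ?n"
    unfolding vec_eq_iff forall_3
    by (simp add: cross3_def inner_vec_def sum_3 vector_def; algebra)
  then have "(?n \<bullet> ?n) *\<^sub>R z = (cross3 z y \<bullet> ?n) *\<^sub>R x + (cross3 x z \<bullet> ?n) *\<^sub>R y"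
    using nz by simp
  then have "(1/(?n \<bullet> ?n)) *\<^sub>R ((?n \<bullet> ?n) *\<^sub>R z) = (1/(?n \<bullet> ?n)) *\<^sub>R ((cross3 z y \<bullet> ?n) *\<^sub>R x + (cross3 x z \<bullet> ?n) *\<^sub>R y)"
    by simp
  then have "z = ((cross3 z y \<bullet> ?n)/(?n \<bullet> ?n)) *\<^sub>R x + ((cross3 x z \<bullet> ?n)/(?n \<bullet> ?n)) *\<^sub>R y"
    using nn by (simp add: scaleR_right_distrib)
  then show thesis by (rule that)
qed

text \<open>Crossing \<phi> with the product recovers (\<phi> \<bullet> y) x. This is the test by
  which corners of a tile are later seen to be independent.\<close>

lemma cross_nonzero_functional:
  fixes x y \<phi> :: "real^3"
  assumes "x \<noteq> 0" "\<phi> \<bullet> x = 0" "\<phi> \<bullet> y \<noteq> 0"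
  shows "cross3 x y \<noteq> 0"
proof
  assume "cross3 x y = 0"
  then have "(\<phi> \<bullet> y) *\<^sub>R x - (\<phi> \<bullet> x) *\<^sub>R y = 0" using Lagrange[of \<phi> x y] by simp
  then show False using assms by simp
qed

lemma plane_span:
  fixes x y z \<nu> \<phi> :: "real^3"
  assumes "\<nu> \<noteq> 0" "\<nu> \<bullet> x = 0" "\<nu> \<bullet> y = 0" "\<nu> \<bullet> z = 0" "x \<noteq> 0" "\<phi> \<bullet> x = 0" "\<phi> \<bullet> y \<noteq> 0"
  obtains g h where "z = g *\<^sub>R x + h *\<^sub>R y"
  using plane_span_cross[OF assms(1-4) cross_nonzero_functional[OF assms(5-7)]] .

section \<open>Cones over arcs\<close>

text \<open>Passing from an arc to the cone over it removes the normalisation: incidence becomes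
  linear, and positive combinations of points of an arc stay in it.\<close>

definition arc_cone :: "arc \<Rightarrow> pt set" where
  "arc_cone a = {s *\<^sub>R fst a + t *\<^sub>R snd a | s t. 0 \<le> s \<and> 0 \<le> t}"

definition arc_icone :: "arc \<Rightarrow> pt set" where
  "arc_icone a = {s *\<^sub>R fst a + t *\<^sub>R snd a | s t. 0 < s \<and> 0 < t}"

text \<open>Arcs are ordered pairs, but their orientation is irrelevant. With this relation one
  argument serves both ends, \<open>e\<close> being the end under consideration and
  \<open>o'\<close> the other one.\<close>

definition ends :: "arc \<Rightarrow> pt \<Rightarrow> pt \<Rightarrow> bool" where
  "ends a e o' \<longleftrightarrow> (e = fst a \<and> o' = snd a) \<or> (e = snd a \<and> o' = fst a)"

lemma ends_fst: "ends a (fst a) (snd a)" and ends_snd: "ends a (snd a) (fst a)"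
  by (auto simp: ends_def)

lemma ends_sym: "ends a e o' \<Longrightarrow> ends a o' e"
  by (auto simp: ends_def)

lemma ends_cone: "ends a e o' \<Longrightarrow> x \<in> arc_cone a \<longleftrightarrow> (\<exists>s t. 0 \<le> s \<and> 0 \<le> t \<and> x = s *\<^sub>R e + t *\<^sub>R o')"
  unfolding ends_def arc_cone_def by (auto; metis add.commute)

lemma ends_icone: "ends a e o' \<Longrightarrow> x \<in> arc_icone a \<longleftrightarrow> (\<exists>s t. 0 < s \<and> 0 < t \<and> x = s *\<^sub>R e + t *\<^sub>R o')"
  unfolding ends_def arc_icone_def by (auto; metis add.commute)

lemma icone_sub_cone: "x \<in> arc_icone a \<Longrightarrow> x \<in> arc_cone a"
  unfolding arc_icone_def arc_cone_def by (auto intro: less_imp_le)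

lemma ends_in_cone: assumes "ends a e o'" shows "e \<in> arc_cone a"
  unfolding ends_cone[OF assms] by (rule exI[of _ 1], rule exI[of _ 0]) simp

lemma zero_in_cone: "0 \<in> arc_cone a"
  unfolding arc_cone_def by (auto intro!: exI[of _ 0])

lemma cone_scale: assumes "x \<in> arc_cone a" "0 \<le> c" shows "c *\<^sub>R x \<in> arc_cone a"
proof -
  obtain s t where "0 \<le> s" "0 \<le> t" "x = s *\<^sub>R fst a + t *\<^sub>R snd a" using assms unfolding arc_cone_def by auto
  then show ?thesis using assms(2) unfolding arc_cone_def
    by (intro CollectI exI[of _ "c * s"] exI[of _ "c * t"]) (simp add: scaleR_right_distrib)
qed

lemma icone_scale: assumes "x \<in> arc_icone a" "0 < c" shows "c *\<^sub>R x \<in> arc_icone a"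
proof -
  obtain s t where "0 < s" "0 < t" "x = s *\<^sub>R fst a + t *\<^sub>R snd a" using assms unfolding arc_icone_def by auto
  then show ?thesis using assms(2) unfolding arc_icone_def
    by (intro CollectI exI[of _ "c * s"] exI[of _ "c * t"]) (simp add: scaleR_right_distrib)
qed

lemma cone_add: assumes "x \<in> arc_cone a" "y \<in> arc_cone a" shows "x + y \<in> arc_cone a"
proof -
  obtain s t where "0 \<le> s" "0 \<le> t" "x = s *\<^sub>R fst a + t *\<^sub>R snd a" using assms unfolding arc_cone_def by auto
  moreover obtain s' t' where "0 \<le> s'" "0 \<le> t'" "y = s' *\<^sub>R fst a + t' *\<^sub>R snd a" using assms unfolding arc_cone_def by auto
  ultimately show ?thesis unfolding arc_cone_def
    by (intro CollectI exI[of _ "s + s'"] exI[of _ "t + t'"]) (simp add: algebra_simps)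
qed

lemma cone_icone_add: assumes "x \<in> arc_cone a" "y \<in> arc_icone a" shows "x + y \<in> arc_icone a"
proof -
  obtain s t where "0 \<le> s" "0 \<le> t" "x = s *\<^sub>R fst a + t *\<^sub>R snd a" using assms unfolding arc_cone_def by auto
  moreover obtain s' t' where "0 < s'" "0 < t'" "y = s' *\<^sub>R fst a + t' *\<^sub>R snd a" using assms unfolding arc_icone_def by auto
  ultimately show ?thesis unfolding arc_icone_def
    by (intro CollectI exI[of _ "s + s'"] exI[of _ "t + t'"]) (simp add: algebra_simps)
qed

lemma cone_comb: "x \<in> arc_cone a \<Longrightarrow> y \<in> arc_cone a \<Longrightarrow> 0 \<le> g \<Longrightarrow> 0 \<le> h \<Longrightarrow> g *\<^sub>R x + h *\<^sub>R y \<in> arc_cone a"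
  by (intro cone_add cone_scale)

lemma icone_comb: "x \<in> arc_cone a \<Longrightarrow> y \<in> arc_icone a \<Longrightarrow> 0 \<le> g \<Longrightarrow> 0 < h \<Longrightarrow> g *\<^sub>R x + h *\<^sub>R y \<in> arc_icone a"
  by (intro cone_icone_add cone_scale icone_scale)

lemma icone_comb': "x \<in> arc_icone a \<Longrightarrow> y \<in> arc_cone a \<Longrightarrow> 0 < g \<Longrightarrow> 0 \<le> h \<Longrightarrow> g *\<^sub>R x + h *\<^sub>R y \<in> arc_icone a"
  using icone_comb[of y a x h g] by (simp add: add.commute)

lemma convex_arc_cone: "convex (arc_cone a)"
  unfolding convex_def by (auto intro: cone_comb)

lemma arc_normal_cross: "arc_normal a = cross3 (fst a) (snd a)"
  by (simp add: arc_normal_def cross3_def Let_def)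

lemma valid_arc_cross: assumes "valid_arc a" shows "arc_normal a \<noteq> 0"
proof
  assume "arc_normal a = 0"
  then have c: "cross3 (fst a) (snd a) = 0" by (simp add: arc_normal_cross)
  have n: "fst a \<bullet> fst a = 1" "snd a \<bullet> snd a = 1"
    using assms by (simp_all add: valid_arc_def norm_eq_1)
  have "(fst a \<bullet> snd a) *\<^sub>R fst a - (fst a \<bullet> fst a) *\<^sub>R snd a = 0"
    using Lagrange[of "fst a" "fst a" "snd a"] c by simp
  then have e: "snd a = (fst a \<bullet> snd a) *\<^sub>R fst a" using n by simp
  then have "(fst a \<bullet> snd a)^2 = 1" using n
    by (metis inner_scaleR_left inner_scaleR_right mult.right_neutral power2_eq_square)
  then have "fst a \<bullet> snd a = 1 \<or> fst a \<bullet> snd a = -1" by (simp add: power2_eq_1_iff)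
  then show False using e assms unfolding valid_arc_def by (metis scaleR_minus1_left scaleR_one minus_minus)
qed

lemma normal_ends: "ends a e o' \<Longrightarrow> arc_normal a \<bullet> e = 0"
  unfolding ends_def arc_normal_cross by (auto simp: dot_cross_self inner_commute)

lemma valid_ends_cross: assumes "valid_arc a" "ends a e o'" shows "cross3 e o' \<noteq> 0"
  using valid_arc_cross[OF assms(1)] assms(2) unfolding ends_def arc_normal_cross
  by (metis cross_skew neg_equal_0_iff_equal)

lemma valid_ends_unique:
  assumes "valid_arc a" "ends a e o'" "s *\<^sub>R e + t *\<^sub>R o' = s' *\<^sub>R e + t' *\<^sub>R o'"
  shows "s = s'" "t = t'"
proof -
  have c: "cross3 e o' \<noteq> 0" by (rule valid_ends_cross[OF assms(1,2)])
  have z: "(s - s') *\<^sub>R e + (t - t') *\<^sub>R o' = 0" using assms(3) by (simp add: algebra_simps)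
  have "cross3 e ((s - s') *\<^sub>R e + (t - t') *\<^sub>R o') = (t - t') *\<^sub>R cross3 e o'"
    by (simp add: cross_add_right cross_mult_right)
  then show "t = t'" using z c by simp
  have "cross3 ((s - s') *\<^sub>R e + (t - t') *\<^sub>R o') o' = (s - s') *\<^sub>R cross3 e o'"
    by (simp add: cross_add_left cross_mult_left)
  then show "s = s'" using z c by simp
qed

lemma ends_nonzero: assumes "valid_arc a" "ends a e o'" shows "e \<noteq> 0"
  using valid_ends_cross[OF assms] by auto

lemma end_notin_icone: assumes "valid_arc a" "ends a e o'" "0 < c" shows "c *\<^sub>R e \<notin> arc_icone a"
proof
  assume "c *\<^sub>R e \<in> arc_icone a"
  then obtain s t where st: "0 < s" "0 < t" "c *\<^sub>R e = s *\<^sub>R e + t *\<^sub>R o'" using ends_icone[OF assms(2)] by auto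
  then have "c *\<^sub>R e + 0 *\<^sub>R o' = s *\<^sub>R e + t *\<^sub>R o'" by simp
  from valid_ends_unique(2)[OF assms(1,2) this] st show False by simp
qed

lemma icone_nonzero: assumes "valid_arc a" "x \<in> arc_icone a" shows "x \<noteq> 0"
proof
  assume "x = 0"
  obtain s t where st: "0 < s" "0 < t" "x = s *\<^sub>R fst a + t *\<^sub>R snd a" using assms(2) unfolding arc_icone_def by auto
  then have "s *\<^sub>R fst a + t *\<^sub>R snd a = 0 *\<^sub>R fst a + 0 *\<^sub>R snd a" using \<open>x = 0\<close> by simp
  from valid_ends_unique(1)[OF assms(1) ends_fst this] st show False by simp
qed

lemma cone_pointed: assumes "valid_arc a" "x \<in> arc_cone a" "- x \<in> arc_cone a" shows "x = 0"
proof -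
  obtain s t where st: "0 \<le> s" "0 \<le> t" "x = s *\<^sub>R fst a + t *\<^sub>R snd a" using assms(2) unfolding arc_cone_def by auto
  obtain s' t' where st': "0 \<le> s'" "0 \<le> t'" "- x = s' *\<^sub>R fst a + t' *\<^sub>R snd a" using assms(3) unfolding arc_cone_def by auto
  have "(s + s') *\<^sub>R fst a + (t + t') *\<^sub>R snd a = x + (- x)" unfolding st'(3) unfolding st(3) by (simp add: algebra_simps)
  then have e: "(s + s') *\<^sub>R fst a + (t + t') *\<^sub>R snd a = 0 *\<^sub>R fst a + 0 *\<^sub>R snd a" by simp
  have "s + s' = 0" "t + t' = 0" using valid_ends_unique[OF assms(1) ends_fst e] by auto
  then have "s = 0" "t = 0" using st st' by auto
  then show ?thesis using st by simp
qed

lemma cone_cases: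
  assumes "x \<in> arc_cone a" "x \<noteq> 0"
  obtains "x \<in> arc_icone a" | c e o' where "ends a e o'" "0 < c" "x = c *\<^sub>R e"
proof -
  obtain s t where st: "0 \<le> s" "0 \<le> t" "x = s *\<^sub>R fst a + t *\<^sub>R snd a" using assms unfolding arc_cone_def by auto
  consider "0 < s" "0 < t" | "s = 0" "0 < t" | "t = 0" "0 < s" using st assms(2) by fastforce
  then show thesis
  proof cases
    case 1 then have "x \<in> arc_icone a" using st(3) unfolding arc_icone_def by auto
    then show thesis by (rule that(1))
  next
    case 2 show thesis by (rule that(2)[OF ends_snd 2(2)]) (simp add: st 2)
  next
    case 3 show thesis by (rule that(2)[OF ends_fst 3(2)]) (simp add: st 3)
  qed
qed

text \<open>In contrast to \<open>arc_normal\<close>, this is free up to a nonzero factor, so that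
  supporting functionals of tiles and one-sidedness can be expressed with whatever normal is at
  hand.\<close>

definition is_normal :: "arc \<Rightarrow> pt \<Rightarrow> bool" where
  "is_normal a \<nu> \<longleftrightarrow> \<nu> \<noteq> 0 \<and> \<nu> \<bullet> fst a = 0 \<and> \<nu> \<bullet> snd a = 0"

lemma is_normal_ends: "is_normal a \<nu> \<Longrightarrow> ends a e o' \<Longrightarrow> \<nu> \<bullet> e = 0"
  by (auto simp: is_normal_def ends_def)

lemma is_normal_nz: "is_normal a \<nu> \<Longrightarrow> \<nu> \<noteq> 0"
  by (simp add: is_normal_def)

lemma is_normal_arc_normal: "valid_arc a \<Longrightarrow> is_normal a (arc_normal a)"
  using valid_arc_cross normal_ends[OF ends_fst] normal_ends[OF ends_snd] by (auto simp: is_normal_def)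

lemma is_normal_uminus: "is_normal a \<nu> \<Longrightarrow> is_normal a (- \<nu>)"
  by (auto simp: is_normal_def)

lemma is_normal_cone: "is_normal a \<nu> \<Longrightarrow> x \<in> arc_cone a \<Longrightarrow> \<nu> \<bullet> x = 0"
  by (auto simp: is_normal_def arc_cone_def inner_add_right)

lemma is_normal_icone: "is_normal a \<nu> \<Longrightarrow> x \<in> arc_icone a \<Longrightarrow> \<nu> \<bullet> x = 0"
  using is_normal_cone icone_sub_cone by blast

lemma is_normal_plane:
  assumes "valid_arc a" "is_normal a \<nu>" "\<nu> \<bullet> x = 0" "ends a e o'"
  obtains s t where "x = s *\<^sub>R e + t *\<^sub>R o'"
  using plane_span_cross[OF is_normal_nz[OF assms(2)] is_normal_ends[OF assms(2,4)] is_normal_ends[OF assms(2) ends_sym[OF assms(4)]] assms(3) valid_ends_cross[OF assms(1,4)]] .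

lemma is_normal_multiple:
  assumes "valid_arc a" "is_normal a \<nu>"
  obtains k where "k \<noteq> 0" "\<nu> = k *\<^sub>R arc_normal a"
proof -
  let ?n = "arc_normal a"
  have n: "?n \<bullet> ?n \<noteq> 0" using valid_arc_cross[OF assms(1)] by simp
  have "cross3 \<nu> ?n = 0"
    using assms(2) by (simp add: arc_normal_cross Lagrange is_normal_def)
  then have "cross3 ?n \<nu> = 0" using cross_skew[of ?n \<nu>] by simp
  then have e: "(?n \<bullet> ?n) *\<^sub>R \<nu> = (?n \<bullet> \<nu>) *\<^sub>R ?n"
    using Lagrange[of ?n ?n \<nu>] by simp
  have "\<nu> = (1/(?n \<bullet> ?n)) *\<^sub>R ((?n \<bullet> ?n) *\<^sub>R \<nu>)" using n by simp
  also have "\<dots> = ((?n \<bullet> \<nu>)/(?n \<bullet> ?n)) *\<^sub>R ?n" unfolding e by simp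
  finally have f: "\<nu> = ((?n \<bullet> \<nu>)/(?n \<bullet> ?n)) *\<^sub>R ?n" .
  show thesis
    by (rule that[OF _ f]) (metis f is_normal_nz[OF assms(2)] scaleR_zero_left)
qed

lemma is_normal_parallel:
  assumes "valid_arc a" "is_normal a \<nu>" "is_normal a \<mu>"
  obtains k where "k \<noteq> 0" "\<mu> = k *\<^sub>R \<nu>"
proof -
  obtain k where k: "k \<noteq> 0" "\<nu> = k *\<^sub>R arc_normal a" using is_normal_multiple[OF assms(1,2)] .
  obtain l where l: "l \<noteq> 0" "\<mu> = l *\<^sub>R arc_normal a" using is_normal_multiple[OF assms(1,3)] .
  show thesis by (rule that[of "l / k"]) (use k l in auto)
qed

lemma relint_icone: "x \<in> arc_relint a \<Longrightarrow> valid_arc a \<Longrightarrow> x \<in> arc_icone a"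
proof -
  assume x: "x \<in> arc_relint a" and v: "valid_arc a"
  then obtain t where t: "0 < t" "t < 1" "x = sgn ((1 - t) *\<^sub>R fst a + t *\<^sub>R snd a)"
    unfolding arc_relint_def arc_pt_def by auto
  let ?y = "(1 - t) *\<^sub>R fst a + t *\<^sub>R snd a"
  have y: "?y \<in> arc_icone a" unfolding arc_icone_def using t by (intro CollectI exI[of _ "1-t"] exI[of _ t]) simp
  then have "?y \<noteq> 0" using icone_nonzero[OF v] by blast
  then show ?thesis using icone_scale[OF y, of "inverse (norm ?y)"] by (simp add: t(3) sgn_div_norm)
qed

lemma cone_ptE:
  assumes "0 \<le> s" "0 \<le> t" "0 < s + t"
  shows "sgn (s *\<^sub>R fst a + t *\<^sub>R snd a) = arc_pt a (t/(s+t))"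
proof -
  have "s *\<^sub>R fst a + t *\<^sub>R snd a = (s+t) *\<^sub>R ((1 - t/(s+t)) *\<^sub>R fst a + (t/(s+t)) *\<^sub>R snd a)"
  proof -
    have "1 - t/(s+t) = s/(s+t)" using assms(3) by (simp add: field_simps)
    then show ?thesis using assms(3) by (simp add: scaleR_right_distrib)
  qed
  then have "sgn (s *\<^sub>R fst a + t *\<^sub>R snd a) = sgn (s+t) *\<^sub>R sgn ((1 - t/(s+t)) *\<^sub>R fst a + (t/(s+t)) *\<^sub>R snd a)"
    by (simp only: sgn_scaleR)
  then show ?thesis using assms(3) unfolding arc_pt_def by (simp only: sgn_pos scaleR_one)
qed

lemma icone_relint: "x \<in> arc_icone a \<Longrightarrow> sgn x \<in> arc_relint a"
  unfolding arc_icone_def arc_relint_def by (auto simp: cone_ptE)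

lemma cone_arc_set: assumes "x \<in> arc_cone a" "x \<noteq> 0" shows "sgn x \<in> arc_set a"
proof -
  obtain s t where st: "0 \<le> s" "0 \<le> t" "x = s *\<^sub>R fst a + t *\<^sub>R snd a" using assms unfolding arc_cone_def by auto
  have "0 < s + t"
  proof (rule ccontr)
    assume "\<not> 0 < s + t"
    then have "s = 0" "t = 0" using st by auto
    then show False using st assms(2) by simp
  qed
  then show ?thesis unfolding st(3) cone_ptE[OF st(1,2) \<open>0 < s + t\<close>] arc_set_def using st \<open>0 < s + t\<close> by (intro imageI) simp
qed

text \<open>A boundary ray of a plane cone is a face: if a positive combination of two points lies
  on it, so do both points, which are then parallel.\<close>

lemma cone_sum_icone:
  assumes v: "valid_arc a" and xy: "x \<in> arc_cone a" "y \<in> arc_cone a" "cross3 x y \<noteq> 0" and gh: "0 < g" "0 < h"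
  shows "g *\<^sub>R x + h *\<^sub>R y \<in> arc_icone a"
proof -
  have "cross3 (g *\<^sub>R x + h *\<^sub>R y) y = g *\<^sub>R cross3 x y" by (simp add: cross_add_left cross_mult_left)
  then have n: "g *\<^sub>R x + h *\<^sub>R y \<noteq> 0" using xy gh by (metis cross_zero_left less_irrefl scaleR_eq_0_iff)
  have gh0: "0 \<le> g" "0 \<le> h" using gh by auto
  from cone_cases[OF cone_comb[OF xy(1,2) gh0] n] show ?thesis
  proof cases
    case 1 then show ?thesis .
  next
    case (2 k e o')
    obtain s t where st: "0 \<le> s" "0 \<le> t" "x = s *\<^sub>R e + t *\<^sub>R o'" using xy(1) unfolding ends_cone[OF 2(1)] by auto
    obtain s' t' where st': "0 \<le> s'" "0 \<le> t'" "y = s' *\<^sub>R e + t' *\<^sub>R o'" using xy(2) unfolding ends_cone[OF 2(1)] by auto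
    have "(g * s + h * s') *\<^sub>R e + (g * t + h * t') *\<^sub>R o' = k *\<^sub>R e + 0 *\<^sub>R o'"
      using 2(3) unfolding st(3) st'(3) by (simp add: algebra_simps)
    from valid_ends_unique(2)[OF v 2(1) this] have "g * t = 0" "h * t' = 0"
      using st st' gh by (simp_all add: add_nonneg_eq_0_iff)
    then have "t = 0" "t' = 0" using gh by auto
    then have "cross3 x y = 0" unfolding st(3) st'(3) by (simp add: cross_mult_left cross_mult_right)
    then show ?thesis using xy by simp
  qed
qed

section \<open>Blocking and touching arcs of a diagram\<close>

locale spherical =
  fixes D :: "arc set"
  assumes sd: "spherical_diagram D"
begin

lemma fin: "finite D" and nonempty: "D \<noteq> {}" and valid: "a \<in> D \<Longrightarrow> valid_arc a"
  using sd by (auto simp: spherical_diagram_def)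

lemma icone_disjoint: assumes "a \<in> D" "b \<in> D" "x \<in> arc_icone a" "x \<in> arc_icone b" shows "a = b"
  using icone_relint[OF assms(3)] icone_relint[OF assms(4)] assms(1,2) sd
  unfolding spherical_diagram_def by blast

lemma blocked: assumes "b \<in> D" "ends b e o'" obtains a where "a \<in> D" "e \<in> arc_icone a"
proof -
  have "\<exists>a\<in>D. e \<in> arc_relint a" using assms sd unfolding spherical_diagram_def ends_def by blast
  then show thesis using relint_icone valid that by blast
qed

text \<open>Otherwise the interiors of the two arcs would overlap.\<close>
lemma hit_transversal:
  assumes "a \<in> D" "b \<in> D" "ends b e o'" "e \<in> arc_icone a" "is_normal a \<nu>"
  shows "\<nu> \<bullet> o' \<noteq> 0"
proof
  assume z: "\<nu> \<bullet> o' = 0"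
  obtain s t where st: "o' = s *\<^sub>R fst a + t *\<^sub>R snd a"
    using is_normal_plane[OF valid[OF assms(1)] assms(5) z ends_fst] .
  obtain p q where pq: "0 < p" "0 < q" "e = p *\<^sub>R fst a + q *\<^sub>R snd a" using assms(4) unfolding arc_icone_def by auto
  \<comment> \<open>Small enough that adding \<epsilon> o' keeps both coefficients of e positive;
    the summand 1 guards against s = 0 or t = 0, and the halving gives strictness.\<close>
  define \<epsilon> where "\<epsilon> = min (p / (\<bar>s\<bar> + 1)) (q / (\<bar>t\<bar> + 1)) / 2"
  have e0: "0 < \<epsilon>" unfolding \<epsilon>_def using pq by (simp add: min_def)
  have "\<epsilon> * (\<bar>s\<bar> + 1) \<le> p / 2" "\<epsilon> * (\<bar>t\<bar> + 1) \<le> q / 2"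
  proof -
    have "2 * \<epsilon> \<le> p / (\<bar>s\<bar> + 1)" "2 * \<epsilon> \<le> q / (\<bar>t\<bar> + 1)" unfolding \<epsilon>_def by auto
    then have "2 * \<epsilon> * (\<bar>s\<bar> + 1) \<le> p" "2 * \<epsilon> * (\<bar>t\<bar> + 1) \<le> q" by (simp_all add: pos_le_divide_eq)
    then show "\<epsilon> * (\<bar>s\<bar> + 1) \<le> p / 2" "\<epsilon> * (\<bar>t\<bar> + 1) \<le> q / 2"
      by simp_all
  qed
  then have "\<epsilon> * \<bar>s\<bar> < p" "\<epsilon> * \<bar>t\<bar> < q" using pq e0 by (simp_all add: algebra_simps)
  moreover have "\<bar>\<epsilon> * s\<bar> = \<epsilon> * \<bar>s\<bar>" "\<bar>\<epsilon> * t\<bar> = \<epsilon> * \<bar>t\<bar>" using e0 by (simp_all add: abs_mult)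
  ultimately have "0 < p + \<epsilon> * s" "0 < q + \<epsilon> * t" by linarith+
  then have "e + \<epsilon> *\<^sub>R o' \<in> arc_icone a"
    unfolding arc_icone_def pq(3) st
    by (intro CollectI exI[of _ "p + \<epsilon> * s"] exI[of _ "q + \<epsilon> * t"]) (simp add: algebra_simps)
  moreover have i: "e + \<epsilon> *\<^sub>R o' \<in> arc_icone b"
    unfolding ends_icone[OF assms(3)] using e0 by (intro exI[of _ 1] exI[of _ \<epsilon>]) simp
  ultimately have "a = b" using icone_disjoint assms by blast
  then show False using end_notin_icone[OF valid[OF assms(2)] assms(3), of 1] assms(4) by simp
qed

lemma not_self_hit: assumes "b \<in> D" "ends b e o'" "e \<in> arc_icone a" shows "a \<noteq> b"
  using end_notin_icone[OF valid[OF assms(1)] assms(2), of 1] assms(3) by auto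

text \<open>Two different arcs share at most one point: for independent common points the sum would
  be interior to both arcs.\<close>

lemma touch_parallel:
  assumes "a \<in> D" "b \<in> D" "a \<noteq> b" "x \<in> arc_cone a" "x \<in> arc_cone b" "y \<in> arc_cone a" "y \<in> arc_cone b"
  shows "cross3 x y = 0"
proof (rule ccontr)
  assume "cross3 x y \<noteq> 0"
  then have "1 *\<^sub>R x + 1 *\<^sub>R y \<in> arc_icone a" "1 *\<^sub>R x + 1 *\<^sub>R y \<in> arc_icone b"
    using cone_sum_icone[of _ x y 1 1] valid assms by simp_all
  then show False using assms icone_disjoint by blast
qed

text \<open>Both ends are common points of the two arcs, hence parallel; but an interior point of
  \<open>a\<close> is not parallel to an end of \<open>a\<close>. This is what finally stops the
  chains of blocking arcs.\<close>

lemma no_mutual_hit: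
  assumes "a \<in> D" "b \<in> D" "ends a e o'" "ends b f o''" "e \<in> arc_icone b" "f \<in> arc_icone a"
  shows False
proof -
  have ab: "a \<noteq> b" using not_self_hit assms by blast
  obtain \<nu> where "is_normal b \<nu>" using is_normal_arc_normal valid assms(2) by blast
  have "cross3 e f = 0"
    using touch_parallel[OF assms(1,2) ab] ends_in_cone[OF assms(3)] ends_in_cone[OF assms(4)] icone_sub_cone assms by blast
  moreover obtain s t where st: "0 < s" "0 < t" "f = s *\<^sub>R e + t *\<^sub>R o'" using ends_icone[OF assms(3)] assms(6) by auto
  ultimately have "t *\<^sub>R cross3 e o' = 0" by (simp add: cross_add_right cross_mult_right)
  then show False using st valid_ends_cross[OF valid[OF assms(1)] assms(3)] by simp
qed

end

subsection \<open>Maximal convex cones missing a diagram\<close>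

text \<open>Shifting a good vector along the new normal n spoils any of the conditions for at most
  one value of the shift.\<close>

lemma finite_avoid_hyperplanes:
  fixes F :: "(real^3) set"
  assumes "finite F" "0 \<notin> F"
  shows "\<exists>d. \<forall>n\<in>F. n \<bullet> d \<noteq> 0"
  using assms
proof (induction F rule: finite_induct)
  case empty then show ?case by simp
next
  case (insert n F)
  then obtain d where d: "\<forall>m\<in>F. m \<bullet> d \<noteq> 0" by auto
  have "finite ((\<lambda>m. - (m \<bullet> d) / (m \<bullet> n)) ` insert n F)" using insert by simp
  then obtain \<epsilon> :: real where \<epsilon>: "\<epsilon> \<notin> (\<lambda>m. - (m \<bullet> d) / (m \<bullet> n)) ` insert n F"
    using ex_new_if_finite[OF infinite_UNIV_char_0] by blast
  have "m \<bullet> (d + \<epsilon> *\<^sub>R n) \<noteq> 0" if m: "m \<in> insert n F" for m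
  proof
    assume "m \<bullet> (d + \<epsilon> *\<^sub>R n) = 0"
    then have e: "m \<bullet> d + \<epsilon> * (m \<bullet> n) = 0" by (simp add: inner_add_right)
    show False
    proof (cases "m \<bullet> n = 0")
      case True
      then have "m \<noteq> n" using insert by auto
      then show False using e True d m by auto
    next
      case False
      then have "\<epsilon> = - (m \<bullet> d) / (m \<bullet> n)" using e by (simp add: field_simps)
      then show False using \<epsilon> m by blast
    qed
  qed
  then show ?case by blast
qed

text \<open>Along the segment every functional is affine, and \<open>r i\<close> is its zero. The
  smallest zero among the functionals that are nonpositive at x is where the segment first leaves
  the cone.\<close>

lemma exit_point:
  fixes \<phi> :: "'i \<Rightarrow> real^3"
  assumes "finite I" "\<And>i. i \<in> I \<Longrightarrow> 0 < \<phi> i \<bullet> k" "i0 \<in> I" "\<phi> i0 \<bullet> x \<le> 0"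
  obtains s j where "0 < s" "s \<le> 1" "j \<in> I" "\<phi> j \<bullet> ((1 - s) *\<^sub>R k + s *\<^sub>R x) = 0"
    "\<And>i. i \<in> I \<Longrightarrow> 0 \<le> \<phi> i \<bullet> ((1 - s) *\<^sub>R k + s *\<^sub>R x)"
proof -
  define J where "J = {i \<in> I. \<phi> i \<bullet> x \<le> 0}"
  define r where "r i = (\<phi> i \<bullet> k) / (\<phi> i \<bullet> k - \<phi> i \<bullet> x)" for i
  define s where "s = Min (r ` J)"
  have J: "finite (r ` J)" "r ` J \<noteq> {}" using assms unfolding J_def by auto
  then obtain j where j: "j \<in> J" "s = r j" using Min_in unfolding s_def by blast
  have kpos: "0 < \<phi> i \<bullet> k" "0 < \<phi> i \<bullet> k - \<phi> i \<bullet> x" if "i \<in> J" for i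
    using that assms(2)[of i] unfolding J_def by auto
  have s0: "0 < s" using kpos[OF j(1)] unfolding j(2) r_def by simp
  have s1: "s \<le> 1" using kpos[OF j(1)] j(1) unfolding j(2) r_def J_def by simp
  have eq: "\<phi> i \<bullet> ((1 - s) *\<^sub>R k + s *\<^sub>R x) = \<phi> i \<bullet> k - s * (\<phi> i \<bullet> k - \<phi> i \<bullet> x)" for i
    by (simp add: inner_add_right algebra_simps)
  have z: "\<phi> j \<bullet> ((1 - s) *\<^sub>R k + s *\<^sub>R x) = 0"
  proof -
    have "s * (\<phi> j \<bullet> k - \<phi> j \<bullet> x) = \<phi> j \<bullet> k" unfolding j(2) r_def using kpos[OF j(1)] by simp
    then show ?thesis unfolding eq by simp
  qed
  have nn: "0 \<le> \<phi> i \<bullet> ((1 - s) *\<^sub>R k + s *\<^sub>R x)" if i: "i \<in> I" for i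
  proof (cases "i \<in> J")
    case True
    then have "s \<le> r i" unfolding s_def using J by simp
    then show ?thesis unfolding eq using kpos[OF True] unfolding r_def by (simp add: pos_le_divide_eq)
  next
    case False
    then have "0 < \<phi> i \<bullet> x" using i unfolding J_def by auto
    then show ?thesis using s0 s1 assms(2)[OF i] by (simp add: inner_add_right)
  qed
  have jI: "j \<in> I" using j unfolding J_def by auto
  show thesis using that[OF s0 s1 jI z nn] .
qed

lemma open_positive:
  fixes m x :: "real^3"
  assumes "open S" "x \<in> S" "m \<noteq> 0" "\<And>y. y \<in> S \<Longrightarrow> 0 \<le> m \<bullet> y"
  shows "0 < m \<bullet> x"
proof -
  obtain e where e: "0 < e" "ball x e \<subseteq> S" using assms(1,2) open_contains_ball by blast
  define c where "c = e / (2 * norm m)"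
  have c: "0 < c" "c * norm m < e" unfolding c_def using e assms(3) by auto
  then have "x - c *\<^sub>R m \<in> S" using e(2) by (auto simp: dist_norm)
  then have "0 \<le> m \<bullet> (x - c *\<^sub>R m)" by (rule assms(4))
  then have "c * (m \<bullet> m) \<le> m \<bullet> x" by (simp add: inner_diff_right)
  moreover have "0 < c * (m \<bullet> m)" using c assms(3) by simp
  ultimately show ?thesis by simp
qed

lemma cone_nonpos: "ends a e o' \<Longrightarrow> m \<bullet> e \<le> 0 \<Longrightarrow> m \<bullet> o' \<le> 0 \<Longrightarrow> x \<in> arc_cone a \<Longrightarrow> m \<bullet> x \<le> 0"
  by (auto simp: ends_cone inner_add_right mult_nonneg_nonpos add_nonpos_nonpos)

text \<open>The bound covers all smaller \<delta> as well, so that bounds for the two ends of an arc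
  can be combined by taking the minimum.\<close>

lemma small_perturb:
  fixes x y :: real
  assumes "x < 0"
  obtains \<epsilon> where "0 < \<epsilon>" "\<And>\<delta>. 0 < \<delta> \<Longrightarrow> \<delta> \<le> \<epsilon> \<Longrightarrow> x + \<delta> * y \<le> 0"
proof
  show "0 < - x / (\<bar>y\<bar> + 1)" using assms by (simp add: divide_less_0_iff)
  fix \<delta> assume d: "0 < \<delta>" "\<delta> \<le> - x / (\<bar>y\<bar> + 1)"
  have "0 < \<bar>y\<bar> + 1" by simp
  from d(2) have "\<delta> * (\<bar>y\<bar> + 1) \<le> - x" unfolding pos_le_divide_eq[OF \<open>0 < \<bar>y\<bar> + 1\<close>] .
  moreover have "\<delta> * y \<le> \<delta> * (\<bar>y\<bar> + 1)" using d by (intro mult_left_mono) auto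
  ultimately show "x + \<delta> * y \<le> 0" by simp
qed

text \<open>One functional is attached to each arc, including arcs far from the cone. Maximality can
  then be exploited by changing the functional of each arc separately.\<close>

definition halfspaces :: "arc set \<Rightarrow> (arc \<Rightarrow> pt) \<Rightarrow> pt set" where
  "halfspaces D \<mu> = {x. \<forall>a\<in>D. 0 < \<mu> a \<bullet> x}"

lemma open_halfspaces: "finite D \<Longrightarrow> open (halfspaces D \<mu>)"
proof -
  assume "finite D"
  have "halfspaces D \<mu> = (\<Inter>a\<in>D. {x. 0 < \<mu> a \<bullet> x})" unfolding halfspaces_def by auto
  then show ?thesis using \<open>finite D\<close> by (auto intro!: open_INT open_halfspace_gt)
qed

lemma convex_halfspaces: "convex (halfspaces D \<mu>)"
proof -
  have "halfspaces D \<mu> = (\<Inter>a\<in>D. {x. 0 < \<mu> a \<bullet> x})" unfolding halfspaces_def by auto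
  then show ?thesis by (auto intro!: convex_INT convex_halfspace_gt)
qed

context spherical
begin

text \<open>Centrally project to an affine plane: an endpoint of maximal norm would lie strictly between two
other endpoints.\<close>
lemma no_hemisphere: 
  assumes "\<And>b. b \<in> D \<Longrightarrow> m \<bullet> fst b < 0 \<and> m \<bullet> snd b < 0"
  shows False
proof -
  define E where "E = fst ` D \<union> snd ` D"
  \<comment> \<open>Central projection onto the affine plane where m equals -1.\<close>
  define h where "h e = (1 / (- (m \<bullet> e))) *\<^sub>R e" for e
  define g where "g e = norm (h e)" for e
  have E: "finite (g ` E)" "g ` E \<noteq> {}" using fin nonempty unfolding E_def by auto
  obtain e where e: "e \<in> E" "g e = Max (g ` E)" using Max_in[OF E] by (metis imageE)
  have emax: "g x \<le> g e" if "x \<in> E" for x using that E e by simp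
  obtain b where b: "b \<in> D" "e = fst b \<or> e = snd b" using e unfolding E_def by auto
  then obtain o' where "ends b e o'" unfolding ends_def by blast
  then obtain a where a: "a \<in> D" "e \<in> arc_icone a" using blocked b(1) by blast
  then obtain s t where st: "0 < s" "0 < t" "e = s *\<^sub>R fst a + t *\<^sub>R snd a" unfolding arc_icone_def by auto
  define U V where "U = h (fst a)" and "V = h (snd a)"
  define u v where "u = - (m \<bullet> fst a)" and "v = - (m \<bullet> snd a)"
  have uv: "0 < u" "0 < v" using assms[OF a(1)] unfolding u_def v_def by auto
  have me: "- (m \<bullet> e) = s * u + t * v" unfolding st(3) u_def v_def by (simp add: inner_add_right)
  define w where "w = s * u + t * v"
  have w: "0 < w" unfolding w_def using st uv by (simp add: add_pos_pos)
  define \<sigma> \<tau> where "\<sigma> = s * u / w" and "\<tau> = t * v / w"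
  have st1: "0 < \<sigma>" "0 < \<tau>" "\<sigma> + \<tau> = 1" unfolding \<sigma>_def \<tau>_def using st uv w
    by (auto simp: w_def add_divide_distrib[symmetric])
  have he: "h e = \<sigma> *\<^sub>R U + \<tau> *\<^sub>R V"
  proof -
    have "h e = (1/w) *\<^sub>R e" unfolding h_def me w_def by simp
    also have "\<dots> = (s/w) *\<^sub>R fst a + (t/w) *\<^sub>R snd a" unfolding st(3) by (simp add: scaleR_right_distrib)
    also have "(s/w) *\<^sub>R fst a = \<sigma> *\<^sub>R U" unfolding \<sigma>_def U_def h_def using uv(1) by (simp add: u_def)
    also have "(t/w) *\<^sub>R snd a = \<tau> *\<^sub>R V" unfolding \<tau>_def V_def h_def using uv(2) by (simp add: v_def)
    finally show ?thesis .
  qed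
  have \<tau>: "\<tau> = 1 - \<sigma>" using st1 by simp
  \<comment> \<open>Strict convexity of the squared norm, with the defect written out.\<close>
  have "h e \<bullet> h e = \<sigma> * (U \<bullet> U) + \<tau> * (V \<bullet> V) - \<sigma> * \<tau> * ((U - V) \<bullet> (U - V))"
    unfolding he \<tau> by (simp add: inner_add_left inner_add_right inner_diff_left inner_diff_right inner_commute algebra_simps)
  moreover have "U \<bullet> U \<le> h e \<bullet> h e" "V \<bullet> V \<le> h e \<bullet> h e"
    using emax[of "fst a"] emax[of "snd a"] a(1) unfolding E_def g_def U_def V_def
    by (auto simp: norm_le)
  then have "\<sigma> * (U \<bullet> U) \<le> \<sigma> * (h e \<bullet> h e)" "\<tau> * (V \<bullet> V) \<le> \<tau> * (h e \<bullet> h e)" using st1 by auto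
  moreover have "\<sigma> * (h e \<bullet> h e) + \<tau> * (h e \<bullet> h e) = h e \<bullet> h e"
    using st1 by (metis distrib_right mult_1)
  ultimately have "\<sigma> * \<tau> * ((U - V) \<bullet> (U - V)) \<le> 0" by linarith
  then have "(U - V) \<bullet> (U - V) \<le> 0" using st1 by (simp add: mult_le_0_iff)
  then have "U = V" by (metis order_antisym inner_eq_zero_iff inner_ge_zero right_minus_eq)
  then have "(1/u) *\<^sub>R fst a + 0 *\<^sub>R snd a = 0 *\<^sub>R fst a + (1/v) *\<^sub>R snd a"
    unfolding U_def V_def h_def u_def v_def by simp
  from valid_ends_unique(1)[OF valid[OF a(1)] ends_fst this] uv show False by simp
qed

text \<open>Zorn's lemma is started at a cell of the arrangement of all arc planes that has p in its
  closure. A maximal convex cone is separated from each arc by a hyperplane, and maximality makes it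
  equal to the intersection of the resulting half-spaces.\<close>

lemma maximal_region:
  obtains L k where
    "\<And>a x. a \<in> D \<Longrightarrow> x \<in> arc_cone a \<Longrightarrow> L a \<bullet> x \<le> 0"
    "k \<in> halfspaces D L" "\<And>a. a \<in> D \<Longrightarrow> 0 \<le> L a \<bullet> (p::pt)"
    "\<And>\<mu>. (\<And>a x. a \<in> D \<Longrightarrow> x \<in> arc_cone a \<Longrightarrow> \<mu> a \<bullet> x \<le> 0) \<Longrightarrow> halfspaces D L \<subseteq> halfspaces D \<mu> \<Longrightarrow> halfspaces D \<mu> \<subseteq> halfspaces D L"
proof -
  have "0 \<notin> arc_normal ` D" using valid_arc_cross valid by (metis imageE)
  then obtain d where d: "\<forall>n\<in>arc_normal ` D. n \<bullet> d \<noteq> 0" using finite_avoid_hyperplanes fin by blast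
  \<comment> \<open>The sign of each normal is chosen so that p + \<epsilon> d lies strictly on its
    positive side for all small \<epsilon> > 0; where p lies on the plane, d decides.\<close>
  define c where "c a = (if arc_normal a \<bullet> p = 0 then arc_normal a \<bullet> d else arc_normal a \<bullet> p)" for a
  define \<kappa> where "\<kappa> a = c a *\<^sub>R arc_normal a" for a
  define K0 where "K0 = halfspaces D \<kappa>"
  have "\<forall>\<^sub>F \<epsilon> in at_right (0::real). 0 < \<kappa> a \<bullet> (p + \<epsilon> *\<^sub>R d)" if a: "a \<in> D" for a
  proof (cases "arc_normal a \<bullet> p = 0")
    case True
    have "\<forall>\<^sub>F \<epsilon> in at_right (0::real). 0 < \<epsilon>" by (simp add: eventually_at_right_less)
    then show ?thesis
      by eventually_elim (use True a d in \<open>auto simp: \<kappa>_def c_def inner_add_right zero_less_mult_iff neq_iff\<close>)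
  next
    case False
    have "((\<lambda>\<epsilon>. \<kappa> a \<bullet> (p + \<epsilon> *\<^sub>R d)) \<longlongrightarrow> \<kappa> a \<bullet> (p + 0 *\<^sub>R d)) (at_right 0)"
      by (intro tendsto_intros)
    moreover have "0 < \<kappa> a \<bullet> (p + 0 *\<^sub>R d)" using False by (auto simp: \<kappa>_def c_def zero_less_mult_iff neq_iff)
    ultimately show ?thesis by (rule order_tendstoD(1))
  qed
  then have ev: "\<forall>\<^sub>F \<epsilon> in at_right (0::real). p + \<epsilon> *\<^sub>R d \<in> K0"
    unfolding K0_def halfspaces_def using fin by (simp add: eventually_ball_finite)
  then have K0ne: "K0 \<noteq> {}" using eventually_happens[OF ev] by auto
  define A where "A = {K. open K \<and> convex K \<and> K0 \<subseteq> K \<and> (\<forall>a\<in>D. K \<inter> arc_cone a = {})}"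
  have K0A: "K0 \<in> A" unfolding A_def
  proof (intro CollectI conjI ballI)
    show "open K0" "convex K0" "K0 \<subseteq> K0" unfolding K0_def using open_halfspaces[OF fin] convex_halfspaces by auto
    fix a assume a: "a \<in> D"
    have "\<kappa> a \<bullet> x = 0" if "x \<in> arc_cone a" for x
      using is_normal_cone[OF is_normal_arc_normal[OF valid[OF a]] that] by (simp add: \<kappa>_def)
    then show "K0 \<inter> arc_cone a = {}" using a unfolding K0_def halfspaces_def by force
  qed
  have "\<exists>M\<in>A. \<forall>X\<in>A. M \<subseteq> X \<longrightarrow> X = M"
  proof (rule subset_Zorn_nonempty)
    show "A \<noteq> {}" using K0A by auto
    fix C assume C: "C \<noteq> {}" "subset.chain A C"
    then have CA: "C \<subseteq> A" and ch: "\<And>X Y. X \<in> C \<Longrightarrow> Y \<in> C \<Longrightarrow> X \<subseteq> Y \<or> Y \<subseteq> X"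
      unfolding subset.chain_def by auto
    show "\<Union>C \<in> A" unfolding A_def
    proof (intro CollectI conjI ballI)
      show "open (\<Union>C)" using CA unfolding A_def by (auto intro: open_Union)
      show "K0 \<subseteq> \<Union>C" using C CA unfolding A_def by auto
      show "\<Union>C \<inter> arc_cone a = {}" if "a \<in> D" for a using CA that unfolding A_def by blast
      show "convex (\<Union>C)"
      proof (rule convexI)
        fix x y and u v :: real assume h: "x \<in> \<Union>C" "y \<in> \<Union>C" "0 \<le> u" "0 \<le> v" "u + v = 1"
        then obtain X Y where XY: "X \<in> C" "x \<in> X" "Y \<in> C" "y \<in> Y" by auto
        then obtain Z where Z: "Z \<in> C" "x \<in> Z" "y \<in> Z" using ch[OF XY(1,3)] by blast
        then have "convex Z" using CA unfolding A_def by auto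
        then have "u *\<^sub>R x + v *\<^sub>R y \<in> Z" using Z h by (simp add: convexD)
        then show "u *\<^sub>R x + v *\<^sub>R y \<in> \<Union>C" using Z by auto
      qed
    qed
  qed
  then obtain K where KA: "K \<in> A" and Kmax: "\<And>X. X \<in> A \<Longrightarrow> K \<subseteq> X \<Longrightarrow> X = K" by blast
  then have K: "open K" "convex K" "K0 \<subseteq> K" "\<And>a. a \<in> D \<Longrightarrow> K \<inter> arc_cone a = {}" unfolding A_def by auto
  have "\<exists>m. (\<forall>x\<in>arc_cone a. m \<bullet> x \<le> 0) \<and> (\<forall>x\<in>K. 0 < m \<bullet> x)" if a: "a \<in> D" for a
  proof -
    have "arc_cone a \<inter> K = {}" using K(4)[OF a] by blast
    moreover have "arc_cone a \<noteq> {}" using zero_in_cone by blast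
    moreover have "K \<noteq> {}" using K(3) K0ne by blast
    ultimately obtain m b where m: "m \<noteq> 0" "\<forall>x\<in>arc_cone a. m \<bullet> x \<le> b" "\<forall>x\<in>K. b \<le> m \<bullet> x"
      using separating_hyperplane_sets[OF convex_arc_cone K(2)] by metis
    have b: "0 \<le> b" using m(2) zero_in_cone[of a] by force
    \<comment> \<open>A linear functional bounded above on a cone is nonpositive on it, so the
      separating level can be moved to 0.\<close>
    have "m \<bullet> x \<le> 0" if x: "x \<in> arc_cone a" for x
    proof (rule ccontr)
      assume "\<not> m \<bullet> x \<le> 0"
      then have p: "0 < m \<bullet> x" by simp
      have "((b + 1) / (m \<bullet> x)) *\<^sub>R x \<in> arc_cone a" using b p by (intro cone_scale[OF x]) simp
      then have "m \<bullet> (((b + 1) / (m \<bullet> x)) *\<^sub>R x) \<le> b" using m(2) by blast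
      then show False using p by simp
    qed
    moreover have "0 < m \<bullet> x" if "x \<in> K" for x
      by (rule open_positive[OF K(1) that m(1)]) (use m(3) b in force)
    ultimately show ?thesis by blast
  qed
  then obtain L where L: "\<And>a x. a \<in> D \<Longrightarrow> x \<in> arc_cone a \<Longrightarrow> L a \<bullet> x \<le> 0" "\<And>a x. a \<in> D \<Longrightarrow> x \<in> K \<Longrightarrow> 0 < L a \<bullet> x"
    by metis
  have HA: "halfspaces D \<mu> \<in> A" if "\<And>a x. a \<in> D \<Longrightarrow> x \<in> arc_cone a \<Longrightarrow> \<mu> a \<bullet> x \<le> 0" "K \<subseteq> halfspaces D \<mu>" for \<mu>
    unfolding A_def
  proof (intro CollectI conjI ballI)
    show "open (halfspaces D \<mu>)" "convex (halfspaces D \<mu>)" using open_halfspaces[OF fin] convex_halfspaces by auto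
    show "K0 \<subseteq> halfspaces D \<mu>" using K(3) that(2) by auto
    show "halfspaces D \<mu> \<inter> arc_cone a = {}" if "a \<in> D" for a
      using that \<open>\<And>a x. a \<in> D \<Longrightarrow> x \<in> arc_cone a \<Longrightarrow> \<mu> a \<bullet> x \<le> 0\<close>[OF that] unfolding halfspaces_def by force
  qed
  have KL: "K \<subseteq> halfspaces D L" using L(2) unfolding halfspaces_def by auto
  have KeqL: "halfspaces D L = K" using Kmax[OF HA[OF L(1) KL] KL] .
  obtain k where k: "k \<in> K0" using K0ne by auto
  show thesis
  proof (rule that[of L k])
    show "\<And>a x. a \<in> D \<Longrightarrow> x \<in> arc_cone a \<Longrightarrow> L a \<bullet> x \<le> 0" by (rule L(1))
    show "k \<in> halfspaces D L" using k K(3) KeqL by auto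
    show "0 \<le> L a \<bullet> p" if a: "a \<in> D" for a
    proof (rule tendsto_lowerbound)
      have "((\<lambda>\<epsilon>. L a \<bullet> (p + \<epsilon> *\<^sub>R d)) \<longlongrightarrow> L a \<bullet> (p + 0 *\<^sub>R d)) (at_right 0)"
        by (intro tendsto_intros)
      then show "((\<lambda>\<epsilon>. L a \<bullet> (p + \<epsilon> *\<^sub>R d)) \<longlongrightarrow> L a \<bullet> p) (at_right 0)" by simp
      show "\<forall>\<^sub>F \<epsilon> in at_right (0::real). 0 \<le> L a \<bullet> (p + \<epsilon> *\<^sub>R d)"
        using ev by eventually_elim (use L(2)[OF a] K(3) in force)
    qed simp
    show "halfspaces D \<mu> \<subseteq> halfspaces D L"
      if "\<And>a x. a \<in> D \<Longrightarrow> x \<in> arc_cone a \<Longrightarrow> \<mu> a \<bullet> x \<le> 0" "halfspaces D L \<subseteq> halfspaces D \<mu>" for \<mu>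
    proof -
      have "halfspaces D \<mu> \<in> A" by (rule HA) (use that KeqL in auto)
      then show ?thesis using Kmax that(2) KeqL by blast
    qed
  qed
qed

end

section \<open>Faces of a maximal region\<close>

locale max_region = spherical +
  fixes L :: "arc \<Rightarrow> pt" and k :: pt
  assumes Lcone: "a \<in> D \<Longrightarrow> x \<in> arc_cone a \<Longrightarrow> L a \<bullet> x \<le> 0"
    and kH: "k \<in> halfspaces D L"
    and Lmax: "(\<And>a x. a \<in> D \<Longrightarrow> x \<in> arc_cone a \<Longrightarrow> \<mu> a \<bullet> x \<le> 0) \<Longrightarrow> halfspaces D L \<subseteq> halfspaces D \<mu> \<Longrightarrow> halfspaces D \<mu> \<subseteq> halfspaces D L"
begin

abbreviation H where "H \<equiv> halfspaces D L"

definition T where "T = {x. \<forall>a\<in>D. 0 \<le> L a \<bullet> x}"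

definition N where "N = {a \<in> D. \<exists>x\<in>T. x \<in> arc_icone a}"

lemma ND: "a \<in> N \<Longrightarrow> a \<in> D" by (simp add: N_def)

lemma Lk: "a \<in> D \<Longrightarrow> 0 < L a \<bullet> k" using kH by (simp add: halfspaces_def)

lemma HT: "x \<in> H \<Longrightarrow> x \<in> T" by (auto simp: halfspaces_def T_def intro: less_imp_le)

lemma T_comb: "x \<in> T \<Longrightarrow> y \<in> T \<Longrightarrow> 0 \<le> s \<Longrightarrow> 0 \<le> t \<Longrightarrow> s *\<^sub>R x + t *\<^sub>R y \<in> T"
  by (auto simp: T_def inner_add_right)

lemma T_scale: "x \<in> T \<Longrightarrow> 0 \<le> s \<Longrightarrow> s *\<^sub>R x \<in> T"
  using T_comb[of x x s 0] by simp

lemma closed_T: "closed T" and convex_T: "convex T"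
proof -
  have "T = (\<Inter>a\<in>D. {x. 0 \<le> L a \<bullet> x})" unfolding T_def by auto
  then show "closed T" "convex T" by (auto intro!: closed_INT closed_halfspace_ge convex_INT convex_halfspace_ge)
qed

text \<open>The usable form of maximality: fresh functionals that separate every arc from the region
  define a region at least as large, hence the same one. If all of them are positive at z, then z
  was inside already.\<close>

lemma extend:
  assumes "\<And>b. b \<in> D \<Longrightarrow> \<exists>m. (\<forall>x\<in>arc_cone b. m \<bullet> x \<le> 0) \<and> (\<forall>x\<in>H. 0 < m \<bullet> x) \<and> 0 < m \<bullet> z"
  shows "z \<in> H"
proof -
  obtain \<mu> where \<mu>: "\<And>b. b \<in> D \<Longrightarrow> (\<forall>x\<in>arc_cone b. \<mu> b \<bullet> x \<le> 0) \<and> (\<forall>x\<in>H. 0 < \<mu> b \<bullet> x) \<and> 0 < \<mu> b \<bullet> z"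
    using assms by metis
  have "H \<subseteq> halfspaces D \<mu>" using \<mu> unfolding halfspaces_def[of D \<mu>] by auto
  then have "halfspaces D \<mu> \<subseteq> H" using Lmax[of \<mu>] \<mu> by blast
  then show ?thesis using \<mu> unfolding halfspaces_def[of D \<mu>] by auto
qed

lemma N_I: "a \<in> D \<Longrightarrow> x \<in> T \<Longrightarrow> x \<in> arc_icone a \<Longrightarrow> a \<in> N"
  by (auto simp: N_def)

lemma blocker_N: assumes "b \<in> D" "ends b e o'" "e \<in> T" shows "\<exists>a\<in>N. e \<in> arc_icone a"
proof -
  obtain a where "a \<in> D" "e \<in> arc_icone a" using blocked[OF assms(1,2)] .
  then show ?thesis using N_I assms(3) by blast
qed

text \<open>The chord of the arc is a compact base of its cone, so it can be strictly separated from
  the closed cone T. Strictness at both ends leaves room for tilting the functional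
  afterwards.\<close>

lemma strict_sep:
  assumes "b \<in> D" "b \<notin> N" "fst b \<notin> T" "snd b \<notin> T"
  shows "\<exists>m. m \<bullet> fst b < 0 \<and> m \<bullet> snd b < 0 \<and> (\<forall>x\<in>T. 0 \<le> m \<bullet> x) \<and> (\<forall>x\<in>H. 0 < m \<bullet> x)"
proof -
  let ?S = "closed_segment (fst b) (snd b)"
  have "?S \<inter> T = {}"
  proof (rule ccontr)
    assume "?S \<inter> T \<noteq> {}"
    then obtain x u where x: "x \<in> T" "0 \<le> u" "u \<le> 1" "x = (1 - u) *\<^sub>R fst b + u *\<^sub>R snd b"
      unfolding closed_segment_def by auto
    consider "u = 0" | "u = 1" | "0 < u" "u < 1" using x by linarith
    then show False
    proof cases
      case 1 then show False using x assms by simp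
    next
      case 2 then show False using x assms by simp
    next
      case 3
      then have "x \<in> arc_icone b" unfolding arc_icone_def x(4) by (intro CollectI exI[of _ "1 - u"] exI[of _ u]) simp
      then show False using N_I x assms by blast
    qed
  qed
  then obtain m \<beta> where m: "\<forall>x\<in>?S. m \<bullet> x < \<beta>" "\<forall>x\<in>T. \<beta> < m \<bullet> x"
    using separating_hyperplane_compact_closed[of ?S T] closed_T convex_T by auto
  have "0 \<in> T" by (simp add: T_def)
  then have b0: "\<beta> < 0" using m(2) by force
  have f: "m \<bullet> fst b < 0" "m \<bullet> snd b < 0" using m(1) b0 by (meson ends_in_segment less_trans)+
  have nn: "0 \<le> m \<bullet> x" if x: "x \<in> T" for x
  proof (rule ccontr)
    assume "\<not> 0 \<le> m \<bullet> x"
    then have n: "m \<bullet> x < 0" by simp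
    then have "(\<beta> / (m \<bullet> x)) *\<^sub>R x \<in> T" using b0 by (intro T_scale[OF x]) (simp add: divide_nonpos_neg)
    then have "\<beta> < m \<bullet> ((\<beta> / (m \<bullet> x)) *\<^sub>R x)" using m(2) by blast
    then show False using n by simp
  qed
  have "m \<noteq> 0" using f by auto
  then have "0 < m \<bullet> x" if "x \<in> H" for x
    by (rule open_positive[OF open_halfspaces[OF fin] that]) (use nn HT in auto)
  then show ?thesis using f nn by blast
qed

text \<open>Without contacts all arcs are strictly separated, and all functionals can be tilted at
  once so that the region grows past a boundary point z. The tilt needs a functional positive at z;
  it exists because no functional is negative at all ends of arcs.\<close>

lemma N_nonempty: "N \<noteq> {}"
proof
  assume N0: "N = {}"
  have nT: "fst b \<notin> T \<and> snd b \<notin> T" if "b \<in> D" for b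
    using blocker_N[OF that ends_fst] blocker_N[OF that ends_snd] unfolding N0 by blast
  have "\<exists>m. m \<bullet> fst b < 0 \<and> m \<bullet> snd b < 0 \<and> (\<forall>x\<in>T. 0 \<le> m \<bullet> x) \<and> (\<forall>x\<in>H. 0 < m \<bullet> x)" if "b \<in> D" for b
    by (rule strict_sep[OF that]) (use nT[OF that] N0 in auto)
  then obtain \<mu> where \<mu>: "\<And>b. b \<in> D \<Longrightarrow> \<mu> b \<bullet> fst b < 0 \<and> \<mu> b \<bullet> snd b < 0 \<and> (\<forall>x\<in>T. 0 \<le> \<mu> b \<bullet> x) \<and> (\<forall>x\<in>H. 0 < \<mu> b \<bullet> x)"
    by metis
  obtain b where b: "b \<in> D" using nonempty by auto
  obtain c where c: "c \<in> D" "\<not> (\<mu> b \<bullet> fst c < 0 \<and> \<mu> b \<bullet> snd c < 0)" using no_hemisphere[of "\<mu> b"] by blast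
  then obtain e where e: "0 \<le> \<mu> b \<bullet> e" "\<mu> c \<bullet> e < 0" using \<mu>[OF c(1)] by (metis not_less)
  obtain s j where s: "0 < s" "s \<le> 1" "j \<in> D" "\<mu> j \<bullet> ((1 - s) *\<^sub>R k + s *\<^sub>R e) = 0"
    "\<And>i. i \<in> D \<Longrightarrow> 0 \<le> \<mu> i \<bullet> ((1 - s) *\<^sub>R k + s *\<^sub>R e)"
    by (rule exit_point[OF fin, of \<mu> k c e]) (use \<mu> kH c e in auto)
  define z where "z = (1 - s) *\<^sub>R k + s *\<^sub>R e"
  \<comment> \<open>Since \<open>\<mu> c\<close> is negative at e, the segment leaves before
    reaching e, so a positive share of k remains in z and makes \<open>\<mu> b\<close> positive
    there.\<close>
  have "s \<noteq> 1" using s(5)[OF c(1)] e by auto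
  then have "0 < (1 - s) * (\<mu> b \<bullet> k)" using s \<mu>[OF b] kH by auto
  then have bz: "0 < \<mu> b \<bullet> z" using s e unfolding z_def by (simp add: inner_add_right add_pos_nonneg)
  define m where "m = (\<Sum>c\<in>D. \<mu> c)"
  have mz: "0 < m \<bullet> z" unfolding m_def inner_sum_left
    by (rule sum_pos2[OF fin b, of "\<lambda>c. \<mu> c \<bullet> z"]) (use bz s(5) z_def in auto)
  have mH: "0 \<le> m \<bullet> x" if "x \<in> H" for x unfolding m_def inner_sum_left
    using \<mu> that by (intro sum_nonneg) (auto intro: less_imp_le)
  have "z \<in> H"
  proof (rule extend)
    fix d assume d: "d \<in> D"
    obtain \<epsilon>1 where e1: "0 < \<epsilon>1" "\<And>\<delta>. 0 < \<delta> \<Longrightarrow> \<delta> \<le> \<epsilon>1 \<Longrightarrow> \<mu> d \<bullet> fst d + \<delta> * (m \<bullet> fst d) \<le> 0"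
      using small_perturb[of "\<mu> d \<bullet> fst d"] \<mu>[OF d] by blast
    obtain \<epsilon>2 where e2: "0 < \<epsilon>2" "\<And>\<delta>. 0 < \<delta> \<Longrightarrow> \<delta> \<le> \<epsilon>2 \<Longrightarrow> \<mu> d \<bullet> snd d + \<delta> * (m \<bullet> snd d) \<le> 0"
      using small_perturb[of "\<mu> d \<bullet> snd d"] \<mu>[OF d] by blast
    define \<epsilon> where "\<epsilon> = min \<epsilon>1 \<epsilon>2"
    have ep: "0 < \<epsilon>" using e1 e2 unfolding \<epsilon>_def by auto
    let ?m = "\<mu> d + \<epsilon> *\<^sub>R m"
    have "?m \<bullet> fst d \<le> 0" "?m \<bullet> snd d \<le> 0" using e1(2)[OF ep] e2(2)[OF ep] unfolding \<epsilon>_def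
      by (auto simp: inner_add_left)
    then have "\<forall>x\<in>arc_cone d. ?m \<bullet> x \<le> 0" using cone_nonpos[OF ends_fst] by blast
    moreover have "\<forall>x\<in>H. 0 < ?m \<bullet> x" using \<mu>[OF d] mH ep by (auto simp: inner_add_left intro!: add_pos_nonneg)
    moreover have "0 < ?m \<bullet> z" using s(5)[OF d] mz ep by (auto simp: inner_add_left z_def intro!: add_nonneg_pos)
    ultimately show "\<exists>m. (\<forall>x\<in>arc_cone d. m \<bullet> x \<le> 0) \<and> (\<forall>x\<in>H. 0 < m \<bullet> x) \<and> 0 < m \<bullet> z" by blast
  qed
  then show False using \<mu>[OF s(3)] s(4) z_def by force
qed

text \<open>The functional is nonpositive at both ends, yet nonnegative at a positive combination of
  them, so it vanishes at both.\<close>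

lemma L_normal: assumes "a \<in> N" shows "is_normal a (L a)"
proof -
  have a: "a \<in> D" using assms ND by blast
  obtain x where x: "x \<in> T" "x \<in> arc_icone a" using assms unfolding N_def by auto
  obtain s t where st: "0 < s" "0 < t" "x = s *\<^sub>R fst a + t *\<^sub>R snd a" using x unfolding arc_icone_def by auto
  have n: "L a \<bullet> fst a \<le> 0" "L a \<bullet> snd a \<le> 0" using Lcone[OF a] ends_in_cone ends_fst ends_snd by blast+
  have "0 \<le> s * (L a \<bullet> fst a) + t * (L a \<bullet> snd a)" using x(1) a unfolding T_def st(3) by (simp add: inner_add_right)
  moreover have "s * (L a \<bullet> fst a) \<le> 0" "t * (L a \<bullet> snd a) \<le> 0" using st n by (simp_all add: mult_le_0_iff)
  ultimately have "s * (L a \<bullet> fst a) = 0" "t * (L a \<bullet> snd a) = 0" by linarith+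
  then show ?thesis using st Lk[OF a] unfolding is_normal_def by auto
qed

text \<open>Otherwise the separating functionals could be tilted so that the region also contains z, against its
maximality.\<close>
lemma interior_point:
  assumes z: "z \<in> T" "\<And>b. b \<in> D \<Longrightarrow> z \<notin> arc_cone b" "\<And>a. a \<in> N \<Longrightarrow> 0 < L a \<bullet> z"
  shows "z \<in> H"
proof (rule extend)
  fix b assume b: "b \<in> D"
  let ?P = "\<lambda>m. (\<forall>x\<in>arc_cone b. m \<bullet> x \<le> 0) \<and> (\<forall>x\<in>H. 0 < m \<bullet> x) \<and> 0 < m \<bullet> z"
  have LP: "0 < L a \<bullet> x" if "a \<in> D" "x \<in> H" for a x using that by (simp add: halfspaces_def)
  show "\<exists>m. ?P m"
  proof (cases "b \<in> N")
    case True then show ?thesis using Lcone[OF b] LP[OF b] z(3) by blast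
  next
    case bN: False
    show ?thesis
    proof (cases "fst b \<in> T \<or> snd b \<in> T")
      case False
      then obtain m where m: "m \<bullet> fst b < 0" "m \<bullet> snd b < 0" "\<And>x. x \<in> T \<Longrightarrow> 0 \<le> m \<bullet> x" "\<And>x. x \<in> H \<Longrightarrow> 0 < m \<bullet> x"
        using strict_sep[OF b bN] by auto
      obtain a where a: "a \<in> N" using N_nonempty by auto
      obtain \<epsilon>1 where e1: "0 < \<epsilon>1" "\<And>\<delta>. 0 < \<delta> \<Longrightarrow> \<delta> \<le> \<epsilon>1 \<Longrightarrow> m \<bullet> fst b + \<delta> * (L a \<bullet> fst b) \<le> 0"
        using small_perturb[OF m(1)] by blast
      obtain \<epsilon>2 where e2: "0 < \<epsilon>2" "\<And>\<delta>. 0 < \<delta> \<Longrightarrow> \<delta> \<le> \<epsilon>2 \<Longrightarrow> m \<bullet> snd b + \<delta> * (L a \<bullet> snd b) \<le> 0"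
        using small_perturb[OF m(2)] by blast
      define \<epsilon> where "\<epsilon> = min \<epsilon>1 \<epsilon>2"
      have ep: "0 < \<epsilon>" using e1 e2 unfolding \<epsilon>_def by auto
      let ?m = "m + \<epsilon> *\<^sub>R L a"
      have "?m \<bullet> fst b \<le> 0" "?m \<bullet> snd b \<le> 0" using e1(2)[OF ep] e2(2)[OF ep] unfolding \<epsilon>_def
        by (auto simp: inner_add_left)
      then have "\<forall>x\<in>arc_cone b. ?m \<bullet> x \<le> 0" using cone_nonpos[OF ends_fst] by blast
      moreover have "\<forall>x\<in>H. 0 < ?m \<bullet> x" using m(4) LP[OF ND[OF a]] ep by (auto simp: inner_add_left intro!: add_pos_pos)
      moreover have "0 < ?m \<bullet> z" using m(3)[OF z(1)] z(3)[OF a] ep by (auto simp: inner_add_left intro!: add_nonneg_pos)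
      ultimately show ?thesis by blast
    next
      case True
      \<comment> \<open>Strict separation fails when an end of b lies in the closed region. The
        blocker of that end is a side whose functional vanishes there, so it can be used for tilting
        without disturbing e.\<close>
      then obtain e o' where eo: "ends b e o'" "e \<in> T" using ends_fst ends_snd by blast
      obtain a where a: "a \<in> N" "e \<in> arc_icone a" using blocker_N[OF b eo] by blast
      have La: "L a \<bullet> e = 0" using is_normal_icone[OF L_normal[OF a(1)] a(2)] .
      have Lb: "L b \<bullet> e = 0" using Lcone[OF b ends_in_cone[OF eo(1)]] eo(2) b unfolding T_def by force
      have Lo: "L b \<bullet> o' \<le> 0" using Lcone[OF b ends_in_cone[OF ends_sym[OF eo(1)]]] .
      show ?thesis
      proof (cases "L a \<bullet> o' \<le> 0")
        case True
        then have "\<forall>x\<in>arc_cone b. L a \<bullet> x \<le> 0" using cone_nonpos[OF eo(1)] La by force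
        then show ?thesis using LP[OF ND[OF a(1)]] z(3)[OF a(1)] by blast
      next
        case pos: False
        show ?thesis
        proof (cases "L b \<bullet> o' < 0")
          case True
          obtain \<epsilon> where e: "0 < \<epsilon>" "\<And>\<delta>. 0 < \<delta> \<Longrightarrow> \<delta> \<le> \<epsilon> \<Longrightarrow> L b \<bullet> o' + \<delta> * (L a \<bullet> o') \<le> 0"
            using small_perturb[OF True] by blast
          let ?m = "L b + \<epsilon> *\<^sub>R L a"
          have "?m \<bullet> e \<le> 0" "?m \<bullet> o' \<le> 0" using e(2)[OF e(1)] La Lb by (auto simp: inner_add_left)
          then have "\<forall>x\<in>arc_cone b. ?m \<bullet> x \<le> 0" using cone_nonpos[OF eo(1)] by blast
          moreover have "\<forall>x\<in>H. 0 < ?m \<bullet> x" using LP[OF b] LP[OF ND[OF a(1)]] e(1) by (auto simp: inner_add_left intro!: add_pos_pos)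
          moreover have "0 < ?m \<bullet> z" using z(1) b z(3)[OF a(1)] e(1) unfolding T_def by (auto simp: inner_add_left intro!: add_nonneg_pos)
          ultimately show ?thesis by blast
        next
          case False
          then have Lo0: "L b \<bullet> o' = 0" using Lo by simp
          have nb: "is_normal b (L b)" using Lb Lo0 eo(1) Lk[OF b] unfolding is_normal_def ends_def by auto
          have "L b \<bullet> z \<noteq> 0"
          proof
            assume "L b \<bullet> z = 0"
            then obtain x y where xy: "z = x *\<^sub>R e + y *\<^sub>R o'" using is_normal_plane[OF valid[OF b] nb _ eo(1)] by blast
            have "0 < y * (L a \<bullet> o')" using z(3)[OF a(1)] La unfolding xy by (simp add: inner_add_right)
            then have y: "0 < y" using pos by (simp add: zero_less_mult_iff)
            have x: "x < 0"
            proof (rule ccontr)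
              assume "\<not> x < 0"
              then have "z \<in> arc_cone b" unfolding ends_cone[OF eo(1)] xy using y by (intro exI[of _ x] exI[of _ y]) simp
              then show False using z(2)[OF b] by blast
            qed
            \<comment> \<open>Because x is negative, o' is a nonnegative combination of z and e.
              Thus an interior point of b lies in T, although b is no side.\<close>
            have "e + o' \<in> T"
            proof -
              have "1 *\<^sub>R e + (1/y) *\<^sub>R (1 *\<^sub>R z + (- x) *\<^sub>R e) \<in> T" using x y by (intro T_comb eo z(1)) auto
              also have "1 *\<^sub>R e + (1/y) *\<^sub>R (1 *\<^sub>R z + (- x) *\<^sub>R e) = e + o'" unfolding xy using y by (simp add: scaleR_right_distrib)
              finally show ?thesis .
            qed
            moreover have "e + o' \<in> arc_icone b" unfolding ends_icone[OF eo(1)] by (intro exI[of _ 1]) simp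
            ultimately show False using N_I b bN by blast
          qed
          then have "0 < L b \<bullet> z" using z(1) b unfolding T_def by force
          then show ?thesis using LP[OF b] Lcone[OF b] by blast
        qed
      qed
    qed
  qed
qed

text \<open>If all sides were positive at z, then z would lie on no arc: an interior point of an arc
  would make that arc a side vanishing at z, and an end would have a blocker with this property. So
  z would be interior.\<close>

lemma boundary_N:
  assumes "z \<in> T" "z \<noteq> 0" "b \<in> D" "L b \<bullet> z = 0"
  shows "\<exists>a\<in>N. L a \<bullet> z = 0"
proof (rule ccontr)
  assume n: "\<not> (\<exists>a\<in>N. L a \<bullet> z = 0)"
  have pos: "0 < L a \<bullet> z" if "a \<in> N" for a
  proof -
    have "L a \<bullet> z \<noteq> 0" "0 \<le> L a \<bullet> z" using n that assms(1) ND[OF that] unfolding T_def by blast+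
    then show ?thesis by simp
  qed
  have "z \<notin> arc_cone d" if d: "d \<in> D" for d
  proof
    assume "z \<in> arc_cone d"
    from cone_cases[OF this assms(2)] show False
    proof cases
      case 1
      then have dN: "d \<in> N" using N_I d assms by blast
      show False using pos[OF dN] is_normal_icone[OF L_normal[OF dN] 1] by simp
    next
      case (2 c e o')
      have "e = (1/c) *\<^sub>R z" using 2 by simp
      then have "e \<in> T" using T_scale[OF assms(1)] 2(2) by simp
      then obtain a where a: "a \<in> N" "e \<in> arc_icone a" using blocker_N[OF d 2(1)] by blast
      then show False using pos[OF a(1)] is_normal_icone[OF L_normal[OF a(1)] a(2)] 2(3) by simp
    qed
  qed
  then have "z \<in> H" using interior_point assms(1) pos by blast
  then show False using assms(3,4) by (force simp: halfspaces_def)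
qed

text \<open>The sides alone cut out the region: a segment from k to x would leave it at a nonzero
  boundary point where all sides are still positive.\<close>

lemma N_interior:
  assumes "\<And>a. a \<in> N \<Longrightarrow> 0 < L a \<bullet> x"
  shows "x \<in> H"
proof (rule ccontr)
  assume "x \<notin> H"
  then obtain b where b: "b \<in> D" "L b \<bullet> x \<le> 0" unfolding halfspaces_def by force
  obtain s j where s: "0 < s" "s \<le> 1" "j \<in> D" "L j \<bullet> ((1 - s) *\<^sub>R k + s *\<^sub>R x) = 0"
    "\<And>i. i \<in> D \<Longrightarrow> 0 \<le> L i \<bullet> ((1 - s) *\<^sub>R k + s *\<^sub>R x)"
    by (rule exit_point[OF fin, of L k b x]) (use Lk b in auto)
  define z where "z = (1 - s) *\<^sub>R k + s *\<^sub>R x"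
  have zT: "z \<in> T" using s(5) unfolding T_def z_def by blast
  have zp: "0 < L a \<bullet> z" if "a \<in> N" for a
    unfolding z_def using s assms[OF that] Lk[OF ND[OF that]] by (simp add: inner_add_right add_nonneg_pos)
  have "z \<noteq> 0" using zp N_nonempty by force
  then show False using boundary_N[OF zT _ s(3)] s(4) zp z_def by (metis less_irrefl)
qed

lemma T_N: "T = {x. \<forall>a\<in>N. 0 \<le> L a \<bullet> x}"
proof
  show "T \<subseteq> {x. \<forall>a\<in>N. 0 \<le> L a \<bullet> x}" unfolding T_def using ND by auto
  show "{x. \<forall>a\<in>N. 0 \<le> L a \<bullet> x} \<subseteq> T"
  proof (clarsimp simp: T_def)
    fix x b assume x: "\<forall>a\<in>N. 0 \<le> L a \<bullet> x" and b: "b \<in> D"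
    have h: "0 \<le> L b \<bullet> x + \<epsilon> * (L b \<bullet> k)" if "0 < \<epsilon>" for \<epsilon>
    proof -
      have "x + \<epsilon> *\<^sub>R k \<in> H" by (rule N_interior) (use x Lk ND that in \<open>auto simp: inner_add_right intro!: add_nonneg_pos\<close>)
      then show ?thesis using b by (force simp: halfspaces_def inner_add_right intro: less_imp_le)
    qed
    show "0 \<le> L b \<bullet> x"
    proof (rule ccontr)
      assume "\<not> 0 \<le> L b \<bullet> x"
      then have n: "L b \<bullet> x < 0" by simp
      define \<epsilon> where "\<epsilon> = - (L b \<bullet> x) / (2 * (L b \<bullet> k))"
      have "0 < \<epsilon>" "\<epsilon> * (L b \<bullet> k) = - (L b \<bullet> x) / 2" unfolding \<epsilon>_def using n Lk[OF b] by (auto simp: divide_less_0_iff)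
      then show False using h[of \<epsilon>] n by simp
    qed
  qed
qed

text \<open>Moving from the contact point w to an outside point y of the same plane passes an end e
  of \<open>a\<close>, except when y is opposite to w. The blocker of e is a side; its functional
  vanishes at e and is nonnegative at w and y, so it vanishes on all of \<open>a\<close>, against
  transversality.\<close>

lemma face_cone_or_opposite:
  assumes a: "a \<in> N" and w: "w \<in> T" "w \<in> arc_icone a" and y: "y \<in> T" "L a \<bullet> y = 0" "y \<notin> arc_cone a"
  obtains c where "0 < c" "y = - c *\<^sub>R w"
proof -
  have aD: "a \<in> D" using a ND by blast
  have no_end: False if eo: "ends a e o'" and gh: "0 < g" "0 < h" "e = g *\<^sub>R w + h *\<^sub>R y" for e o' g h
  proof -
    have eT: "e \<in> T" using T_comb[OF w(1) y(1)] gh by simp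
    obtain b where b: "b \<in> N" "e \<in> arc_icone b" using blocker_N[OF aD eo eT] by blast
    have bD: "b \<in> D" using b ND by blast
    have "0 = g * (L b \<bullet> w) + h * (L b \<bullet> y)" using is_normal_icone[OF L_normal[OF b(1)] b(2)] unfolding gh(3) by (simp add: inner_add_right)
    moreover have "0 \<le> g * (L b \<bullet> w)" "0 \<le> h * (L b \<bullet> y)" using gh w y bD unfolding T_def by auto
    ultimately have "g * (L b \<bullet> w) = 0" by linarith
    then have "L b \<bullet> w = 0" using gh by simp
    obtain s t where st: "0 < s" "0 < t" "w = s *\<^sub>R e + t *\<^sub>R o'" using w(2) unfolding ends_icone[OF eo] by auto
    have "L b \<bullet> o' = 0" using \<open>L b \<bullet> w = 0\<close> st is_normal_icone[OF L_normal[OF b(1)] b(2)] by (simp add: inner_add_right)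
    then show False using hit_transversal[OF bD aD eo b(2) L_normal[OF b(1)]] by blast
  qed
  obtain \<zeta> \<eta> where y': "y = \<zeta> *\<^sub>R fst a + \<eta> *\<^sub>R snd a"
    using is_normal_plane[OF valid[OF aD] L_normal[OF a] y(2) ends_fst] .
  obtain \<alpha> \<beta> where w': "0 < \<alpha>" "0 < \<beta>" "w = \<alpha> *\<^sub>R fst a + \<beta> *\<^sub>R snd a" using w(2) unfolding arc_icone_def by auto
  have neg: "\<zeta> < 0 \<or> \<eta> < 0" 
  proof (rule ccontr)
    assume "\<not> (\<zeta> < 0 \<or> \<eta> < 0)"
    then have "y \<in> arc_cone a" unfolding arc_cone_def y' by (intro CollectI exI[of _ \<zeta>] exI[of _ \<eta>]) simp
    then show False using y(3) by blast
  qed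
  \<comment> \<open>The determinant of w and y in coordinates of the two ends. Its sign tells which
    end lies strictly between w and y; zero means that w and y are parallel.\<close>
  define \<tau> where "\<tau> = \<alpha> * \<eta> - \<beta> * \<zeta>"
  have id1: "\<alpha> *\<^sub>R y + (- \<zeta>) *\<^sub>R w = \<tau> *\<^sub>R snd a" unfolding y' w'(3) \<tau>_def by (simp add: algebra_simps)
  have id2: "\<beta> *\<^sub>R y + (- \<eta>) *\<^sub>R w = (- \<tau>) *\<^sub>R fst a" unfolding y' w'(3) \<tau>_def by (simp add: algebra_simps)
  consider "0 < \<tau>" | "\<tau> < 0" | "\<tau> = 0" by linarith
  then show thesis
  proof cases
    case 1
    have "\<zeta> < 0"
    proof (rule ccontr)
      assume "\<not> \<zeta> < 0"
      then have "0 \<le> \<beta> * \<zeta>" "\<alpha> * \<eta> < 0" using neg w' by (auto simp: mult_less_0_iff)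
      then show False using 1 unfolding \<tau>_def by simp
    qed
    moreover have "snd a = (1/\<tau>) *\<^sub>R (\<alpha> *\<^sub>R y + (- \<zeta>) *\<^sub>R w)" unfolding id1 using 1 by simp
    then have "snd a = (- \<zeta>/\<tau>) *\<^sub>R w + (\<alpha>/\<tau>) *\<^sub>R y" by (simp add: scaleR_right_diff_distrib)
    moreover have "0 < - \<zeta>/\<tau>" "0 < \<alpha>/\<tau>" using \<open>\<zeta> < 0\<close> 1 w' by (auto simp: divide_less_0_iff)
    ultimately show thesis using no_end[OF ends_snd, of "- \<zeta>/\<tau>" "\<alpha>/\<tau>"] by blast
  next
    case 2
    have "\<eta> < 0"
    proof (rule ccontr)
      assume "\<not> \<eta> < 0"
      then have "0 \<le> \<alpha> * \<eta>" "\<beta> * \<zeta> < 0" using neg w' by (auto simp: mult_less_0_iff)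
      then show False using 2 unfolding \<tau>_def by simp
    qed
    moreover have "fst a = (1/(-\<tau>)) *\<^sub>R (\<beta> *\<^sub>R y + (- \<eta>) *\<^sub>R w)" unfolding id2 using 2 by simp
    then have "fst a = (\<eta>/\<tau>) *\<^sub>R w + (\<beta>/(-\<tau>)) *\<^sub>R y" by (simp add: scaleR_right_diff_distrib)
    moreover have "0 < \<eta>/\<tau>" "0 < \<beta>/(-\<tau>)" using \<open>\<eta> < 0\<close> 2 w' by (auto simp: zero_less_divide_iff divide_less_0_iff)
    ultimately show thesis using no_end[OF ends_fst, of "\<eta>/\<tau>" "\<beta>/(-\<tau>)"] by blast
  next
    case 3
    have "\<zeta> < 0"
    proof (rule ccontr)
      assume "\<not> \<zeta> < 0"
      then have "0 \<le> \<beta> * \<zeta>" "\<alpha> * \<eta> < 0" using neg w' by (auto simp: mult_less_0_iff)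
      then show False using 3 unfolding \<tau>_def by simp
    qed
    moreover have "y = (\<zeta>/\<alpha>) *\<^sub>R w"
    proof -
      have "\<alpha> *\<^sub>R y = \<zeta> *\<^sub>R w" using id1 3 by simp
      then have "(1/\<alpha>) *\<^sub>R (\<alpha> *\<^sub>R y) = (1/\<alpha>) *\<^sub>R (\<zeta> *\<^sub>R w)" by simp
      then show ?thesis using w' by simp
    qed
    ultimately show thesis using that[of "- \<zeta>/\<alpha>"] w' by (simp add: zero_less_divide_iff divide_less_0_iff)
  qed
qed

text \<open>A line in T would allow a point z of a face to slide along it out of the arc. By the
  previous lemma the line and the shifted point are then both parallel to the same contact point,
  although z is independent of the line.\<close>

lemma T_pointed: assumes w: "w \<in> T" "- w \<in> T" shows "w = 0"
proof (rule ccontr)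
  assume w0: "w \<noteq> 0"
  have Lw: "L a \<bullet> w = 0" if "a \<in> D" for a using w that unfolding T_def by force
  obtain a0 where a0: "a0 \<in> D" using nonempty by auto
  define m where "m = cross3 w k"
  have mnz: "m \<noteq> 0" unfolding m_def
    by (rule cross_nonzero_functional[of _ "L a0"]) (use w0 Lw[OF a0] Lk[OF a0] in auto)
  obtain \<delta> where d: "0 < \<delta>" "\<And>\<delta>'. 0 < \<delta>' \<Longrightarrow> \<delta>' \<le> \<delta> \<Longrightarrow> - (L a0 \<bullet> k) + \<delta>' * (L a0 \<bullet> m) \<le> 0"
    using small_perturb[of "- (L a0 \<bullet> k)"] Lk[OF a0] by auto
  \<comment> \<open>The term \<delta> m pushes the exit point out of the plane of w and k, while
    \<delta> is so small that the functional of a0 still forces an exit.\<close>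
  define x where "x = - k + \<delta> *\<^sub>R m"
  have x: "L a0 \<bullet> x \<le> 0" unfolding x_def using d(2)[OF d(1)] by (simp add: inner_add_right inner_diff_right)
  obtain s j where s: "0 < s" "s \<le> 1" "j \<in> D" "L j \<bullet> ((1 - s) *\<^sub>R k + s *\<^sub>R x) = 0"
    "\<And>i. i \<in> D \<Longrightarrow> 0 \<le> L i \<bullet> ((1 - s) *\<^sub>R k + s *\<^sub>R x)"
    by (rule exit_point[OF fin, of L k a0 x]) (use Lk a0 x in auto)
  define z where "z = (1 - s) *\<^sub>R k + s *\<^sub>R x"
  have zT: "z \<in> T" using s(5) unfolding T_def z_def by blast
  have mz: "m \<bullet> z = s * \<delta> * (m \<bullet> m)" unfolding z_def x_def m_def
    by (simp add: inner_add_right inner_diff_right dot_cross_self)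
  then have mz0: "m \<bullet> z \<noteq> 0" using s d mnz by simp
  have mw: "m \<bullet> w = 0" unfolding m_def by (metis dot_cross_self(1) inner_commute)
  have z0: "z \<noteq> 0" using mz0 by auto
  obtain a where a: "a \<in> N" "L a \<bullet> z = 0" using boundary_N[OF zT z0 s(3)] s(4) z_def by auto
  have aD: "a \<in> D" using a ND by blast
  obtain t0 where t0: "t0 \<in> T" "t0 \<in> arc_icone a" using a unfolding N_def by auto
  define w' where "w' = (if w \<in> arc_cone a then - w else w)"
  have w': "w' \<in> T" "w' \<notin> arc_cone a" "w' = w \<or> w' = - w"
    unfolding w'_def using cone_pointed[OF valid[OF aD], of w] w w0 by auto
  have Lw': "L a \<bullet> w' = 0" "m \<bullet> w' = 0" using w'(3) Lw[OF aD] mw by auto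
  obtain c where c: "0 < c" "w' = - c *\<^sub>R t0" using face_cone_or_opposite[OF a(1) t0 w'(1) Lw'(1) w'(2)] .
  have mt: "m \<bullet> t0 = 0" using Lw'(2) c by simp
  obtain z1 z2 where z': "z = z1 *\<^sub>R fst a + z2 *\<^sub>R snd a" using is_normal_plane[OF valid[OF aD] L_normal[OF a(1)] a(2) ends_fst] .
  obtain \<alpha> \<beta> where ab: "0 < \<alpha>" "0 < \<beta>" "t0 = \<alpha> *\<^sub>R fst a + \<beta> *\<^sub>R snd a" using t0 unfolding arc_icone_def by auto
  \<comment> \<open>Chosen so that the coefficient of \<open>fst a\<close> becomes z1 - |z1| - 1,
    which is negative.\<close>
  define M where "M = (\<bar>z1\<bar> + 1) / (c * \<alpha>)"
  have M: "0 < M" "M * c * \<alpha> = \<bar>z1\<bar> + 1" unfolding M_def using c ab by auto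
  define y where "y = z + M *\<^sub>R w'"
  have y': "y = (z1 - M * c * \<alpha>) *\<^sub>R fst a + (z2 - M * c * \<beta>) *\<^sub>R snd a"
    unfolding y_def c(2) z' ab(3) by (simp add: algebra_simps)
  have "y \<notin> arc_cone a"
  proof
    assume "y \<in> arc_cone a"
    then obtain s t where st: "0 \<le> s" "y = s *\<^sub>R fst a + t *\<^sub>R snd a" unfolding arc_cone_def by auto
    have "z1 - M * c * \<alpha> = s" using valid_ends_unique(1)[OF valid[OF aD] ends_fst st(2)[unfolded y']] .
    then show False using M st by simp
  qed
  moreover have "y \<in> T" using T_comb[OF zT w'(1), of 1 M] M unfolding y_def by simp
  moreover have "L a \<bullet> y = 0" unfolding y_def using a(2) Lw' by (simp add: inner_add_right)
  ultimately obtain c' where "y = - c' *\<^sub>R t0" using face_cone_or_opposite[OF a(1) t0] by blast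
  then have "m \<bullet> y = 0" using mt by simp
  then show False using mz0 Lw' unfolding y_def by (simp add: inner_add_right)
qed

text \<open>The opposite alternative would place both w and -w in the pointed cone T.\<close>

lemma face_cone:
  assumes "a \<in> N" "y \<in> T" "L a \<bullet> y = 0" shows "y \<in> arc_cone a"
proof (rule ccontr)
  assume n: "y \<notin> arc_cone a"
  obtain w where w: "w \<in> T" "w \<in> arc_icone a" using assms(1) unfolding N_def by auto
  obtain c where c: "0 < c" "y = - c *\<^sub>R w" using face_cone_or_opposite[OF assms(1) w assms(2,3) n] .
  then have "- w \<in> T" using T_scale[OF assms(2), of "1/c"] by simp
  then show False using T_pointed[OF w(1)] icone_nonzero[OF valid[OF ND[OF assms(1)]] w(2)] by blast
qed

end

section \<open>Tiles, independently of the functionals of the other arcs\<close>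

definition region :: "(arc \<Rightarrow> pt) \<Rightarrow> arc set \<Rightarrow> pt set" where
  "region \<nu> N = {x. \<forall>a\<in>N. 0 \<le> \<nu> a \<bullet> x}"

text \<open>The set N consists of the arcs whose relative interior meets the tile, so a corner at which two
sides end on a third arc contributes this third arc as a side of length zero.\<close>
definition tile :: "arc set \<Rightarrow> pt \<Rightarrow> (arc \<Rightarrow> pt) \<Rightarrow> arc set \<Rightarrow> bool" where
  "tile D p \<nu> N \<longleftrightarrow> N \<noteq> {} \<and> N \<subseteq> D \<and> p \<in> region \<nu> N \<and>
     (\<forall>a\<in>N. \<nu> a = arc_normal a \<or> \<nu> a = - arc_normal a) \<and>
     (\<forall>a\<in>D. a \<in> N \<longleftrightarrow> region \<nu> N \<inter> arc_icone a \<noteq> {}) \<and>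
     (\<forall>a\<in>N. \<forall>x\<in>region \<nu> N. \<nu> a \<bullet> x = 0 \<longrightarrow> x \<in> arc_cone a)"

text \<open>From the maximal region only the functionals of sides are kept, rescaled to plus or
  minus \<open>arc_normal\<close>. Because of this normalisation the functionals of two tiles at a
  common side can differ only in sign.\<close>

lemma (in spherical) tile_exists: obtains \<nu> N where "tile D p \<nu> N"
proof (rule maximal_region[of p])
  fix L k
  assume hL: "\<And>a x. a \<in> D \<Longrightarrow> x \<in> arc_cone a \<Longrightarrow> L a \<bullet> x \<le> 0"
    "k \<in> halfspaces D L" "\<And>a. a \<in> D \<Longrightarrow> 0 \<le> L a \<bullet> p"
    "\<And>\<mu>. (\<And>a x. a \<in> D \<Longrightarrow> x \<in> arc_cone a \<Longrightarrow> \<mu> a \<bullet> x \<le> 0) \<Longrightarrow> halfspaces D L \<subseteq> halfspaces D \<mu> \<Longrightarrow> halfspaces D \<mu> \<subseteq> halfspaces D L"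
  interpret max_region D L k by unfold_locales (fact hL(1) hL(2) hL(4))+
  define \<nu> where "\<nu> a = (if \<exists>c>0. L a = c *\<^sub>R arc_normal a then arc_normal a else - arc_normal a)" for a
  have \<nu>: "\<exists>c>0. L a = c *\<^sub>R \<nu> a" if a: "a \<in> N" for a
  proof -
    obtain c where c: "c \<noteq> 0" "L a = c *\<^sub>R arc_normal a" using is_normal_multiple[OF valid[OF ND[OF a]] L_normal[OF a]] .
    show ?thesis
    proof (cases "\<exists>c>0. L a = c *\<^sub>R arc_normal a")
      case True then show ?thesis unfolding \<nu>_def by simp
    next
      case False
      then have "0 < - c" using c by (metis neg_0_less_iff_less linorder_neqE_linordered_idom)
      moreover have "\<nu> a = - arc_normal a" unfolding \<nu>_def by (rule if_not_P[OF False])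
      then have "L a = (- c) *\<^sub>R \<nu> a" using c by simp
      ultimately show ?thesis by blast
    qed
  qed
  have le: "0 \<le> \<nu> a \<bullet> x \<longleftrightarrow> 0 \<le> L a \<bullet> x" and eq: "\<nu> a \<bullet> x = 0 \<longleftrightarrow> L a \<bullet> x = 0" if "a \<in> N" for a x
    using \<nu>[OF that] by (auto simp: zero_le_mult_iff)
  have RT: "region \<nu> N = T" unfolding region_def T_N using le by auto
  have "tile D p \<nu> N" unfolding tile_def RT
  proof (intro conjI ballI impI)
    show "N \<noteq> {}" by (rule N_nonempty)
    show "N \<subseteq> D" using ND by blast
    show "p \<in> T" using hL(3) by (simp add: T_def)
    show "\<nu> a = arc_normal a \<or> \<nu> a = - arc_normal a" for a by (simp add: \<nu>_def)
    show "a \<in> N \<longleftrightarrow> T \<inter> arc_icone a \<noteq> {}" if "a \<in> D" for a using that by (auto simp: N_def)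
    show "x \<in> arc_cone a" if "a \<in> N" "x \<in> T" "\<nu> a \<bullet> x = 0" for a x using face_cone that eq by blast
  qed
  then show thesis by (rule that)
qed

subsection \<open>Tiles\<close>

lemma line_unique:
  assumes "valid_arc a" "is_normal a m" "\<not> is_normal a n" "x \<noteq> 0" "m \<bullet> x = 0" "n \<bullet> x = 0" "m \<bullet> y = 0" "n \<bullet> y = 0" "n \<noteq> 0"
  obtains g where "y = g *\<^sub>R x"
proof -
  obtain e o' where e: "ends a e o'" "n \<bullet> e \<noteq> 0" using assms(3,9) ends_fst ends_snd unfolding is_normal_def by blast
  obtain g h where gh: "y = g *\<^sub>R x + h *\<^sub>R e"
    using plane_span[OF is_normal_nz[OF assms(2)] assms(5) is_normal_ends[OF assms(2) e(1)] assms(7) assms(4,6) e(2)] .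
  have "h * (n \<bullet> e) = 0" using assms(8,6) unfolding gh by (simp add: inner_add_right)
  then have "y = g *\<^sub>R x" using gh e(2) by simp
  then show thesis by (rule that)
qed

text \<open>Two different planes meet in a line, and an arc, being shorter than a half circle,
  contains at most one of its two rays.\<close>

lemma cone_line:
  assumes "valid_arc a" "is_normal a m" "\<not> is_normal a n" "n \<noteq> 0" "x \<in> arc_cone a" "y \<in> arc_cone a" "x \<noteq> 0" "y \<noteq> 0" "n \<bullet> x = 0" "n \<bullet> y = 0"
  obtains g where "0 < g" "y = g *\<^sub>R x"
proof -
  obtain g where g: "y = g *\<^sub>R x"
    using line_unique[OF assms(1-3,7) is_normal_cone[OF assms(2,5)] assms(9) is_normal_cone[OF assms(2,6)] assms(10,4)] .
  have "0 < g"
  proof (rule ccontr)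
    assume "\<not> 0 < g"
    then have "(- g) *\<^sub>R x \<in> arc_cone a" using cone_scale[OF assms(5), of "- g"] by simp
    then have "- y \<in> arc_cone a" using g by simp
    then show False using cone_pointed[OF assms(1,6)] assms(8) by blast
  qed
  then show thesis using that g by blast
qed

lemma cross_zero:
  assumes "x \<in> arc_icone a" "y \<in> arc_icone a" "0 \<le> \<phi> \<bullet> x" "\<phi> \<bullet> y \<le> 0"
  obtains q where "q \<in> arc_icone a" "\<phi> \<bullet> q = 0"
proof (cases "\<phi> \<bullet> y = 0")
  case True then show thesis using that assms by blast
next
  case False
  have "(\<phi> \<bullet> x) *\<^sub>R y + (- (\<phi> \<bullet> y)) *\<^sub>R x \<in> arc_icone a"
    by (rule icone_comb) (use assms False icone_sub_cone in auto)
  then show thesis by (rule that) (simp add: inner_diff_right)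
qed

text \<open>The pole condition carried over to cones; it is insensitive to positive rescaling and to
  replacing p by -p.\<close>

definition avoids :: "pt \<Rightarrow> arc \<Rightarrow> bool" where
  "avoids p a \<longleftrightarrow> p \<noteq> 0 \<and> p \<in> span {fst a, snd a} \<and> p \<notin> arc_cone a \<and> - p \<notin> arc_cone a"

lemma avoids_uminus: "avoids p a \<Longrightarrow> avoids (- p) a"
  unfolding avoids_def using span_neg by auto

lemma avoids_normal: assumes "avoids p a" "is_normal a m" shows "m \<bullet> p = 0"
proof -
  have "p \<in> span {fst a, snd a}" using assms by (simp add: avoids_def)
  then obtain s t where "p = s *\<^sub>R fst a + t *\<^sub>R snd a" unfolding span_breakdown_eq[of _ "fst a"] span_singleton
    by (metis (no_types, lifting) add.commute diff_add_cancel rangeE)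
  then show ?thesis using assms(2) by (simp add: is_normal_def inner_add_right)
qed

context spherical
begin

context
  fixes p \<nu> N assumes t: "tile D p \<nu> N"
begin

lemma tile_D: "a \<in> N \<Longrightarrow> a \<in> D" and tile_nonempty: "N \<noteq> {}"
  and tile_I: "a \<in> D \<Longrightarrow> x \<in> region \<nu> N \<Longrightarrow> x \<in> arc_icone a \<Longrightarrow> a \<in> N"
  and tile_contact: "a \<in> N \<Longrightarrow> \<exists>x\<in>region \<nu> N. x \<in> arc_icone a"
  and tile_face: "a \<in> N \<Longrightarrow> x \<in> region \<nu> N \<Longrightarrow> \<nu> a \<bullet> x = 0 \<Longrightarrow> x \<in> arc_cone a"
  and tile_p: "p \<in> region \<nu> N"
  and tile_nu: "a \<in> N \<Longrightarrow> \<nu> a = arc_normal a \<or> \<nu> a = - arc_normal a"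
  using t unfolding tile_def by blast+

lemma tile_finite: "finite N"
  using tile_D fin by (meson finite_subset subsetI)

lemma tile_nn: "a \<in> N \<Longrightarrow> x \<in> region \<nu> N \<Longrightarrow> 0 \<le> \<nu> a \<bullet> x"
  by (simp add: region_def)

lemma tile_normal: "a \<in> N \<Longrightarrow> is_normal a (\<nu> a)"
  using tile_nu is_normal_arc_normal is_normal_uminus tile_D valid by metis

lemma tile_blocker: assumes "b \<in> D" "ends b e o'" "e \<in> region \<nu> N" shows "\<exists>a\<in>N. e \<in> arc_icone a"
proof -
  obtain a where "a \<in> D" "e \<in> arc_icone a" using blocked[OF assms(1,2)] .
  then show ?thesis using tile_I assms(3) by blast
qed

lemma tile_pointed: assumes "x \<in> region \<nu> N" "- x \<in> region \<nu> N" shows "x = 0"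
proof -
  obtain a where a: "a \<in> N" using tile_nonempty by auto
  have "\<nu> a \<bullet> x = 0" using tile_nn[OF a assms(1)] tile_nn[OF a assms(2)] by simp
  then have "x \<in> arc_cone a" "- x \<in> arc_cone a" using tile_face[OF a] assms by auto
  then show ?thesis using cone_pointed valid tile_D[OF a] by blast
qed

text \<open>By the face property a contact point of \<open>a\<close> would lie on b. As an interior
  point of b it makes the arcs overlap; as an end of b it makes b hit \<open>a\<close> within the
  plane of \<open>a\<close>.\<close>

lemma tile_planes: assumes "a \<in> N" "b \<in> N" "a \<noteq> b" "is_normal a m" shows "\<not> is_normal b m"
proof
  assume b: "is_normal b m"
  have aD: "a \<in> D" and bD: "b \<in> D" using assms tile_D by auto
  obtain w where w: "w \<in> region \<nu> N" "w \<in> arc_icone a" using tile_contact[OF assms(1)] by blast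
  obtain k where k: "k \<noteq> 0" "\<nu> b = k *\<^sub>R m" using is_normal_parallel[OF valid[OF bD] b tile_normal[OF assms(2)]] .
  have "\<nu> b \<bullet> w = 0" using is_normal_icone[OF assms(4) w(2)] k by simp
  then have wb: "w \<in> arc_cone b" using tile_face[OF assms(2) w(1)] by blast
  from cone_cases[OF wb icone_nonzero[OF valid[OF aD] w(2)]] show False
  proof cases
    case 1 then show False using icone_disjoint aD bD w(2) assms(3) by blast
  next
    case (2 c e o')
    have "e = (1/c) *\<^sub>R w" using 2 by simp
    then have e: "e \<in> arc_icone a" using icone_scale[OF w(2), of "1/c"] 2 by simp
    show False using hit_transversal[OF aD bD 2(1) e assms(4)] is_normal_ends[OF b ends_sym[OF 2(1)]] by simp
  qed
qed

text \<open>The neighbour is found at the last tile point on the way from a contact point to e: this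
  is e itself with its blocker, or the first plane of another side met before e. The signs at e and
  \<open>o'\<close> ensure that the neighbours for the two ends differ.\<close>

lemma tile_neighbour:
  assumes a: "a \<in> N" and eo: "ends a e o'"
  obtains b r where "b \<in> N" "b \<noteq> a" "\<nu> b \<bullet> e \<le> 0" "0 < \<nu> b \<bullet> o'" "r \<in> region \<nu> N" "r \<noteq> 0" "r \<in> arc_cone a" "r \<in> arc_cone b"
    "r = e \<and> e \<in> arc_icone b \<or> r \<in> arc_icone a"
proof -
  have aD: "a \<in> D" using a tile_D by blast
  obtain w where w: "w \<in> region \<nu> N" "w \<in> arc_icone a" using tile_contact[OF a] by blast
  obtain \<alpha> \<beta> where ab: "0 < \<alpha>" "0 < \<beta>" "w = \<alpha> *\<^sub>R e + \<beta> *\<^sub>R o'" using w(2) unfolding ends_icone[OF eo] by auto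
  have wb: "0 \<le> \<alpha> * (\<nu> b \<bullet> e) + \<beta> * (\<nu> b \<bullet> o')" if "b \<in> N" for b
    using tile_nn[OF that w(1)] unfolding ab(3) by (simp add: inner_add_right)
  show thesis
  proof (cases "e \<in> region \<nu> N")
    case True
    obtain b where b: "b \<in> N" "e \<in> arc_icone b" using tile_blocker[OF aD eo True] by blast
    have be: "\<nu> b \<bullet> e = 0" using is_normal_icone[OF tile_normal[OF b(1)] b(2)] .
    have "\<nu> b \<bullet> o' \<noteq> 0" using hit_transversal[OF tile_D[OF b(1)] aD eo b(2) tile_normal[OF b(1)]] .
    moreover have "0 \<le> \<nu> b \<bullet> o'" using wb[OF b(1)] be ab by (simp add: zero_le_mult_iff)
    ultimately have "0 < \<nu> b \<bullet> o'" by simp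
    then show thesis using that[of b e] b be True ends_nonzero[OF valid[OF aD] eo] ends_in_cone[OF eo] icone_sub_cone[OF b(2)]
      not_self_hit[OF aD eo b(2)] by auto
  next
    case False
    define J where "J = {b \<in> N. \<nu> b \<bullet> e < 0}"
    \<comment> \<open>The parameter at which the ray from w in direction e meets the plane of
      b.\<close>
    define \<tau> where "\<tau> b = (\<nu> b \<bullet> w) / - (\<nu> b \<bullet> e)" for b
    have J: "finite (\<tau> ` J)" "\<tau> ` J \<noteq> {}" using False tile_finite unfolding J_def region_def by (auto simp: not_le)
    then obtain b where b: "b \<in> J" "\<tau> b = Min (\<tau> ` J)" using Min_in[OF J] by (metis imageE)
    have bN: "b \<in> N" and be: "\<nu> b \<bullet> e < 0" using b(1) unfolding J_def by auto
    define r where "r = w + \<tau> b *\<^sub>R e"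
    have tb: "0 \<le> \<tau> b" using tile_nn[OF bN w(1)] be unfolding \<tau>_def by (simp add: divide_nonneg_neg)
    have rT: "0 \<le> \<nu> d \<bullet> r" if d: "d \<in> N" for d
    proof (cases "d \<in> J")
      case True
      then have "\<tau> b \<le> \<tau> d" using b(2) J by simp
      moreover have "\<nu> d \<bullet> e < 0" using True unfolding J_def by auto
      ultimately have "\<tau> d * (\<nu> d \<bullet> e) \<le> \<tau> b * (\<nu> d \<bullet> e)" by (simp add: mult_right_mono_neg)
      moreover have "\<tau> d * (\<nu> d \<bullet> e) = - (\<nu> d \<bullet> w)" unfolding \<tau>_def using \<open>\<nu> d \<bullet> e < 0\<close> by simp
      ultimately show ?thesis unfolding r_def by (simp add: inner_add_right)
    next
      case False
      then have "0 \<le> \<nu> d \<bullet> e" using d unfolding J_def by auto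
      then show ?thesis unfolding r_def using tb tile_nn[OF d w(1)] by (simp add: inner_add_right)
    qed
    then have rR: "r \<in> region \<nu> N" by (simp add: region_def)
    have "\<nu> b \<bullet> r = 0" unfolding r_def \<tau>_def using be by (simp add: inner_add_right inner_diff_right)
    then have rb: "r \<in> arc_cone b" using tile_face[OF bN rR] by blast
    have ra: "r \<in> arc_icone a" unfolding r_def using cone_icone_add[OF cone_scale[OF ends_in_cone[OF eo] tb] w(2)] by (simp add: add.commute)
    have "\<alpha> * (\<nu> b \<bullet> e) < 0" using ab be by (simp add: mult_less_0_iff)
    then have "0 < \<beta> * (\<nu> b \<bullet> o')" using wb[OF bN] by simp
    then have bo: "0 < \<nu> b \<bullet> o'" using ab by (simp add: zero_less_mult_iff)
    have "b \<noteq> a" using is_normal_ends[OF tile_normal[OF a] eo] be by auto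
    then show thesis using that[of b r] bN be bo rR rb ra icone_sub_cone icone_nonzero[OF valid[OF aD] ra] by auto
  qed
qed

lemma tile_two_neighbours:
  assumes a: "a \<in> N"
  obtains b r b' r' where "b \<in> N" "b' \<in> N" "b \<noteq> a" "b' \<noteq> a" "b \<noteq> b'"
    "r \<in> region \<nu> N" "r \<noteq> 0" "r \<in> arc_cone a" "r \<in> arc_cone b" "r = fst a \<and> fst a \<in> arc_icone b \<or> r \<in> arc_icone a"
    "r' \<in> region \<nu> N" "r' \<noteq> 0" "r' \<in> arc_cone a" "r' \<in> arc_cone b'" "r' = snd a \<and> snd a \<in> arc_icone b' \<or> r' \<in> arc_icone a"
proof -
  obtain b r where b: "b \<in> N" "b \<noteq> a" "\<nu> b \<bullet> fst a \<le> 0" "0 < \<nu> b \<bullet> snd a" "r \<in> region \<nu> N" "r \<noteq> 0" "r \<in> arc_cone a" "r \<in> arc_cone b"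
    "r = fst a \<and> fst a \<in> arc_icone b \<or> r \<in> arc_icone a" by (rule tile_neighbour[OF a ends_fst])
  obtain b' r' where b': "b' \<in> N" "b' \<noteq> a" "\<nu> b' \<bullet> snd a \<le> 0" "0 < \<nu> b' \<bullet> fst a" "r' \<in> region \<nu> N" "r' \<noteq> 0" "r' \<in> arc_cone a" "r' \<in> arc_cone b'"
    "r' = snd a \<and> snd a \<in> arc_icone b' \<or> r' \<in> arc_icone a" by (rule tile_neighbour[OF a ends_snd])
  have "b \<noteq> b'" using b b' by auto
  then show thesis using that[of b b' r r'] b b' by blast
qed

lemma tile_card: "3 \<le> card N"
proof -
  obtain a where a: "a \<in> N" using tile_nonempty by auto
  obtain b r b' r' where b: "b \<in> N" "b' \<in> N" "b \<noteq> a" "b' \<noteq> a" "b \<noteq> b'" by (rule tile_two_neighbours[OF a])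
  have "card {a, b, b'} \<le> card N" by (rule card_mono[OF tile_finite]) (use a b in auto)
  then show ?thesis using b by simp
qed

lemma avoids_notin_tile: "avoids p a \<Longrightarrow> a \<notin> N"
  using avoids_normal tile_normal tile_face tile_p unfolding avoids_def by metis

end

text \<open>The two planes meet exactly in the line through p, so a common point would be a multiple
  of p, while neither p nor -p lies on the arcs.\<close>

lemma avoids_touch:
  assumes "a \<in> D" "b \<in> D" "avoids p a" "avoids p b" "is_normal a m" "\<not> is_normal b m" "x \<in> arc_cone a" "x \<in> arc_cone b"
  shows "x = 0"
proof (rule ccontr)
  assume x: "x \<noteq> 0"
  obtain n where n: "is_normal b n" using is_normal_arc_normal valid assms(2) by blast
  obtain g where g: "p = g *\<^sub>R x"
    using line_unique[OF valid[OF assms(2)] n assms(6) x is_normal_cone[OF n assms(8)] is_normal_cone[OF assms(5,7)]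
      avoids_normal[OF assms(4) n] avoids_normal[OF assms(3,5)] is_normal_nz[OF assms(5)]] .
  have "p \<in> arc_cone a \<or> - p \<in> arc_cone a"
  proof (cases "0 \<le> g")
    case True then show ?thesis using cone_scale[OF assms(7)] g by blast
  next
    case False
    then have "(- g) *\<^sub>R x \<in> arc_cone a" using cone_scale[OF assms(7), of "- g"] by simp
    then show ?thesis using g by simp
  qed
  then show False using assms(3) unfolding avoids_def by blast
qed

section \<open>Tiles at two antipodal points\<close>

context
  fixes p \<nu> N \<nu>' S assumes t: "tile D p \<nu> N" and t': "tile D (- p) \<nu>' S" and p0: "p \<noteq> 0"
begin

text \<open>The two functionals agree up to sign and are nonnegative at p and -p respectively. If
  they vanished there, the face property would put both p and -p on c.\<close>

lemma common_side:
  assumes "c \<in> N" "c \<in> S"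
  shows "0 < \<nu> c \<bullet> p" "\<nu>' c = - \<nu> c"
proof -
  have n: "0 \<le> \<nu> c \<bullet> p" "0 \<le> \<nu>' c \<bullet> (- p)" using tile_nn[OF t] tile_nn[OF t'] tile_p[OF t] tile_p[OF t'] assms by blast+
  have nz: "\<nu> c \<bullet> p \<noteq> 0"
  proof
    assume z: "\<nu> c \<bullet> p = 0"
    then have "\<nu>' c \<bullet> - p = 0" using tile_nu[OF t assms(1)] tile_nu[OF t' assms(2)] by auto
    then have "p \<in> arc_cone c" "- p \<in> arc_cone c"
      using tile_face[OF t assms(1) tile_p[OF t] z] tile_face[OF t' assms(2) tile_p[OF t']] by auto
    then show False using cone_pointed valid tile_D[OF t assms(1)] p0 by blast
  qed
  then show "0 < \<nu> c \<bullet> p" using n by simp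
  then show "\<nu>' c = - \<nu> c" using tile_nu[OF t assms(1)] tile_nu[OF t' assms(2)] n by auto
qed

lemma common_side_nonpos: "c \<in> N \<Longrightarrow> c \<in> S \<Longrightarrow> x \<in> region \<nu>' S \<Longrightarrow> \<nu> c \<bullet> x \<le> 0"
  using tile_nn[OF t', of c x] common_side(2)[of c] by simp

text \<open>The plane of one common side separates the two tiles, and any other common side touches
  both, so it crosses this plane in its relative interior. A point shared by two common sides would
  thus be interior to both.\<close>

lemma common_sides_disjoint:
  assumes c: "c \<in> N" "c \<in> S" and d: "d \<in> N" "d \<in> S" and cd: "c \<noteq> d" and x: "x \<in> arc_cone c" "x \<in> arc_cone d"
  shows "x = 0"
proof (rule ccontr)
  assume x0: "x \<noteq> 0"
  have "x \<in> arc_icone a" if a: "a \<in> N" "a \<in> S" "b \<in> N" "b \<in> S" "a \<noteq> b" "x \<in> arc_cone a" "x \<in> arc_cone b" for a b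
  proof -
    obtain w where w: "w \<in> region \<nu> N" "w \<in> arc_icone a" using tile_contact[OF t a(1)] by blast
    obtain w' where w': "w' \<in> region \<nu>' S" "w' \<in> arc_icone a" using tile_contact[OF t' a(2)] by blast
    have aD: "a \<in> D" using tile_D[OF t] a by blast
    obtain q where q: "q \<in> arc_icone a" "\<nu> b \<bullet> q = 0"
      using cross_zero[OF w(2) w'(2) tile_nn[OF t a(3) w(1)] common_side_nonpos[OF a(3,4) w'(1)]] .
    have n: "is_normal b (\<nu> b)" "\<not> is_normal a (\<nu> b)" using tile_normal[OF t a(3)] tile_planes[OF t a(3) a(1) a(5)[symmetric]] by blast+
    obtain g where "0 < g" and g: "q = g *\<^sub>R x"
      using cone_line[OF valid[OF aD] tile_normal[OF t a(1)] n(2) is_normal_nz[OF n(1)] a(6) icone_sub_cone[OF q(1)]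
        x0 icone_nonzero[OF valid[OF aD] q(1)] is_normal_cone[OF n(1) a(7)] q(2)] .
    then have "x = (1/g) *\<^sub>R q" using g by simp
    then show ?thesis using icone_scale[OF q(1), of "1/g"] \<open>0 < g\<close> by simp
  qed
  then have "x \<in> arc_icone c" "x \<in> arc_icone d" using assms by blast+
  then show False using icone_disjoint tile_D[OF t] c d cd by blast
qed

lemma common_side_private:
  assumes "c \<in> N" "c \<in> S"
  shows "2 \<le> card (N - S)"
proof -
  obtain b r b' r' where b: "b \<in> N" "b' \<in> N" "b \<noteq> c" "b' \<noteq> c" "b \<noteq> b'"
    "r \<noteq> 0" "r \<in> arc_cone c" "r \<in> arc_cone b" "r' \<noteq> 0" "r' \<in> arc_cone c" "r' \<in> arc_cone b'"
    by (rule tile_two_neighbours[OF t assms(1)])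
  have "b \<notin> S" "b' \<notin> S" using common_sides_disjoint[OF assms] b by blast+
  then have "card {b, b'} \<le> card (N - S)" using b tile_finite[OF t] by (intro card_mono) auto
  then show ?thesis using b by simp
qed

end

text \<open>Both tiles have at least three sides, so five sides in all force a common one; its
  neighbours are private, at least two in each tile. Hence 2 + 1 + 2 is the only
  possibility.\<close>

lemma few_sides:
  assumes t: "tile D p \<nu> N" and t': "tile D (- p) \<nu>' S" and p0: "p \<noteq> 0" and c5: "card (N \<union> S) \<le> 5"
  shows "card N = 3" "card S = 3" "card (N \<inter> S) = 1"
proof -
  have f: "finite N" "finite S" using tile_finite t t' by blast+
  have u: "card N + card S = card (N \<union> S) + card (N \<inter> S)" using card_Un_Int[OF f] .
  have k: "3 \<le> card N" "3 \<le> card S" using tile_card t t' by blast+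
  have "N \<inter> S \<noteq> {}" using u k c5 by auto
  then obtain c where c: "c \<in> N" "c \<in> S" by auto
  have "2 \<le> card (N - S)" using common_side_private[OF t t' p0 c] .
  moreover have "2 \<le> card (S - N)" using common_side_private[of "- p" \<nu>' S \<nu> N c] t t' p0 c by simp
  moreover have "card N = card (N - S) + card (N \<inter> S)" "card S = card (S - N) + card (N \<inter> S)"
    using f by (metis card_Diff_subset_Int Int_commute add.commute card_mono finite_Int inf_le1 le_add_diff_inverse)+
  ultimately show "card N = 3" "card S = 3" "card (N \<inter> S) = 1" using u k c5 by linarith+
qed

text \<open>The three corners of a triangular tile are the dual basis of its three inner normals.\<close>
lemma tile_triangle:
  assumes t: "tile D p \<nu> {a, b, c}" and d: "a \<noteq> b" "b \<noteq> c" "a \<noteq> c"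
  obtains x y z where
    "\<nu> a \<bullet> x = 0" "\<nu> b \<bullet> x = 0" "\<nu> c \<bullet> x = 1" "x \<in> arc_cone a" "x \<in> arc_cone b" "x \<in> region \<nu> {a, b, c}"
    "\<nu> b \<bullet> y = 0" "\<nu> c \<bullet> y = 0" "\<nu> a \<bullet> y = 1" "y \<in> arc_cone b" "y \<in> arc_cone c" "y \<in> region \<nu> {a, b, c}"
    "\<nu> c \<bullet> z = 0" "\<nu> a \<bullet> z = 0" "\<nu> b \<bullet> z = 1" "z \<in> arc_cone c" "z \<in> arc_cone a" "z \<in> region \<nu> {a, b, c}"
    "\<And>q. q = (\<nu> c \<bullet> q) *\<^sub>R x + (\<nu> a \<bullet> q) *\<^sub>R y + (\<nu> b \<bullet> q) *\<^sub>R z"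
proof -
  define A B C where "A = \<nu> a" and "B = \<nu> b" and "C = \<nu> c"
  define \<Delta> where "\<Delta> = C \<bullet> cross3 A B"
  have R: "region \<nu> {a, b, c} = {x. 0 \<le> A \<bullet> x \<and> 0 \<le> B \<bullet> x \<and> 0 \<le> C \<bullet> x}" by (auto simp: region_def A_def B_def C_def)
  have AB: "cross3 A B \<noteq> 0"
  proof
    assume "cross3 A B = 0"
    have "cross3 A B = 0 \<Longrightarrow> (A \<bullet> A) *\<^sub>R B = (A \<bullet> B) *\<^sub>R A" using Lagrange[of A A B] by simp
    then have e: "(A \<bullet> A) *\<^sub>R B = (A \<bullet> B) *\<^sub>R A" using \<open>cross3 A B = 0\<close> by blast
    have An: "is_normal a A" and Bn: "is_normal b B" using tile_normal[OF t] unfolding A_def B_def by auto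
    have "is_normal a B"
      unfolding is_normal_def
    proof (intro conjI)
      show "B \<noteq> 0" using is_normal_nz[OF Bn] .
      have "(A \<bullet> A) * (B \<bullet> v) = (A \<bullet> B) * (A \<bullet> v)" for v using arg_cong[OF e, of "\<lambda>w. w \<bullet> v"] by simp
      then show "B \<bullet> fst a = 0" "B \<bullet> snd a = 0" using An unfolding is_normal_def by (metis mult_eq_0_iff inner_eq_zero_iff mult_zero_right)+
    qed
    then show False using tile_planes[OF t, of a b B] d Bn by auto
  qed
  \<comment> \<open>If the three normals were dependent, the line through \<open>cross3 A B\<close>
    would lie in the tile, which is pointed.\<close>
  have D0: "\<Delta> \<noteq> 0"
  proof
    assume z: "\<Delta> = 0"
    have "cross3 A B \<in> region \<nu> {a, b, c}" "- cross3 A B \<in> region \<nu> {a, b, c}" unfolding R using z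
      by (auto simp: dot_cross_self \<Delta>_def)
    then show False using tile_pointed[OF t] AB by blast
  qed
  define x where "x = (1/\<Delta>) *\<^sub>R cross3 A B"
  define y where "y = (1/\<Delta>) *\<^sub>R cross3 B C"
  define z where "z = (1/\<Delta>) *\<^sub>R cross3 C A"
  have D2: "A \<bullet> cross3 B C = \<Delta>" "B \<bullet> cross3 C A = \<Delta>" unfolding \<Delta>_def by (metis cross_triple inner_commute)+
  have xs: "A \<bullet> x = 0" "B \<bullet> x = 0" "C \<bullet> x = 1" using D0 unfolding x_def by (auto simp: dot_cross_self \<Delta>_def)
  have ys: "B \<bullet> y = 0" "C \<bullet> y = 0" "A \<bullet> y = 1" using D0 D2 unfolding y_def by (auto simp: dot_cross_self)
  have zs: "C \<bullet> z = 0" "A \<bullet> z = 0" "B \<bullet> z = 1" using D0 D2 unfolding z_def by (auto simp: dot_cross_self)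
  have reg: "x \<in> region \<nu> {a, b, c}" "y \<in> region \<nu> {a, b, c}" "z \<in> region \<nu> {a, b, c}" unfolding R using xs ys zs by auto
  have repr: "q = (C \<bullet> q) *\<^sub>R x + (A \<bullet> q) *\<^sub>R y + (B \<bullet> q) *\<^sub>R z" for q
  proof -
    define w where "w = q - ((C \<bullet> q) *\<^sub>R x + (A \<bullet> q) *\<^sub>R y + (B \<bullet> q) *\<^sub>R z)"
    have "A \<bullet> w = 0" "B \<bullet> w = 0" "C \<bullet> w = 0" unfolding w_def using xs ys zs by (auto simp: inner_add_right inner_diff_right)
    then have "w \<in> region \<nu> {a, b, c}" "- w \<in> region \<nu> {a, b, c}" unfolding R by auto
    then have "w = 0" using tile_pointed[OF t] by blast
    then show ?thesis unfolding w_def by simp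
  qed
  have cones: "x \<in> arc_cone a" "x \<in> arc_cone b" "y \<in> arc_cone b" "y \<in> arc_cone c" "z \<in> arc_cone c" "z \<in> arc_cone a"
    using tile_face[OF t] reg xs ys zs unfolding A_def B_def C_def by auto
  show thesis using that[OF xs[unfolded A_def B_def C_def] cones(1,2) reg(1) ys[unfolded A_def B_def C_def] cones(3,4) reg(2)
     zs[unfolded A_def B_def C_def] cones(5,6) reg(3) repr[unfolded A_def B_def C_def]] .
qed

end

text \<open>If q lay on the great circles of two sides of opposite triangles while avoiding both sides, then the
relations below would combine to a nontrivial nonnegative relation among points of one cone.\<close>
lemma opposite_triangles_vector:
  fixes x1 x2 y1 y2 P P' p q \<gamma> :: pt
  assumes v: "valid_arc c" and xy: "x1 \<in> arc_cone c" "x2 \<in> arc_cone c" "y1 \<in> arc_cone c" "y2 \<in> arc_cone c" "x1 \<noteq> 0"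
    and g: "is_normal c \<gamma>" "0 < \<gamma> \<bullet> P" "\<gamma> \<bullet> P' < 0"
    and p: "p = a *\<^sub>R x1 + b *\<^sub>R x2 + d *\<^sub>R P" "0 \<le> a" "0 \<le> b" "0 < d"
    and p': "- p = a' *\<^sub>R y1 + b' *\<^sub>R y2 + d' *\<^sub>R P'" "0 \<le> a'" "0 \<le> b'" "0 < d'"
    and q: "q = \<alpha> *\<^sub>R x1 - \<beta> *\<^sub>R P" "0 < \<alpha>" "0 < \<beta>"
    and q': "\<epsilon> *\<^sub>R q = \<alpha>' *\<^sub>R y1 - \<beta>' *\<^sub>R P'" "0 < \<alpha>'" "0 < \<beta>'" "\<epsilon> = 1 \<or> \<epsilon> = -1"
  shows False
proof -
  have gx: "\<gamma> \<bullet> x1 = 0" "\<gamma> \<bullet> x2 = 0" "\<gamma> \<bullet> y1 = 0" "\<gamma> \<bullet> y2 = 0" using is_normal_cone[OF g(1)] xy by auto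
  have e: "\<epsilon> * (- \<beta> * (\<gamma> \<bullet> P)) = - \<beta>' * (\<gamma> \<bullet> P')"
    using arg_cong[OF q'(1), of "\<lambda>w. \<gamma> \<bullet> w"] gx unfolding q(1) by (simp add: inner_diff_right)
  have pos: "0 < \<beta> * (\<gamma> \<bullet> P)" "\<beta>' * (\<gamma> \<bullet> P') < 0" using g q q' by (auto simp: mult_less_0_iff)
  \<comment> \<open>Seen through \<gamma>, the vector q is negative, whereas the right-hand side of
    the second relation is positive. This leaves only the opposite sign.\<close>
  have eps: "\<epsilon> = -1" using q'(4) e pos by auto
  have e1: "\<beta> * (\<gamma> \<bullet> P) = - \<beta>' * (\<gamma> \<bullet> P')" using e eps by simp
  have e2: "d * (\<gamma> \<bullet> P) = - d' * (\<gamma> \<bullet> P')"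
  proof -
    have "\<gamma> \<bullet> (a *\<^sub>R x1 + b *\<^sub>R x2 + d *\<^sub>R P) + \<gamma> \<bullet> (a' *\<^sub>R y1 + b' *\<^sub>R y2 + d' *\<^sub>R P') = \<gamma> \<bullet> p + \<gamma> \<bullet> (- p)"
      using p(1) p'(1) by metis
    then show ?thesis using gx by (simp add: inner_add_right)
  qed
  define k where "k = d / \<beta>"
  have k: "0 < k" "d = k * \<beta>" unfolding k_def using p q by auto
  have "k * (\<beta> * (\<gamma> \<bullet> P)) = - d' * (\<gamma> \<bullet> P')" using e2 k by (simp add: mult.assoc)
  then have "k * (- \<beta>' * (\<gamma> \<bullet> P')) = - d' * (\<gamma> \<bullet> P')" unfolding e1 .
  then have "(d' - k * \<beta>') * (\<gamma> \<bullet> P') = 0" by algebra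
  then have d': "d' = k * \<beta>'" using g by simp
  have s: "\<beta> *\<^sub>R P + \<beta>' *\<^sub>R P' = \<alpha> *\<^sub>R x1 + \<alpha>' *\<^sub>R y1" using q(1) q'(1) eps by (simp add: algebra_simps)
  have "0 = p + (- p)" by simp
  also have "\<dots> = a *\<^sub>R x1 + b *\<^sub>R x2 + (a' *\<^sub>R y1 + b' *\<^sub>R y2) + k *\<^sub>R (\<beta> *\<^sub>R P + \<beta>' *\<^sub>R P')"
    unfolding p'(1) unfolding p(1) k(2) d' by (simp add: algebra_simps)
  also have "\<dots> = (k * \<alpha>) *\<^sub>R x1 + (a *\<^sub>R x1 + b *\<^sub>R x2 + ((a' + k * \<alpha>') *\<^sub>R y1 + b' *\<^sub>R y2))"
    unfolding s by (simp add: algebra_simps)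
  finally have z: "- ((k * \<alpha>) *\<^sub>R x1) = a *\<^sub>R x1 + b *\<^sub>R x2 + ((a' + k * \<alpha>') *\<^sub>R y1 + b' *\<^sub>R y2)"
    by (metis add.commute add_eq_0_iff)
  have "a *\<^sub>R x1 + b *\<^sub>R x2 + ((a' + k * \<alpha>') *\<^sub>R y1 + b' *\<^sub>R y2) \<in> arc_cone c"
    using xy p p' q' k by (intro cone_add cone_scale) auto
  moreover have "(k * \<alpha>) *\<^sub>R x1 \<in> arc_cone c" using xy k q by (intro cone_scale) auto
  ultimately have "(k * \<alpha>) *\<^sub>R x1 = 0" using cone_pointed[OF v] z by metis
  then show False using k q xy by simp
qed

subsection \<open>Five poles: spherical diagrams\<close>

text \<open>Two coefficients of the same weak sign would place q or -q on the arc.\<close>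

lemma avoids_signs:
  assumes "x \<in> arc_cone a" "y \<in> arc_cone a" "q = u *\<^sub>R x + v *\<^sub>R y" "avoids q a"
  shows "(0 < u \<and> v < 0) \<or> (u < 0 \<and> 0 < v)"
proof -
  have "\<not> (0 \<le> u \<and> 0 \<le> v)" using cone_comb[OF assms(1,2), of u v] assms(3,4) unfolding avoids_def by auto
  moreover have "\<not> (u \<le> 0 \<and> v \<le> 0)"
  proof
    assume "u \<le> 0 \<and> v \<le> 0"
    then have "(- u) *\<^sub>R x + (- v) *\<^sub>R y \<in> arc_cone a" using cone_comb[OF assms(1,2), of "- u" "- v"] by simp
    moreover have "(- u) *\<^sub>R x + (- v) *\<^sub>R y = - q" using assms(3) by simp
    ultimately show False using assms(4) unfolding avoids_def by simp
  qed
  ultimately show ?thesis by linarith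
qed

context spherical
begin

text \<open>In each triangle the common pole lies on the great circle of a side through a corner on
  c and the apex opposite to c, with coefficients of opposite signs. After choosing signs this is
  the situation of \<open>opposite_triangles_vector\<close> with the normal of c as
  \<gamma>.\<close>

lemma opposite_triangles:
  assumes t: "tile D p \<nu> {c, n, n'}" "c \<noteq> n" "n \<noteq> n'" "c \<noteq> n'"
    and t': "tile D (- p) \<nu>' {c, s, s'}" "c \<noteq> s" "s \<noteq> s'" "c \<noteq> s'" and p0: "p \<noteq> 0"
    and q: "avoids q n" "avoids q s"
  shows False
proof -
  obtain x P z where T: "\<nu> c \<bullet> x = 0" "\<nu> n \<bullet> x = 0" "\<nu> n' \<bullet> x = 1" "x \<in> arc_cone c" "x \<in> arc_cone n" "x \<in> region \<nu> {c, n, n'}"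
    "\<nu> n \<bullet> P = 0" "\<nu> n' \<bullet> P = 0" "\<nu> c \<bullet> P = 1" "P \<in> arc_cone n" "P \<in> arc_cone n'" "P \<in> region \<nu> {c, n, n'}"
    "\<nu> n' \<bullet> z = 0" "\<nu> c \<bullet> z = 0" "\<nu> n \<bullet> z = 1" "z \<in> arc_cone n'" "z \<in> arc_cone c" "z \<in> region \<nu> {c, n, n'}"
    "\<And>q. q = (\<nu> n' \<bullet> q) *\<^sub>R x + (\<nu> c \<bullet> q) *\<^sub>R P + (\<nu> n \<bullet> q) *\<^sub>R z"
    by (rule tile_triangle[OF t]) blast
  obtain x' P' z' where T': "\<nu>' c \<bullet> x' = 0" "\<nu>' s \<bullet> x' = 0" "\<nu>' s' \<bullet> x' = 1" "x' \<in> arc_cone c" "x' \<in> arc_cone s" "x' \<in> region \<nu>' {c, s, s'}"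
    "\<nu>' s \<bullet> P' = 0" "\<nu>' s' \<bullet> P' = 0" "\<nu>' c \<bullet> P' = 1" "P' \<in> arc_cone s" "P' \<in> arc_cone s'" "P' \<in> region \<nu>' {c, s, s'}"
    "\<nu>' s' \<bullet> z' = 0" "\<nu>' c \<bullet> z' = 0" "\<nu>' s \<bullet> z' = 1" "z' \<in> arc_cone s'" "z' \<in> arc_cone c" "z' \<in> region \<nu>' {c, s, s'}"
    "\<And>q. q = (\<nu>' s' \<bullet> q) *\<^sub>R x' + (\<nu>' c \<bullet> q) *\<^sub>R P' + (\<nu>' s \<bullet> q) *\<^sub>R z'"
    by (rule tile_triangle[OF t']) blast
  have c: "0 < \<nu> c \<bullet> p" "\<nu>' c = - \<nu> c" using common_side[OF t(1) t'(1) p0] by auto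
  have cD: "c \<in> D" using tile_D[OF t(1)] by simp
  have q1: "q = (\<nu> n' \<bullet> q) *\<^sub>R x + (\<nu> c \<bullet> q) *\<^sub>R P"
    using T(19)[of q] avoids_normal[OF q(1) tile_normal[OF t(1)]] by simp
  have q2: "q = (\<nu>' s' \<bullet> q) *\<^sub>R x' + (\<nu>' c \<bullet> q) *\<^sub>R P'"
    using T'(19)[of q] avoids_normal[OF q(2) tile_normal[OF t'(1)]] by simp
  note s1 = avoids_signs[OF T(5,10) q1 q(1)]
  note s2 = avoids_signs[OF T'(5,10) q2 q(2)]
  obtain Q \<alpha> \<beta> where Q: "Q = \<alpha> *\<^sub>R x - \<beta> *\<^sub>R P" "0 < \<alpha>" "0 < \<beta>" "Q = q \<or> Q = - q"
  proof (cases "0 < \<nu> n' \<bullet> q")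
    case True
    then show thesis using s1 q1 by (intro that[of q "\<nu> n' \<bullet> q" "- (\<nu> c \<bullet> q)"]) auto
  next
    case False
    have "- q = (- (\<nu> n' \<bullet> q)) *\<^sub>R x - (\<nu> c \<bullet> q) *\<^sub>R P" using arg_cong[OF q1, of uminus] by simp
    then show thesis using False s1 by (intro that[of "- q" "- (\<nu> n' \<bullet> q)" "\<nu> c \<bullet> q"]) auto
  qed
  obtain \<epsilon> \<alpha>' \<beta>' where Q': "\<epsilon> *\<^sub>R Q = \<alpha>' *\<^sub>R x' - \<beta>' *\<^sub>R P'" "0 < \<alpha>'" "0 < \<beta>'" "\<epsilon> = 1 \<or> \<epsilon> = (-1::real)"
  proof -
    obtain \<delta> :: real where \<delta>: "\<delta> *\<^sub>R Q = q" "\<delta> = 1 \<or> \<delta> = -1" using Q(4) by (metis scaleR_minus1_left scaleR_one minus_minus)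
    show thesis
    proof (cases "0 < \<nu>' s' \<bullet> q")
      case True
      then show thesis using s2 q2 \<delta> by (intro that[of \<delta> "\<nu>' s' \<bullet> q" "- (\<nu>' c \<bullet> q)"]) auto
    next
      case False
      have "- q = (- (\<nu>' s' \<bullet> q)) *\<^sub>R x' - (\<nu>' c \<bullet> q) *\<^sub>R P'" using arg_cong[OF q2, of uminus] by simp
      then show thesis using False s2 \<delta> by (intro that[of "- \<delta>" "- (\<nu>' s' \<bullet> q)" "\<nu>' c \<bullet> q"]) auto
    qed
  qed
  have x0: "x \<noteq> 0" using T(3) by auto
  have p1: "p = (\<nu> n' \<bullet> p) *\<^sub>R x + (\<nu> n \<bullet> p) *\<^sub>R z + (\<nu> c \<bullet> p) *\<^sub>R P" using T(19)[of p] by (simp add: algebra_simps)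
  have p2: "- p = (\<nu>' s' \<bullet> - p) *\<^sub>R x' + (\<nu>' s \<bullet> - p) *\<^sub>R z' + (\<nu>' c \<bullet> - p) *\<^sub>R P'" using T'(19)[of "- p"] by (simp add: algebra_simps)
  have n1: "0 \<le> \<nu> n' \<bullet> p" "0 \<le> \<nu> n \<bullet> p" using tile_nn[OF t(1) _ tile_p[OF t(1)]] by auto
  have n2: "0 \<le> \<nu>' s' \<bullet> - p" "0 \<le> \<nu>' s \<bullet> - p" using tile_nn[OF t'(1) _ tile_p[OF t'(1)]] by auto
  have c2: "0 < \<nu>' c \<bullet> - p" using c by simp
  have cn: "is_normal c (\<nu> c)" using tile_normal[OF t(1)] by simp
  have g: "0 < \<nu> c \<bullet> P" "\<nu> c \<bullet> P' < 0" using T(9) T'(9) c(2) by auto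
  show False
    by (rule opposite_triangles_vector[OF valid[OF cD] T(4) T(17) T'(4) T'(17) x0 cn g p1 n1 c(1) p2 n2 c2 Q(1-3) Q'])
qed

lemma triangle_touch:
  assumes t: "tile D p \<nu> N" and c: "card N = 3" "a \<in> N" "b \<in> N" "a \<noteq> b"
  obtains x where "x \<noteq> 0" "x \<in> arc_cone a" "x \<in> arc_cone b"
proof -
  have "card (N - {a, b}) = card N - card {a, b}" by (rule card_Diff_subset) (use c in auto)
  then have "card (N - {a, b}) = 1" using c by simp
  then obtain d where d: "N - {a, b} = {d}" using card_1_singletonE by blast
  have N: "N = {a, b, d}" and dd: "b \<noteq> d" "a \<noteq> d" using d c by blast+
  obtain x where x: "\<nu> d \<bullet> x = 1" "x \<in> arc_cone a" "x \<in> arc_cone b"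
    by (rule tile_triangle[OF t[unfolded N] c(4) dd]) blast
  then have "x \<noteq> 0" by auto
  then show thesis using that x by blast
qed

lemma triangle_avoids:
  assumes t: "tile D p \<nu> N" and c: "card N = 3" "a \<in> N" "b \<in> N" "a \<noteq> b" and q: "avoids q a" "avoids q b"
  shows False
proof -
  obtain x where x: "x \<noteq> 0" "x \<in> arc_cone a" "x \<in> arc_cone b" using triangle_touch[OF t c] .
  have n: "is_normal a (\<nu> a)" using tile_normal[OF t] c by blast
  show False using avoids_touch[OF _ _ q n tile_planes[OF t c(2,3,4) n] x(2,3)] x(1) c tile_D[OF t] by blast
qed

end

section \<open>Counting the arcs of each pole\<close>

locale coloured = spherical +
  fixes f :: "arc \<Rightarrow> pt" and Q :: "pt set"
  assumes finQ: "finite Q" and cardQ: "card Q = 5" and fQ: "a \<in> D \<Longrightarrow> f a \<in> Q"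
    and f_avoids: "a \<in> D \<Longrightarrow> avoids (f a) a"
begin

definition fibre where "fibre p = {a \<in> D. f a = p}"

lemma fibre_avoids: "a \<in> fibre p \<Longrightarrow> avoids p a"
  using f_avoids unfolding fibre_def by blast

lemma f_nonzero: "a \<in> D \<Longrightarrow> f a \<noteq> 0"
  using f_avoids unfolding avoids_def by blast

text \<open>Two sides of one triangle touch, and sides of different triangles are handled by
  \<open>opposite_triangles\<close>, so in the exceptional case the pole map is injective on the
  five sides. It never takes the value p there, which makes six poles.\<close>

lemma six_sides:
  assumes a0: "a0 \<in> fibre p" and t: "tile D p \<nu> N" and t': "tile D (- p) \<nu>' S"
  shows "6 \<le> card (N \<union> S)"
proof (rule ccontr)
  assume "\<not> 6 \<le> card (N \<union> S)"
  then have c5: "card (N \<union> S) \<le> 5" by simp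
  have p0: "p \<noteq> 0" using a0 f_nonzero unfolding fibre_def by blast
  have k: "card N = 3" "card S = 3" "card (N \<inter> S) = 1" using few_sides[OF t t' p0 c5] by auto
  obtain c where c: "N \<inter> S = {c}" using k(3) card_1_singletonE by blast
  have f: "finite N" "finite S" using tile_finite t t' by blast+
  have cross: False if n: "n \<in> N" "n \<noteq> c" and s: "s \<in> S" "s \<noteq> c" and fe: "f n = f s" for n s
  proof -
    have cNS: "c \<in> N" "c \<in> S" using c by auto
    have "card (N - {c, n}) = card N - card {c, n}" by (rule card_Diff_subset) (use cNS n in auto)
    then have "card (N - {c, n}) = 1" using k n by simp
    then obtain n' where d1: "N - {c, n} = {n'}" using card_1_singletonE by blast
    have "card (S - {c, s}) = card S - card {c, s}" by (rule card_Diff_subset) (use cNS s in auto)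
    then have "card (S - {c, s}) = 1" using k s by simp
    then obtain s' where d2: "S - {c, s} = {s'}" using card_1_singletonE by blast
    note d = d1 d2
    have N: "N = {c, n, n'}" and S: "S = {c, s, s'}" using cNS n s d by blast+
    have dd: "c \<noteq> n" "n \<noteq> n'" "c \<noteq> n'" "c \<noteq> s" "s \<noteq> s'" "c \<noteq> s'" using n s d by blast+
    have av: "avoids (f n) n" "avoids (f n) s" using f_avoids tile_D[OF t n(1)] tile_D[OF t' s(1)] fe by metis+
    show False using opposite_triangles[OF t[unfolded N] dd(1-3) t'[unfolded S] dd(4-6) p0 av] .
  qed
  have inj: "inj_on f (N \<union> S)"
  proof (rule inj_onI, rule ccontr)
    fix a b assume ab: "a \<in> N \<union> S" "b \<in> N \<union> S" "f a = f b" "a \<noteq> b"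
    then have D: "a \<in> D" "b \<in> D" using tile_D t t' by blast+
    have av: "avoids (f a) a" "avoids (f a) b" using f_avoids D ab(3) by metis+
    consider "a \<in> N \<and> b \<in> N" | "a \<in> S \<and> b \<in> S" | "a \<in> N \<and> a \<notin> S \<and> b \<in> S \<and> b \<notin> N" | "a \<in> S \<and> a \<notin> N \<and> b \<in> N \<and> b \<notin> S" using ab by blast
    then show False
    proof cases
      case 1 then show False using triangle_avoids[OF t k(1) _ _ ab(4) av] by blast
    next
      case 2 then show False using triangle_avoids[OF t' k(2) _ _ ab(4) av] by blast
    next
      case 3 then show False using cross[of a b] ab c by blast
    next
      case 4 then show False using cross[of b a] ab c by (metis IntI singletonI Int_iff)
    qed
  qed
  have pn: "p \<notin> f ` (N \<union> S)"
  proof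
    assume "p \<in> f ` (N \<union> S)"
    then obtain a where a: "a \<in> N \<union> S" "f a = p" by auto
    then have "a \<in> D" using tile_D t t' by blast
    then have "avoids p a" using f_avoids a by metis
    then show False using avoids_notin_tile[OF t] avoids_notin_tile[OF t' avoids_uminus] a by blast
  qed
  have "insert p (f ` (N \<union> S)) \<subseteq> Q" using fQ a0 tile_D t t' unfolding fibre_def by blast
  then have "card (insert p (f ` (N \<union> S))) \<le> 5" using card_mono[OF finQ] cardQ by metis
  moreover have "card (insert p (f ` (N \<union> S))) = Suc (card (N \<union> S))" using pn f card_image[OF inj] by simp
  moreover have "card (N \<union> S) = 5" using card_Un_Int[OF f] k by simp
  ultimately show False by simp
qed

lemma fibre_disjoint:
  assumes "tile D p \<nu> N" "tile D (- p) \<nu>' S" shows "(N \<union> S) \<inter> fibre p = {}"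
  using avoids_notin_tile[OF assms(1)] avoids_notin_tile[OF assms(2) avoids_uminus] fibre_avoids by blast

lemma fibre_card: assumes "fibre p \<noteq> {}" shows "6 + card (fibre p) \<le> card D"
proof -
  obtain a0 where a0: "a0 \<in> fibre p" using assms by auto
  obtain \<nu> N where t: "tile D p \<nu> N" using tile_exists .
  obtain \<nu>' S where t': "tile D (- p) \<nu>' S" using tile_exists .
  have "card (N \<union> S) + card (fibre p) = card ((N \<union> S) \<union> fibre p)"
    using fibre_disjoint[OF t t'] tile_finite t t' fin by (intro card_Un_disjoint[symmetric]) (auto simp: fibre_def)
  also have "\<dots> \<le> card D" using tile_D t t' fin by (intro card_mono) (auto simp: fibre_def)
  finally show ?thesis using six_sides[OF a0 t t'] by simp
qed

lemma card_fibres: "card D = (\<Sum>p\<in>Q. card (fibre p))"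
proof -
  have "(\<Sum>p\<in>Q. \<Sum>a\<in>{a \<in> D. f a = p}. 1) = (\<Sum>a\<in>D. 1::nat)" using fQ by (intro sum.group fin finQ) auto
  then show ?thesis by (simp add: fibre_def)
qed

lemma sd_bound: "8 \<le> card D"
proof -
  have b: "card (fibre p) \<le> card D - 6" for p
    using fibre_card[of p] by (cases "fibre p = {}") auto
  have "card D \<le> (\<Sum>p\<in>Q. card D - 6)" unfolding card_fibres[symmetric] using b card_fibres sum_mono[of Q "\<lambda>p. card (fibre p)" "\<lambda>p. card D - 6"] by simp
  then have "card D \<le> 5 * (card D - 6)" using cardQ by simp
  \<comment> \<open>Subtraction is truncated, so the inequality alone would also admit an empty
    diagram.\<close>
  moreover have "0 < card D" using fin nonempty by (simp add: card_gt_0_iff)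
  ultimately show ?thesis by simp
qed

end

lemma coloured_exists:
  assumes "spherical_diagram D" "k_oriented 5 D"
  obtains f Q where "coloured D f Q"
proof -
  obtain P f where P: "finite P" "card P = 5" "\<forall>x\<in>P. norm x = 1"
    and f: "\<forall>a\<in>D. f a \<in> P \<and> f a \<in> span {fst a, snd a} \<and> f a \<notin> arc_set a \<and> - f a \<notin> arc_set a"
    using assms(2) unfolding k_oriented_def by blast
  have "avoids (f a) a" if a: "a \<in> D" for a
  proof -
    have n: "norm (f a) = 1" using P f a by blast
    then have nz: "f a \<noteq> 0" by auto
    have s: "sgn (f a) = f a" "sgn (- f a) = - f a" using n by (simp_all add: sgn_div_norm)
    show ?thesis unfolding avoids_def
      using nz f a cone_arc_set[of "f a" a] cone_arc_set[of "- f a" a] s by auto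
  qed
  then have "coloured D f P" using assms P f by unfold_locales blast+
  then show thesis by (rule that)
qed

subsection \<open>A triangle and the opposite tile sharing a side\<close>

lemma region_scale: "x \<in> region \<nu> N \<Longrightarrow> 0 \<le> s \<Longrightarrow> s *\<^sub>R x \<in> region \<nu> N"
  by (simp add: region_def)

text \<open>The end u is the one nearer to the pole p.\<close>
lemma avoids_top:
  assumes "valid_arc A" "avoids p A" "s \<in> arc_cone A" "s \<noteq> 0"
  obtains u v g h \<alpha> \<beta> where "ends A u v" "u = g *\<^sub>R s + h *\<^sub>R p" "0 < g" "0 \<le> h" "p = \<alpha> *\<^sub>R u - \<beta> *\<^sub>R v" "0 < \<alpha>" "0 < \<beta>"
proof -
  obtain m where m: "is_normal A m" using is_normal_arc_normal assms(1) by blast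
  obtain a b where ab: "p = a *\<^sub>R fst A + b *\<^sub>R snd A" using is_normal_plane[OF assms(1) m avoids_normal[OF assms(2) m] ends_fst] .
  obtain u v \<alpha> \<beta> where uv: "ends A u v" "p = \<alpha> *\<^sub>R u - \<beta> *\<^sub>R v" "0 < \<alpha>" "0 < \<beta>"
  proof -
    from avoids_signs[OF ends_in_cone[OF ends_fst] ends_in_cone[OF ends_snd] ab assms(2)] show thesis
    proof (elim disjE conjE)
      assume "0 < a" "b < 0" then show thesis using that[OF ends_fst[of A], of a "- b"] ab by simp
    next
      assume "a < 0" "0 < b" then show thesis using that[OF ends_snd[of A], of b "- a"] ab by (simp add: algebra_simps)
    qed
  qed
  obtain s1 s2 where s: "0 \<le> s1" "0 \<le> s2" "s = s1 *\<^sub>R u + s2 *\<^sub>R v" using assms(3) unfolding ends_cone[OF uv(1)] by auto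
  \<comment> \<open>Eliminating v from s by means of p = \<alpha> u - \<beta> v leaves k as the
    coefficient of u.\<close>
  define k where "k = s1 + s2 * \<alpha> / \<beta>"
  have k: "0 < k"
  proof (cases "s1 = 0")
    case True
    then have "s2 \<noteq> 0" using s assms(4) by auto
    then have "0 < s2 * \<alpha> / \<beta>" using s uv by simp
    then show ?thesis unfolding k_def using True by simp
  next
    case False
    have "0 \<le> s2 * \<alpha> / \<beta>" using s uv by simp
    then show ?thesis unfolding k_def using False s by simp
  qed
  have "k *\<^sub>R u = s + (s2 / \<beta>) *\<^sub>R p" unfolding k_def s(3) uv(2) using uv(4) by (simp add: algebra_simps)
  then have "(1/k) *\<^sub>R (k *\<^sub>R u) = (1/k) *\<^sub>R (s + (s2 / \<beta>) *\<^sub>R p)" by simp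
  then have "u = (1/k) *\<^sub>R s + (s2 / \<beta> / k) *\<^sub>R p" using k by (simp add: scaleR_right_distrib)
  then show thesis using that[OF uv(1), of "1/k" "s2 / \<beta> / k" \<alpha> \<beta>] k s uv by simp
qed

lemma cone_nonneg: "ends a e o' \<Longrightarrow> 0 \<le> m \<bullet> e \<Longrightarrow> 0 \<le> m \<bullet> o' \<Longrightarrow> x \<in> arc_cone a \<Longrightarrow> 0 \<le> m \<bullet> x"
  by (auto simp: ends_cone inner_add_right)

lemma icone_pos: "ends a e o' \<Longrightarrow> m \<bullet> e = 0 \<Longrightarrow> 0 < m \<bullet> o' \<Longrightarrow> x \<in> arc_icone a \<Longrightarrow> 0 < m \<bullet> x"
  by (auto simp: ends_icone inner_add_right)

lemma icone_neg: "ends a e o' \<Longrightarrow> m \<bullet> e = 0 \<Longrightarrow> m \<bullet> o' < 0 \<Longrightarrow> x \<in> arc_icone a \<Longrightarrow> m \<bullet> x < 0"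
  by (auto simp: ends_icone inner_add_right mult_less_0_iff)

lemma ends_separated:
  assumes "x \<in> arc_icone a" "m \<bullet> x = 0" "y \<in> arc_cone a" "m \<bullet> y \<noteq> 0"
  obtains e o' where "ends a e o'" "0 < m \<bullet> e" "m \<bullet> o' < 0"
proof -
  obtain s t where st: "0 < s" "0 < t" "x = s *\<^sub>R fst a + t *\<^sub>R snd a" using assms(1) unfolding arc_icone_def by auto
  have e: "s * (m \<bullet> fst a) + t * (m \<bullet> snd a) = 0" using assms(2) unfolding st(3) by (simp add: inner_add_right)
  consider "0 < m \<bullet> fst a" | "m \<bullet> fst a < 0" | "m \<bullet> fst a = 0" by linarith
  then show thesis
  proof cases
    case 1
    then have "0 < s * (m \<bullet> fst a)" using st by simp
    then have "t * (m \<bullet> snd a) < 0" using e by linarith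
    then show thesis using that[OF ends_fst 1] st by (simp add: mult_less_0_iff)
  next
    case 2
    then have "s * (m \<bullet> fst a) < 0" using st by (simp add: mult_less_0_iff)
    then have "0 < t * (m \<bullet> snd a)" using e by linarith
    then show thesis using that[OF ends_snd _ 2] st by (simp add: zero_less_mult_iff)
  next
    case 3
    then have "m \<bullet> snd a = 0" using e st by simp
    then have "m \<bullet> y = 0" using 3 assms(3) unfolding arc_cone_def by (auto simp: inner_add_right)
    then show thesis using assms(4) by simp
  qed
qed

context spherical
begin

lemma hit_not_normal:
  assumes "a \<in> D" "b \<in> D" "ends b e o'" "e \<in> arc_icone a" "is_normal b m" shows "\<not> is_normal a m"
  using hit_transversal[OF assms(1-4)] is_normal_ends[OF assms(5) ends_sym[OF assms(3)]] by blast

lemma avoids_no_hit: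
  assumes "a \<in> D" "b \<in> D" "ends b e o'" "e \<in> arc_icone a" "avoids p a" "avoids p b" shows False
proof -
  obtain m where m: "is_normal b m" using is_normal_arc_normal valid assms(2) by blast
  have "e = 0" using avoids_touch[OF assms(2,1,6,5) m hit_not_normal[OF assms(1-4) m] ends_in_cone[OF assms(3)] icone_sub_cone[OF assms(4)]] .
  then show False using ends_nonzero[OF valid[OF assms(2)] assms(3)] by simp
qed

text \<open>Interiors of different arcs are disjoint, so a point of b interior to \<open>a\<close>
  can only be an end of b, up to scaling.\<close>

lemma touch_hit:
  assumes "a \<in> D" "b \<in> D" "a \<noteq> b" "x \<in> arc_icone a" "x \<in> arc_cone b"
  obtains k e o' where "ends b e o'" "0 < k" "x = k *\<^sub>R e" "e \<in> arc_icone a"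
proof -
  have x0: "x \<noteq> 0" using icone_nonzero[OF valid[OF assms(1)] assms(4)] .
  from cone_cases[OF assms(5) x0] show thesis
  proof cases
    case 1 then show thesis using icone_disjoint assms by blast
  next
    case (2 k e o')
    have "e = (1/k) *\<^sub>R x" using 2 by simp
    then show thesis using that[OF 2] icone_scale[OF assms(4), of "1/k"] 2(2) by simp
  qed
qed

end

locale occlusion = spherical +
  assumes one_sided: "\<lbrakk>a \<in> D; b \<in> D; b' \<in> D; ends b e o'; e \<in> arc_icone a; ends b' e2 o2; e2 \<in> arc_icone a; is_normal a m; 0 < m \<bullet> o'\<rbrakk>
    \<Longrightarrow> 0 < m \<bullet> o2"
begin

end

text \<open>A triangular tile at p with sides c, n1, n2 and an opposite tile sharing exactly the side c.
The functionals g, m1, m2 are the coordinates with respect to the corners P, x2, x1.\<close>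
locale shared_side = occlusion +
  fixes p :: pt and \<nu> \<nu>' :: "arc \<Rightarrow> pt" and S :: "arc set" and c n1 n2 :: arc and x1 P x2 g m1 m2 :: pt
  assumes t: "tile D p \<nu> {c, n1, n2}" and dist: "c \<noteq> n1" "n1 \<noteq> n2" "c \<noteq> n2"
    and t': "tile D (- p) \<nu>' S" and p0: "p \<noteq> 0" and cS: "c \<in> S" and nS: "n1 \<notin> S" "n2 \<notin> S" and cardS: "card S = 4"
    and rest: "a \<in> D \<Longrightarrow> a \<noteq> c \<Longrightarrow> a \<noteq> n1 \<Longrightarrow> a \<noteq> n2 \<Longrightarrow> a \<notin> S \<Longrightarrow> avoids p a"
    and gm: "g = \<nu> c" "m1 = \<nu> n1" "m2 = \<nu> n2"
    and x1: "g \<bullet> x1 = 0" "m1 \<bullet> x1 = 0" "m2 \<bullet> x1 = 1" "x1 \<in> arc_cone c" "x1 \<in> arc_cone n1" "x1 \<in> region \<nu> {c, n1, n2}"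
    and P: "m1 \<bullet> P = 0" "m2 \<bullet> P = 0" "g \<bullet> P = 1" "P \<in> arc_cone n1" "P \<in> arc_cone n2" "P \<in> region \<nu> {c, n1, n2}"
    and x2: "m2 \<bullet> x2 = 0" "g \<bullet> x2 = 0" "m1 \<bullet> x2 = 1" "x2 \<in> arc_cone n2" "x2 \<in> arc_cone c" "x2 \<in> region \<nu> {c, n1, n2}"
    and repr: "q = (m2 \<bullet> q) *\<^sub>R x1 + (g \<bullet> q) *\<^sub>R P + (m1 \<bullet> q) *\<^sub>R x2"
begin

lemma D: "c \<in> D" "n1 \<in> D" "n2 \<in> D" using tile_D[OF t] by auto

lemma SD: "s \<in> S \<Longrightarrow> s \<in> D" using tile_D[OF t'] .

lemma normals: "is_normal c g" "is_normal n1 m1" "is_normal n2 m2"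
  using tile_normal[OF t] gm by auto

lemma p_coords: "0 < g \<bullet> p" "0 \<le> m1 \<bullet> p" "0 \<le> m2 \<bullet> p"
  using common_side(1)[OF t t' p0 _ cS] tile_nn[OF t _ tile_p[OF t]] gm by auto

lemma S_nonpos: "x \<in> region \<nu>' S \<Longrightarrow> g \<bullet> x \<le> 0"
  using common_side_nonpos[OF t t' p0 _ cS] gm by simp

lemma in_n1: assumes "m1 \<bullet> q = 0" "0 < m2 \<bullet> q" "0 < g \<bullet> q" shows "q \<in> arc_icone n1"
proof -
  have "cross3 x1 P \<noteq> 0" by (rule cross_nonzero_functional[of _ g]) (use x1 P in auto)
  from cone_sum_icone[OF valid[OF D(2)] x1(5) P(4) this assms(2,3)] show ?thesis using repr[of q] assms(1) by simp
qed

lemma in_n2: assumes "m2 \<bullet> q = 0" "0 < m1 \<bullet> q" "0 < g \<bullet> q" shows "q \<in> arc_icone n2"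
proof -
  have "cross3 P x2 \<noteq> 0" by (rule cross_nonzero_functional[of _ m1]) (use x2 P in auto)
  from cone_sum_icone[OF valid[OF D(3)] P(5) x2(4) this assms(3,2)] show ?thesis using repr[of q] assms(1) by simp
qed

lemma in_c: assumes "g \<bullet> q = 0" "0 < m1 \<bullet> q" "0 < m2 \<bullet> q" shows "q \<in> arc_icone c"
proof -
  have "cross3 x1 x2 \<noteq> 0" by (rule cross_nonzero_functional[of _ m1]) (use x2 x1 in auto)
  from cone_sum_icone[OF valid[OF D(1)] x1(4) x2(5) this assms(3,2)] show ?thesis using repr[of q] assms(1) by simp
qed

lemma not_avoids: "a \<in> {c, n1, n2} \<Longrightarrow> \<not> avoids p a" "a \<in> S \<Longrightarrow> \<not> avoids p a"
  using avoids_notin_tile[OF t] avoids_notin_tile[OF t' avoids_uminus] by blast+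

lemma contact: assumes "s \<in> S" obtains r where "r \<in> arc_icone s" "r \<in> region \<nu>' S" "g \<bullet> r \<le> 0"
  using tile_contact[OF t' assms] S_nonpos by blast

lemma inner_repr: "\<phi> \<bullet> q = (m2 \<bullet> q) * (\<phi> \<bullet> x1) + (g \<bullet> q) * (\<phi> \<bullet> P) + (m1 \<bullet> q) * (\<phi> \<bullet> x2)"
  by (subst repr[of q]) (simp add: inner_add_right)

lemma swap: "shared_side D p \<nu> \<nu>' S c n2 n1 x2 P x1 g m2 m1"
proof unfold_locales
  show "tile D p \<nu> {c, n2, n1}" using t by (simp add: insert_commute)
  show "q = (m1 \<bullet> q) *\<^sub>R x2 + (g \<bullet> q) *\<^sub>R P + (m2 \<bullet> q) *\<^sub>R x1" for q
    using repr[of q] by (simp add: algebra_simps)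
qed (use dist t' p0 cS nS cardS rest gm x1 P x2 in \<open>auto simp: insert_commute\<close>)

text \<open>If P is not interior to n2 it is an end of n2, blocked by a side of the triangle. The
  side c is excluded because g is positive at P, so n1 remains. Up to exchanging n1 and n2, n1
  therefore ends on n2.\<close>

lemma P_hit: "P \<in> arc_icone n1 \<or> P \<in> arc_icone n2"
proof (rule disjCI)
  assume n: "P \<notin> arc_icone n2"
  have P0: "P \<noteq> 0" using P(3) by auto
  from cone_cases[OF P(5) P0] n obtain k e o' where e: "ends n2 e o'" "0 < k" "P = k *\<^sub>R e" by metis
  have ek: "e = (1/k) *\<^sub>R P" using e by simp
  have "e \<in> region \<nu> {c, n1, n2}" using P(6) unfolding ek using e(2) by (simp add: region_def)
  then obtain a where a: "a \<in> {c, n1, n2}" "e \<in> arc_icone a" using tile_blocker[OF t D(3) e(1)] by blast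
  have "a \<noteq> n2" using not_self_hit[OF D(3) e(1) a(2)] .
  moreover have "a \<noteq> c" using is_normal_icone[OF normals(1), of e] a(2) P(3) e by auto
  ultimately have "e \<in> arc_icone n1" using a by auto
  then show "P \<in> arc_icone n1" using icone_scale e by blast
qed

end

section \<open>The common side is hit only from the side of the opposite tile\<close>

locale shared_side_below = shared_side +
  assumes below: "b \<in> D \<Longrightarrow> ends b e o' \<Longrightarrow> e \<in> arc_icone c \<Longrightarrow> g \<bullet> o' < 0"
begin

text \<open>Were the corner interior to c, the arc n1 would hit c there, coming from the side of P,
  where g is positive. So c ends at the corner, and its blocker can only be n1.\<close>

lemma x1_end: obtains k E where "0 < k" "x1 = k *\<^sub>R E" "E = fst c \<or> E = snd c" "E \<in> arc_icone n1"
proof -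
  have x10: "x1 \<noteq> 0" using x1(3) by auto
  have "x1 \<notin> arc_icone c"
  proof
    assume i: "x1 \<in> arc_icone c"
    obtain k e o' where e: "ends n1 e o'" "0 < k" "x1 = k *\<^sub>R e" "e \<in> arc_icone c" using touch_hit[OF D(1,2) dist(1) i x1(5)] .
    have "g \<bullet> o' < 0" using below[OF D(2) e(1,4)] .
    moreover have "g \<bullet> e = 0" using is_normal_icone[OF normals(1) e(4)] .
    ultimately have "g \<bullet> P \<le> 0" using cone_nonpos[OF e(1) _ _ P(4)] by simp
    then show False using P(3) by simp
  qed
  then obtain k E F where E: "ends c E F" "0 < k" "x1 = k *\<^sub>R E" using cone_cases[OF x1(4) x10] by metis
  have Ek: "E = (1/k) *\<^sub>R x1" using E by simp
  have "E \<in> region \<nu> {c, n1, n2}" using x1(6) unfolding Ek using E(2) by (simp add: region_def)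
  then obtain a where a: "a \<in> {c, n1, n2}" "E \<in> arc_icone a" using tile_blocker[OF t D(1) E(1)] by blast
  have "a \<noteq> c" using not_self_hit[OF D(1) E(1) a(2)] .
  moreover have "a \<noteq> n2" using is_normal_icone[OF normals(3), of E] a(2) x1(3) E by auto
  ultimately have "E \<in> arc_icone n1" using a by auto
  then show thesis using that E unfolding ends_def by blast
qed

lemma swap_below: "shared_side_below D p \<nu> \<nu>' S c n2 n1 x2 P x1 g m2 m1"
  unfolding shared_side_below_def shared_side_below_axioms_def using swap below by auto

lemma c_ends: obtains k1 E1 k2 E2 where "0 < k1" "x1 = k1 *\<^sub>R E1" "0 < k2" "x2 = k2 *\<^sub>R E2" "ends c E1 E2" "E1 \<in> arc_icone n1" "E2 \<in> arc_icone n2"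
proof -
  interpret sw: shared_side_below D p \<nu> \<nu>' S c n2 n1 x2 P x1 g m2 m1 by (rule swap_below)
  obtain k1 E1 where 1: "0 < k1" "x1 = k1 *\<^sub>R E1" "E1 = fst c \<or> E1 = snd c" "E1 \<in> arc_icone n1" using x1_end .
  obtain k2 E2 where 2: "0 < k2" "x2 = k2 *\<^sub>R E2" "E2 = fst c \<or> E2 = snd c" "E2 \<in> arc_icone n2" using sw.x1_end .
  have "E1 \<noteq> E2" using 1 2 x1 x2 by auto
  then have "ends c E1 E2" using 1(3) 2(3) unfolding ends_def by auto
  then show thesis using that 1 2 by blast
qed

text \<open>The side c itself hits n1, coming from the triangle, and one-sidedness extends this to
  all arcs hitting n1.\<close>

lemma n1_side: assumes "b \<in> D" "ends b e o'" "e \<in> arc_icone n1" shows "0 < m1 \<bullet> o'"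
proof -
  obtain k1 E1 k2 E2 where E: "0 < k2" "x2 = k2 *\<^sub>R E2" "ends c E1 E2" "E1 \<in> arc_icone n1" by (rule c_ends)
  have "k2 * (m1 \<bullet> E2) = 1" using x2(3) E(2) by simp
  then have "0 < m1 \<bullet> E2" using E(1) by (metis zero_less_mult_pos zero_less_one)
  then show ?thesis using one_sided[OF D(2) D(1) assms(1) E(3,4) assms(2,3) normals(2)] by blast
qed

text \<open>Above the plane of c only n1, n2, one further side s3 of the opposite tile and arcs of
  pole p can occur. Following the blockers from the end \<omega> of n2 beyond P leaves no consistent
  choice.\<close>

lemma contradiction_aux:
  assumes P2: "P \<in> arc_icone n2"
  shows False
proof -
  interpret sw: shared_side_below D p \<nu> \<nu>' S c n2 n1 x2 P x1 g m2 m1 by (rule swap_below)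
  note n2_side = sw.n1_side
  obtain k1 E1 k2 E2 where E: "0 < k1" "x1 = k1 *\<^sub>R E1" "0 < k2" "x2 = k2 *\<^sub>R E2" "ends c E1 E2" "E1 \<in> arc_icone n1" "E2 \<in> arc_icone n2"
    by (rule c_ends)
  have x2i: "x2 \<in> arc_icone n2" using icone_scale E by blast
  have Ereg: "E1 \<in> region \<nu> {c, n1, n2}" "E2 \<in> region \<nu> {c, n1, n2}"
  proof -
    have "(1/k1) *\<^sub>R x1 = E1" "(1/k2) *\<^sub>R x2 = E2" using E(1-4) by simp_all
    then show "E1 \<in> region \<nu> {c, n1, n2}" "E2 \<in> region \<nu> {c, n1, n2}"
      using region_scale[OF x1(6), of "1/k1"] region_scale[OF x2(6), of "1/k2"] E(1,3) by simp_all
  qed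
  \<comment> \<open>A neighbour of c in the opposite tile cannot block an end of c, since that end
    lies in the triangle and its blocker would be a side there. So the neighbour hits c, necessarily
    from below, and stays below.\<close>
  have nb: "g \<bullet> x \<le> 0" if s: "s \<in> S" "s \<noteq> c" "r \<noteq> 0" "r \<in> arc_cone s" "(\<exists>e. (e = fst c \<or> e = snd c) \<and> r = e \<and> e \<in> arc_icone s) \<or> r \<in> arc_icone c"
    and x: "x \<in> arc_cone s" for s r x
  proof -
    have "r \<in> arc_icone c"
    proof (rule ccontr)
      assume "r \<notin> arc_icone c"
      then obtain e where "e = fst c \<or> e = snd c" "e \<in> arc_icone s" using s(5) by blast
      then have "e \<in> region \<nu> {c, n1, n2}" "e \<in> arc_icone s" using Ereg E(5) unfolding ends_def by auto
      then have "s \<in> {c, n1, n2}" using tile_I[OF t SD[OF s(1)]] by blast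
      then show False using s nS by auto
    qed
    then obtain k e o' where e: "ends s e o'" "0 < k" "r = k *\<^sub>R e" "e \<in> arc_icone c"
      using touch_hit[OF D(1) SD[OF s(1)] s(2)[symmetric] _ s(4)] by blast
    have "g \<bullet> o' < 0" using below[OF SD[OF s(1)] e(1,4)] .
    then show ?thesis using cone_nonpos[OF e(1) _ _ x] is_normal_icone[OF normals(1) e(4)] by simp
  qed
  obtain s1 r1 s2 r2 where s: "s1 \<in> S" "s2 \<in> S" "s1 \<noteq> c" "s2 \<noteq> c" "s1 \<noteq> s2"
    "r1 \<noteq> 0" "r1 \<in> arc_cone s1" "r1 = fst c \<and> fst c \<in> arc_icone s1 \<or> r1 \<in> arc_icone c"
    "r2 \<noteq> 0" "r2 \<in> arc_cone s2" "r2 = snd c \<and> snd c \<in> arc_icone s2 \<or> r2 \<in> arc_icone c"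
    by (rule tile_two_neighbours[OF t' cS]) blast
  have s1n: "g \<bullet> x \<le> 0" if "x \<in> arc_cone s1" for x by (rule nb[OF s(1,3,6,7) _ that]) (use s(8) in blast)
  have s2n: "g \<bullet> x \<le> 0" if "x \<in> arc_cone s2" for x by (rule nb[OF s(2,4,9,10) _ that]) (use s(11) in blast)
  have "card (S - {c, s1, s2}) = card S - card {c, s1, s2}" by (rule card_Diff_subset) (use s cS in auto)
  also have "card {c, s1, s2} = 3" using s by auto
  finally have "card (S - {c, s1, s2}) = 1" using cardS by simp
  then obtain s3 where s3: "S - {c, s1, s2} = {s3}" using card_1_singletonE by blast
  have s3S: "s3 \<in> S" "s3 \<noteq> c" using s3 by blast+
  have classes: "a = c \<or> a = n1 \<or> a = n2 \<or> a = s1 \<or> a = s2 \<or> a = s3 \<or> avoids p a" if "a \<in> D" for a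
    using rest[OF that] s3 by blast
  have s3D: "s3 \<in> D" using SD s3S by auto
  have pos: "a = n1 \<or> a = n2 \<or> a = s3 \<or> avoids p a" if "a \<in> D" "e \<in> arc_icone a" "0 < g \<bullet> e" for a e
    using classes[OF that(1)] is_normal_icone[OF normals(1), of e] s1n[of e] s2n[of e] icone_sub_cone[OF that(2)] that by auto
  \<comment> \<open>The upper end u of an arc of pole p cannot lie on n1 or n2: it would arrive from
    the inner side, and p = \<alpha> u - \<beta> v would put p strictly outside the triangle. Only
    s3 can block it.\<close>
  have top: thesis if A: "A \<in> D" "avoids p A" "w \<in> arc_cone A" "0 < g \<bullet> w"
    and th: "\<And>u v k h. ends A u v \<Longrightarrow> u = k *\<^sub>R w + h *\<^sub>R p \<Longrightarrow> 0 < k \<Longrightarrow> 0 \<le> h \<Longrightarrow> u \<in> arc_icone s3 \<Longrightarrow> thesis" for A w thesis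
  proof -
    have "w \<noteq> 0" using A by auto
    from avoids_top[OF valid[OF A(1)] A(2,3) this] obtain u v k h \<alpha> \<beta> where
      u: "ends A u v" "u = k *\<^sub>R w + h *\<^sub>R p" "0 < k" "0 \<le> h" "p = \<alpha> *\<^sub>R u - \<beta> *\<^sub>R v" "0 < \<alpha>" "0 < \<beta>" .
    have gu: "0 < g \<bullet> u" unfolding u(2) using u(3,4) A(4) p_coords by (simp add: inner_add_right add_pos_nonneg)
    obtain y where y: "y \<in> D" "u \<in> arc_icone y" using blocked[OF A(1) u(1)] .
    have notn: False if "n \<in> D" "u \<in> arc_icone n" "is_normal n m" "0 \<le> m \<bullet> p" "0 < m \<bullet> v" for n m
    proof -
      have "m \<bullet> u = 0" using is_normal_icone that by blast
      then have "m \<bullet> p = - (\<beta> * (m \<bullet> v))" unfolding u(5) by (simp add: inner_diff_right)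
      moreover have "0 < \<beta> * (m \<bullet> v)" using u(7) that(5) by simp
      ultimately show False using that(4) by linarith
    qed
    have "y \<noteq> n1" using notn[OF _ _ normals(2) p_coords(2)] n1_side[OF A(1) u(1)] y by blast
    moreover have "y \<noteq> n2" using notn[OF _ _ normals(3) p_coords(3)] n2_side[OF A(1) u(1)] y by blast
    moreover have "\<not> avoids p y" using avoids_no_hit[OF y(1) A(1) u(1) y(2) _ A(2)] by blast
    ultimately have "y = s3" using pos[OF y gu] by blast
    then show thesis using th u y by blast
  qed
  obtain \<omega> e0 where om: "ends n2 \<omega> e0" "0 < g \<bullet> \<omega>" "g \<bullet> e0 < 0"
    using ends_separated[OF x2i x2(2) icone_sub_cone[OF P2]] P(3) by auto
  have omn: "m2 \<bullet> \<omega> = 0" using is_normal_ends[OF normals(3) om(1)] .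
  have om1: "m1 \<bullet> \<omega> < 0"
  proof (rule ccontr)
    assume "\<not> m1 \<bullet> \<omega> < 0"
    then have "(g \<bullet> \<omega>) *\<^sub>R P + (m1 \<bullet> \<omega>) *\<^sub>R x2 \<in> arc_icone n2" using icone_comb'[OF P2 x2(4) om(2)] by simp
    then have "\<omega> \<in> arc_icone n2" using repr[of \<omega>] omn by simp
    then show False using end_notin_icone[OF valid[OF D(3)] om(1), of 1] by simp
  qed
  obtain t3 where t3: "t3 \<in> arc_icone s3" "t3 \<in> region \<nu>' S" "g \<bullet> t3 \<le> 0" using contact[OF s3S(1)] .
  \<comment> \<open>If the upper end of s3 lay on an arc of pole p, the upper end of that arc would
    lie on s3, and the two would block each other.\<close>
  have follow: thesis if b: "b \<in> arc_icone s3" "0 < g \<bullet> b"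
    and th: "\<And>w v. ends s3 w v \<Longrightarrow> 0 < g \<bullet> w \<Longrightarrow> (w \<in> arc_icone n1 \<and> 0 < m1 \<bullet> v) \<or> (w \<in> arc_icone n2 \<and> 0 < m2 \<bullet> v) \<Longrightarrow> thesis" for b thesis
  proof -
    obtain w v where w: "ends s3 w v" "0 < g \<bullet> w"
    proof (cases "0 < g \<bullet> fst s3")
      case True then show thesis using that ends_fst by blast
    next
      case False
      then have "\<not> g \<bullet> snd s3 \<le> 0" using cone_nonpos[OF ends_fst _ _ icone_sub_cone[OF b(1)], of g] b(2) by auto
      then show thesis using that[OF ends_snd] by simp
    qed
    obtain z where z: "z \<in> D" "w \<in> arc_icone z" using blocked[OF s3D w(1)] .
    have "z \<noteq> s3" using not_self_hit[OF s3D w(1) z(2)] .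
    moreover have "\<not> avoids p z"
    proof
      assume az: "avoids p z"
      show False
        by (rule top[OF z(1) az icone_sub_cone[OF z(2)] w(2)]) (use no_mutual_hit[OF z(1) s3D _ w(1) _ z(2)] in blast)
    qed
    ultimately consider "z = n1" | "z = n2" using pos[OF z w(2)] by blast
    then show thesis using th[OF w] n1_side[OF s3D w(1)] n2_side[OF s3D w(1)] z by cases auto
  qed
  obtain y where y: "y \<in> D" "\<omega> \<in> arc_icone y" using blocked[OF D(3) om(1)] .
  have "y \<noteq> n1" using is_normal_icone[OF normals(2), of \<omega>] y om1 by auto
  moreover have "y \<noteq> n2" using not_self_hit[OF D(3) om(1) y(2)] .
  ultimately consider "y = s3" | "avoids p y" using pos[OF y om(2)] by blast
  then show False
  proof cases
    \<comment> \<open>As s3 carries an end of n2, it cannot itself end on n2. Ending on n1 from the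
      inner side it would stay where m1 is positive, unlike \<omega>.\<close>
    case 1
    then have os: "\<omega> \<in> arc_icone s3" using y by simp
    show False
    proof (rule follow[OF os om(2)])
      fix w v assume w: "ends s3 w v" "0 < g \<bullet> w" "(w \<in> arc_icone n1 \<and> 0 < m1 \<bullet> v) \<or> (w \<in> arc_icone n2 \<and> 0 < m2 \<bullet> v)"
      have "w \<notin> arc_icone n2" using no_mutual_hit[OF D(3) s3D om(1) w(1) os] by blast
      then have w1: "w \<in> arc_icone n1" "0 < m1 \<bullet> v" using w by auto
      have "0 < m1 \<bullet> \<omega>" using icone_pos[OF w(1) is_normal_icone[OF normals(2) w1(1)] w1(2) os] .
      then show False using om1 by simp
    qed
  next
    case A: 2
    show False
    proof (rule top[OF y(1) A icone_sub_cone[OF y(2)] om(2)])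
      fix u v k h assume u: "ends y u v" "u = k *\<^sub>R \<omega> + h *\<^sub>R p" "0 < k" "0 \<le> h" "u \<in> arc_icone s3"
      have "h \<noteq> 0"
      proof
        assume "h = 0"
        then have "k *\<^sub>R \<omega> = 1 *\<^sub>R u" using u by simp
        then show False using end_notin_icone[OF valid[OF y(1)] u(1), of 1] icone_scale[OF y(2) u(3)] by simp
      qed
      then have h: "0 < h" using u by simp
      have gu: "0 < g \<bullet> u" unfolding u(2) using u(3,4) om p_coords by (simp add: inner_add_right add_pos_nonneg)
      have m2u: "m2 \<bullet> u = h * (m2 \<bullet> p)" unfolding u(2) using omn by (simp add: inner_add_right)
      have yn: "y \<noteq> n1" "y \<noteq> n2" using A not_avoids(1) by blast+
      show False
      proof (rule follow[OF u(5) gu])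
        fix w v' assume w: "ends s3 w v'" "0 < g \<bullet> w" "(w \<in> arc_icone n1 \<and> 0 < m1 \<bullet> v') \<or> (w \<in> arc_icone n2 \<and> 0 < m2 \<bullet> v')"
        from w(3) show False
        proof (elim disjE conjE)
          assume w1: "w \<in> arc_icone n1" "0 < m1 \<bullet> v'"
          have mu: "0 < m1 \<bullet> u" using icone_pos[OF w(1) is_normal_icone[OF normals(2) w1(1)] w1(2) u(5)] .
          \<comment> \<open>The point where y crosses the plane of n1 between \<omega> and u. It is
            interior to n1 or a multiple of P, so y would overlap n1 or n2.\<close>
          define q where "q = (m1 \<bullet> u) *\<^sub>R \<omega> + (- (m1 \<bullet> \<omega>)) *\<^sub>R u"
          have qy: "q \<in> arc_icone y" unfolding q_def by (rule icone_comb'[OF y(2) ends_in_cone[OF u(1)] mu]) (use om1 in simp)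
          have iq: "\<phi> \<bullet> q = (m1 \<bullet> u) * (\<phi> \<bullet> \<omega>) + (- (m1 \<bullet> \<omega>)) * (\<phi> \<bullet> u)" for \<phi>
            unfolding q_def by (simp only: inner_add_right inner_scaleR_right)
          have "0 < (m1 \<bullet> u) * (g \<bullet> \<omega>)" "0 < (- (m1 \<bullet> \<omega>)) * (g \<bullet> u)" using mu om(2) om1 gu by (simp_all add: mult_neg_pos)
          moreover have "0 \<le> (- (m1 \<bullet> \<omega>)) * (m2 \<bullet> u)" unfolding m2u using om1 h p_coords by (intro mult_nonneg_nonneg) auto
          ultimately have q: "m1 \<bullet> q = 0" "0 < g \<bullet> q" "0 \<le> m2 \<bullet> q" unfolding iq omn by simp_all
          show False
          proof (cases "m2 \<bullet> q = 0")
            case True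
            then have "q = (g \<bullet> q) *\<^sub>R P" using repr[of q] q by simp
            then have "q \<in> arc_icone n2" using icone_scale[OF P2 q(2)] by simp
            then show False using icone_disjoint[OF y(1) D(3) qy] yn by blast
          next
            case False
            then have "q \<in> arc_icone n1" using in_n1 q by simp
            then show False using icone_disjoint[OF y(1) D(2) qy] yn by blast
          qed
        next
          assume w2: "w \<in> arc_icone n2" "0 < m2 \<bullet> v'"
          define \<sigma> where "\<sigma> = \<nu>' s3"
          have sn: "is_normal s3 \<sigma>" unfolding \<sigma>_def using tile_normal[OF t' s3S(1)] .
          have sT: "0 \<le> \<sigma> \<bullet> x" if "x \<in> region \<nu>' S" for x unfolding \<sigma>_def using tile_nn[OF t' s3S(1) that] .
          have "0 = k * (\<sigma> \<bullet> \<omega>) + h * (\<sigma> \<bullet> p)" using is_normal_icone[OF sn u(5)] unfolding u(2) by (simp add: inner_add_right)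
          moreover have "h * (\<sigma> \<bullet> p) \<le> 0" using sT[OF tile_p[OF t']] h by (simp add: mult_le_0_iff)
          ultimately have "0 \<le> k * (\<sigma> \<bullet> \<omega>)" by linarith
          then have so: "0 \<le> \<sigma> \<bullet> \<omega>" using u by (simp add: zero_le_mult_iff)
          obtain a b where ab: "0 < a" "0 < b" "w = a *\<^sub>R e0 + b *\<^sub>R \<omega>" using w2(1) unfolding ends_icone[OF ends_sym[OF om(1)]] by auto
          obtain a' b' where ab': "0 < a'" "0 < b'" "x2 = a' *\<^sub>R e0 + b' *\<^sub>R \<omega>" using x2i unfolding ends_icone[OF ends_sym[OF om(1)]] by auto
          \<comment> \<open>On n2 the point w lies between x2 and \<omega>; as \<sigma> vanishes at
            w and is nonnegative at \<omega>, it is nonpositive at x2.\<close>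
          have w': "a' *\<^sub>R w = a *\<^sub>R x2 + (a' * b - a * b') *\<^sub>R \<omega>" unfolding ab(3) ab'(3) by (simp add: algebra_simps)
          have "a' * (g \<bullet> w) = (a' * b - a * b') * (g \<bullet> \<omega>)" using arg_cong[OF w', of "\<lambda>z. g \<bullet> z"] x2 by (simp add: inner_add_right)
          then have mpos: "0 < a' * b - a * b'" using ab' w(2) om(2) by (metis mult_pos_pos zero_less_mult_pos2)
          have sw0: "\<sigma> \<bullet> w = 0" using is_normal_ends[OF sn w(1)] .
          then have sx: "a * (\<sigma> \<bullet> x2) + (a' * b - a * b') * (\<sigma> \<bullet> \<omega>) = 0"
            using arg_cong[OF w', of "\<lambda>z. \<sigma> \<bullet> z"] by (simp add: inner_add_right)
          have "0 \<le> (a' * b - a * b') * (\<sigma> \<bullet> \<omega>)" using mpos so by simp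
          then have "a * (\<sigma> \<bullet> x2) \<le> 0" using sx by linarith
          then have sx2: "\<sigma> \<bullet> x2 \<le> 0" using ab by (simp add: mult_le_0_iff)
          have sx2n: "\<sigma> \<bullet> x2 \<noteq> 0"
          proof
            assume z: "\<sigma> \<bullet> x2 = 0"
            then have o0: "\<sigma> \<bullet> \<omega> = 0" using sx mpos by simp
            then have "\<sigma> \<bullet> e0 = 0" using z ab' by (simp add: inner_add_right)
            then have "is_normal n2 \<sigma>" using o0 om(1) is_normal_nz[OF sn] unfolding is_normal_def ends_def by auto
            then show False using hit_not_normal[OF D(3) s3D w(1) w2(1) sn] by blast
          qed
          \<comment> \<open>The opposite tile touches c strictly between its ends, so \<sigma>,
            being negative at x2, has to be positive at x1.\<close>
          obtain tc where tc: "tc \<in> arc_icone c" "tc \<in> region \<nu>' S" using contact[OF cS] by blast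
          obtain i j where ij: "0 < i" "0 < j" "tc = i *\<^sub>R E1 + j *\<^sub>R E2" using tc(1) unfolding ends_icone[OF E(5)] by auto
          have tcx: "tc = (i/k1) *\<^sub>R x1 + (j/k2) *\<^sub>R x2" unfolding ij(3) E(2) E(4) using E by simp
          have "0 \<le> (i/k1) * (\<sigma> \<bullet> x1) + (j/k2) * (\<sigma> \<bullet> x2)" using sT[OF tc(2)] unfolding tcx by (simp add: inner_add_right)
          moreover have "(j/k2) * (\<sigma> \<bullet> x2) < 0"
          proof (rule mult_pos_neg)
            show "0 < j/k2" using ij(2) E(3) by simp
            show "\<sigma> \<bullet> x2 < 0" using sx2 sx2n by simp
          qed
          ultimately have "0 < (i/k1) * (\<sigma> \<bullet> x1)" by linarith
          then have sx1: "0 < \<sigma> \<bullet> x1" using ij(1) E(1) by (simp add: zero_less_mult_iff zero_less_divide_iff)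
          \<comment> \<open>The crossing of s3 with the plane of c. The signs of \<sigma> at x1 and
            x2 place it strictly between these corners, so s3 would cross c.\<close>
          define \<kappa> where "\<kappa> = (g \<bullet> w) *\<^sub>R t3 + (- (g \<bullet> t3)) *\<^sub>R w"
          have k3: "\<kappa> \<in> arc_icone s3" unfolding \<kappa>_def by (rule icone_comb'[OF t3(1) ends_in_cone[OF w(1)] w(2)]) (use t3 in simp)
          have w20: "m2 \<bullet> w = 0" using is_normal_icone[OF normals(3) w2(1)] .
          have m2t: "0 < m2 \<bullet> t3" using icone_pos[OF w(1) w20 w2(2) t3(1)] .
          have kg: "g \<bullet> \<kappa> = 0" unfolding \<kappa>_def by (simp add: inner_diff_right)
          have km2: "0 < m2 \<bullet> \<kappa>" unfolding \<kappa>_def using w20 m2t w(2) by (simp add: inner_diff_right)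
          have "0 = (m2 \<bullet> \<kappa>) * (\<sigma> \<bullet> x1) + (m1 \<bullet> \<kappa>) * (\<sigma> \<bullet> x2)"
            using inner_repr[of \<sigma> \<kappa>] kg is_normal_icone[OF sn k3] by simp
          moreover have "0 < (m2 \<bullet> \<kappa>) * (\<sigma> \<bullet> x1)" using km2 sx1 by simp
          ultimately have "(m1 \<bullet> \<kappa>) * (\<sigma> \<bullet> x2) < 0" by linarith
          then have "0 < m1 \<bullet> \<kappa>" using sx2 by (simp add: mult_less_0_iff)
          then have "\<kappa> \<in> arc_icone c" using in_c kg km2 by blast
          then show False using icone_disjoint[OF D(1) s3D _ k3] s3S by blast
        qed
      qed
    qed
  qed
qed

lemma contradiction: False
proof -
  interpret sw: shared_side_below D p \<nu> \<nu>' S c n2 n1 x2 P x1 g m2 m1 by (rule swap_below)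
  show False using P_hit contradiction_aux sw.contradiction_aux by blast
qed

end

section \<open>The common side is hit only from the side of the triangle\<close>

locale shared_side_above = shared_side +
  assumes above: "b \<in> D \<Longrightarrow> ends b e o' \<Longrightarrow> e \<in> arc_icone c \<Longrightarrow> 0 < g \<bullet> o'"
begin

lemma swap_above: "shared_side_above D p \<nu> \<nu>' S c n2 n1 x2 P x1 g m2 m1"
  unfolding shared_side_above_def shared_side_above_axioms_def using swap above by auto

text \<open>A neighbour of c in the opposite tile that did not block E would hit c, hence from
  above, and could not touch the opposite tile in its interior.\<close>

lemma end_blocked:
  assumes "ends c E W"
  obtains s where "s \<in> S" "s \<noteq> c" "E \<in> arc_icone s" "E \<in> region \<nu>' S"
proof -
  obtain s r where s: "s \<in> S" "s \<noteq> c" "r \<in> region \<nu>' S" "r \<noteq> 0" "r \<in> arc_cone s" "r = E \<and> E \<in> arc_icone s \<or> r \<in> arc_icone c"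
    by (rule tile_neighbour[OF t' cS assms])
  have "r \<notin> arc_icone c"
  proof
    assume "r \<in> arc_icone c"
    then obtain k e o' where e: "ends s e o'" "0 < k" "r = k *\<^sub>R e" "e \<in> arc_icone c"
      using touch_hit[OF D(1) SD[OF s(1)] s(2)[symmetric] _ s(5)] by blast
    obtain w where w: "w \<in> arc_icone s" "g \<bullet> w \<le> 0" using contact[OF s(1)] by blast
    have "0 < g \<bullet> w" using icone_pos[OF e(1) is_normal_icone[OF normals(1) e(4)] above[OF SD[OF s(1)] e(1,4)] w(1)] .
    then show False using w by simp
  qed
  then show thesis using that s by blast
qed

text \<open>Were the corner an end of c, its blocker would be a side of the opposite tile by
  \<open>end_blocked\<close> and also a side of the triangle, different from c.\<close>

lemma x1_inner: "x1 \<in> arc_icone c"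
proof (rule ccontr)
  assume n: "x1 \<notin> arc_icone c"
  have "x1 \<noteq> 0" using x1(3) by auto
  then obtain k E W where E: "ends c E W" "0 < k" "x1 = k *\<^sub>R E" using cone_cases[OF x1(4)] n by metis
  obtain s where s: "s \<in> S" "s \<noteq> c" "E \<in> arc_icone s" using end_blocked[OF E(1)] by blast
  have "(1/k) *\<^sub>R x1 = E" using E by simp
  then have "E \<in> region \<nu> {c, n1, n2}" using region_scale[OF x1(6), of "1/k"] E(2) by simp
  then have "s \<in> {c, n1, n2}" using tile_I[OF t SD[OF s(1)] _ s(3)] by blast
  then show False using s nS by auto
qed

text \<open>Here c sticks out of the triangle at both ends, where the sides s1 and s2 of the
  opposite tile block it. The upper end w of s2 starts a chain of blockers confined to the region
  above c and outside n2, which cannot be closed.\<close>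

lemma contradiction_aux:
  assumes P2: "P \<in> arc_icone n2"
  shows False
proof -
  interpret sw: shared_side_above D p \<nu> \<nu>' S c n2 n1 x2 P x1 g m2 m1 by (rule swap_above)
  note x2_inner = sw.x1_inner
  obtain e1 where e1: "\<exists>o'. ends n1 e1 o'" "\<exists>k>0. x1 = k *\<^sub>R e1"
    using touch_hit[OF D(1,2) dist(1) x1_inner x1(5)] by metis
  obtain eP oP where eP: "ends n1 eP oP" "\<exists>k>0. P = k *\<^sub>R eP" "eP \<in> arc_icone n2"
    using touch_hit[OF D(3,2) dist(2)[symmetric] P2 P(4)] by metis
  have "oP = e1"
  proof (rule ccontr)
    assume "oP \<noteq> e1"
    then have "e1 = eP" using e1(1) eP(1) unfolding ends_def by auto
    then show False using e1(2) eP(2) x1 P by auto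
  qed
  then have n1e: "ends n1 eP e1" using eP by simp
  obtain k1 where k1: "0 < k1" "x1 = k1 *\<^sub>R e1" using e1(2) by blast
  obtain kP where kP: "0 < kP" "P = kP *\<^sub>R eP" using eP(2) by blast
  have m2e1: "0 < m2 \<bullet> e1" using x1(3) k1 by (metis inner_scaleR_right zero_less_mult_pos zero_less_one)
  have n1_nn: "0 \<le> m2 \<bullet> q" if "q \<in> arc_cone n1" for q
    using cone_nonneg[OF n1e _ _ that, of m2] m2e1 P(2) kP by auto
  have n2_side: "0 < m2 \<bullet> o'" if "b \<in> D" "ends b e o'" "e \<in> arc_icone n2" for b e o'
    using one_sided[OF D(3,2) that(1) n1e eP(3) that(2,3) normals(3) m2e1] .
  \<comment> \<open>E is the end of c beyond x1 and W the one beyond x2, as the signs of m1 and m2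
    below confirm.\<close>
  obtain E W where EW: "ends c E W" "m1 \<bullet> E < 0" "0 < m1 \<bullet> W"
    using ends_separated[OF x1_inner x1(2) x2(5)] x2(3) ends_sym by (metis zero_neq_one)
  have gEW: "g \<bullet> E = 0" "g \<bullet> W = 0" using is_normal_ends[OF normals(1)] EW(1) ends_sym by blast+
  obtain E' W' where EW': "ends c E' W'" "m2 \<bullet> W' < 0" "0 < m2 \<bullet> E'"
    using ends_separated[OF x2_inner x2(1) x1(4)] x1(3) by (metis zero_neq_one)
  have Erep: "E = (m2 \<bullet> E) *\<^sub>R x1 + (m1 \<bullet> E) *\<^sub>R x2" using repr[of E] gEW by simp
  have "\<not> m2 \<bullet> E \<le> 0"
  proof
    assume "m2 \<bullet> E \<le> 0"
    then have "(- (m2 \<bullet> E)) *\<^sub>R x1 + (- (m1 \<bullet> E)) *\<^sub>R x2 \<in> arc_cone c" by (intro cone_comb x1 x2) (use EW in auto)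
    moreover have "(- (m2 \<bullet> E)) *\<^sub>R x1 + (- (m1 \<bullet> E)) *\<^sub>R x2 = - E" by (subst (3) Erep) simp
    ultimately have "- E \<in> arc_cone c" by simp
    then show False using cone_pointed[OF valid[OF D(1)] ends_in_cone[OF EW(1)]] ends_nonzero[OF valid[OF D(1)] EW(1)] by simp
  qed
  then have m2E: "0 < m2 \<bullet> E" by simp
  have m2W: "m2 \<bullet> W < 0"
  proof -
    have "E' = E" "W' = W" using EW' EW m2E unfolding ends_def by auto
    then show ?thesis using EW' by simp
  qed
  obtain s1 where s1: "s1 \<in> S" "s1 \<noteq> c" "E \<in> arc_icone s1" "E \<in> region \<nu>' S" using end_blocked[OF EW(1)] .
  obtain s2 where s2: "s2 \<in> S" "s2 \<noteq> c" "W \<in> arc_icone s2" "W \<in> region \<nu>' S" using end_blocked[OF ends_sym[OF EW(1)]] .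
  have s12: "s1 \<noteq> s2"
  proof
    assume "s1 = s2"
    then have "cross3 E W = 0"
      using touch_parallel[OF D(1) SD[OF s1(1)] s1(2)[symmetric] ends_in_cone[OF EW(1)] icone_sub_cone[OF s1(3)] ends_in_cone[OF ends_sym[OF EW(1)]]]
        icone_sub_cone[OF s2(3)] by simp
    then show False using valid_ends_cross[OF valid[OF D(1)] EW(1)] by simp
  qed
  have "card (S - {c, s1, s2}) = card S - card {c, s1, s2}" by (rule card_Diff_subset) (use s1 s2 cS in auto)
  also have "card {c, s1, s2} = 3" using s1 s2 s12 by auto
  finally have "card (S - {c, s1, s2}) = 1" using cardS by simp
  then obtain s3 where s3: "S - {c, s1, s2} = {s3}" using card_1_singletonE by blast
  have s3S: "s3 \<in> S" "s3 \<noteq> c" "s3 \<noteq> s1" "s3 \<noteq> s2" using s3 by blast+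
  have classes: "a = c \<or> a = n1 \<or> a = n2 \<or> a = s1 \<or> a = s2 \<or> a = s3 \<or> avoids p a" if "a \<in> D" for a
    using rest[OF that] s3 by blast
  have sD: "s1 \<in> D" "s2 \<in> D" "s3 \<in> D" using SD s1 s2 s3S by auto
  have sn: "s1 \<noteq> n1" "s1 \<noteq> n2" "s2 \<noteq> n1" "s2 \<noteq> n2" "s3 \<noteq> n1" "s3 \<noteq> n2" using nS s1 s2 s3S by auto
  define \<sigma> where "\<sigma> = \<nu>' s1"
  define \<tau> where "\<tau> = \<nu>' s2"
  have sg: "is_normal s1 \<sigma>" and ta: "is_normal s2 \<tau>" unfolding \<sigma>_def \<tau>_def using tile_normal[OF t'] s1 s2 by auto
  have sT: "0 \<le> \<sigma> \<bullet> x" "0 \<le> \<tau> \<bullet> x" if "x \<in> region \<nu>' S" for x unfolding \<sigma>_def \<tau>_def using tile_nn[OF t' _ that] s1 s2 by auto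
  have sE: "\<sigma> \<bullet> E = 0" "\<tau> \<bullet> W = 0" using is_normal_icone sg ta s1 s2 by blast+
  have sW: "0 < \<sigma> \<bullet> W" using sT(1)[OF s2(4)] hit_transversal[OF sD(1) D(1) EW(1) s1(3) sg] by simp
  have tE: "0 < \<tau> \<bullet> E" using sT(2)[OF s1(4)] hit_transversal[OF sD(2) D(1) ends_sym[OF EW(1)] s2(3) ta] by simp
  have sx: "0 < \<sigma> \<bullet> x1" "0 < \<sigma> \<bullet> x2" using icone_pos[OF EW(1) sE(1) sW] x1_inner x2_inner by auto
  have tx: "0 < \<tau> \<bullet> x1" "0 < \<tau> \<bullet> x2" using icone_pos[OF ends_sym[OF EW(1)] sE(2) tE] x1_inner x2_inner by auto
  \<comment> \<open>Since p is a combination of the corners with nonnegative coefficients, positive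
    at P, a functional positive at x1 and x2 but nonpositive at p must be nonpositive at P.\<close>
  have phiP: "\<phi> \<bullet> P \<le> 0" if "0 < \<phi> \<bullet> x1" "0 < \<phi> \<bullet> x2" "\<phi> \<bullet> p \<le> 0" for \<phi>
  proof -
    have "0 \<le> (m2 \<bullet> p) * (\<phi> \<bullet> x1)" "0 \<le> (m1 \<bullet> p) * (\<phi> \<bullet> x2)" using p_coords that by auto
    then have "(g \<bullet> p) * (\<phi> \<bullet> P) \<le> 0" using inner_repr[of \<phi> p] that by linarith
    then show ?thesis using p_coords by (simp add: mult_le_0_iff)
  qed
  have sP: "\<sigma> \<bullet> P \<le> 0" using phiP[OF sx] sT(1)[OF tile_p[OF t']] by simp
  have tP: "\<tau> \<bullet> P \<le> 0" using phiP[OF tx] sT(2)[OF tile_p[OF t']] by simp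
  have on_n1: "q \<in> arc_icone n1 \<or> q \<in> arc_icone n2"
    if "m1 \<bullet> q = 0" "0 < g \<bullet> q" "0 \<le> \<phi> \<bullet> q" "0 < \<phi> \<bullet> x1" "\<phi> \<bullet> P \<le> 0" for q \<phi>
  proof -
    have "(g \<bullet> q) * (\<phi> \<bullet> P) \<le> 0" using that by (simp add: mult_le_0_iff)
    then have "0 \<le> (m2 \<bullet> q) * (\<phi> \<bullet> x1)" using inner_repr[of \<phi> q] that by simp
    then have m: "0 \<le> m2 \<bullet> q" using that by (simp add: zero_le_mult_iff)
    show ?thesis
    proof (cases "m2 \<bullet> q = 0")
      case True
      then have "q = (g \<bullet> q) *\<^sub>R P" using repr[of q] that by simp
      then show ?thesis using icone_scale[OF P2 that(2)] by simp
    next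
      case False then show ?thesis using in_n1 that m by simp
    qed
  qed
  have on_n2: "q \<in> arc_icone n2" if "m2 \<bullet> q = 0" "0 < g \<bullet> q" "0 \<le> m1 \<bullet> q" for q
    using icone_comb'[OF P2 x2(4) that(2,3)] repr[of q] that by simp
  \<comment> \<open>Otherwise s1, starting at E, would cross the plane of n1 between x1 and P, that
    is, on n1 or at P on n2.\<close>
  have s1_nonpos: "m1 \<bullet> b \<le> 0" if b: "b \<in> arc_cone s1" "0 < g \<bullet> b" for b
  proof (rule ccontr)
    assume "\<not> m1 \<bullet> b \<le> 0"
    then have mb: "0 < m1 \<bullet> b" by simp
    define z where "z = (m1 \<bullet> b) *\<^sub>R E + (- (m1 \<bullet> E)) *\<^sub>R b"
    have zs: "z \<in> arc_icone s1" unfolding z_def by (rule icone_comb'[OF s1(3) b(1) mb]) (use EW in simp)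
    have iz: "\<phi> \<bullet> z = (m1 \<bullet> b) * (\<phi> \<bullet> E) + (- (m1 \<bullet> E)) * (\<phi> \<bullet> b)" for \<phi>
      unfolding z_def by (simp only: inner_add_right inner_scaleR_right)
    have "0 < (- (m1 \<bullet> E)) * (g \<bullet> b)" using EW b by (intro mult_pos_pos) auto
    then have "m1 \<bullet> z = 0" "0 < g \<bullet> z" unfolding iz by (simp_all add: gEW)
    then have "z \<in> arc_icone n1 \<or> z \<in> arc_icone n2" using on_n1[of z \<sigma>] is_normal_icone[OF sg zs] sx sP by simp
    then show False using icone_disjoint[OF sD(1) _ zs] D sn by blast
  qed
  have "\<not> is_normal s2 g" using hit_not_normal[OF sD(2) D(1) ends_sym[OF EW(1)] s2(3) normals(1)] .
  then obtain f2 where "f2 \<in> arc_cone s2" "g \<bullet> f2 \<noteq> 0"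
    using is_normal_nz[OF normals(1)] ends_in_cone[OF ends_fst] ends_in_cone[OF ends_snd] unfolding is_normal_def by metis
  then obtain w o2 where w: "ends s2 w o2" "0 < g \<bullet> w" "g \<bullet> o2 < 0" using ends_separated[OF s2(3) gEW(2)] by metis
  obtain i j where ij: "0 < i" "0 < j" "W = i *\<^sub>R w + j *\<^sub>R o2" using s2(3) unfolding ends_icone[OF w(1)] by auto
  have tw: "\<tau> \<bullet> w = 0" using is_normal_ends[OF ta w(1)] .
  \<comment> \<open>In passing from W to a point with m2 nonnegative, s2 would cross n2 or end on
    it; an arc ending on n2 comes from the inner side, while W lies on the outer one.\<close>
  have m2w: "m2 \<bullet> w < 0"
  proof (rule ccontr)
    assume "\<not> m2 \<bullet> w < 0"
    then have mw: "0 \<le> m2 \<bullet> w" by simp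
    define z where "z = (m2 \<bullet> w) *\<^sub>R W + (- (m2 \<bullet> W)) *\<^sub>R w"
    have iz: "\<phi> \<bullet> z = (m2 \<bullet> w) * (\<phi> \<bullet> W) + (- (m2 \<bullet> W)) * (\<phi> \<bullet> w)" for \<phi>
      unfolding z_def by (simp only: inner_add_right inner_scaleR_right)
    have "0 < (- (m2 \<bullet> W)) * (g \<bullet> w)" using m2W w by (intro mult_pos_pos) auto
    then have z: "m2 \<bullet> z = 0" "0 < g \<bullet> z" unfolding iz by (simp_all add: gEW)
    have "\<tau> \<bullet> z = 0" unfolding iz sE tw by simp
    then have "(g \<bullet> z) * (\<tau> \<bullet> P) + (m1 \<bullet> z) * (\<tau> \<bullet> x2) = 0" using inner_repr[of \<tau> z] z by simp
    moreover have "(g \<bullet> z) * (\<tau> \<bullet> P) \<le> 0" using z tP by (simp add: mult_le_0_iff)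
    ultimately have "0 \<le> (m1 \<bullet> z) * (\<tau> \<bullet> x2)" by linarith
    then have "0 \<le> m1 \<bullet> z" using tx by (simp add: zero_le_mult_iff)
    then have zn: "z \<in> arc_icone n2" using on_n2 z by blast
    show False
    proof (cases "m2 \<bullet> w = 0")
      case True
      then have "w = (1/(- (m2 \<bullet> W))) *\<^sub>R z" unfolding z_def using m2W by simp
      then have "w \<in> arc_icone n2" using icone_scale[OF zn, of "1/(- (m2 \<bullet> W))"] m2W by simp
      then have "0 < m2 \<bullet> o2" using n2_side[OF sD(2) w(1)] by simp
      then have "0 < m2 \<bullet> W" unfolding ij(3) using True ij by (simp add: inner_add_right)
      then show False using m2W by simp
    next
      case False
      then have "0 < m2 \<bullet> w" using mw by simp
      then have "z \<in> arc_icone s2" unfolding z_def by (rule icone_comb'[OF s2(3) ends_in_cone[OF w(1)]]) (use m2W in simp)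
      then show False using icone_disjoint[OF sD(2) D(3) _ zn] sn by blast
    qed
  qed
  have m1w: "0 < m1 \<bullet> w"
  proof -
    have "0 = (m2 \<bullet> w) * (\<tau> \<bullet> x1) + (g \<bullet> w) * (\<tau> \<bullet> P) + (m1 \<bullet> w) * (\<tau> \<bullet> x2)" using inner_repr[of \<tau> w] tw by simp
    moreover have "(m2 \<bullet> w) * (\<tau> \<bullet> x1) < 0" "(g \<bullet> w) * (\<tau> \<bullet> P) \<le> 0" using m2w tx w tP by (simp_all add: mult_neg_pos mult_le_0_iff)
    ultimately have "0 < (m1 \<bullet> w) * (\<tau> \<bullet> x2)" by linarith
    then show ?thesis using tx by (simp add: zero_less_mult_iff)
  qed
  obtain t3 where t3: "t3 \<in> arc_icone s3" "t3 \<in> region \<nu>' S" "g \<bullet> t3 \<le> 0" using contact[OF s3S(1)] .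
  text \<open>Followed from b towards the opposite tile, s3 would have to cross c, n1 or n2.\<close>
  have towards: False
    if b: "b \<in> arc_icone s3" "0 < g \<bullet> b" "0 < m1 \<bullet> b" "\<phi> \<bullet> b = 0"
      and ph: "0 \<le> \<phi> \<bullet> t3" "\<phi> \<bullet> W \<le> 0" "0 < \<phi> \<bullet> x1" "\<phi> \<bullet> P \<le> 0" for b \<phi>
  proof -
    define \<kappa> where "\<kappa> = (g \<bullet> b) *\<^sub>R t3 + (- (g \<bullet> t3)) *\<^sub>R b"
    have ik: "\<psi> \<bullet> \<kappa> = (g \<bullet> b) * (\<psi> \<bullet> t3) + (- (g \<bullet> t3)) * (\<psi> \<bullet> b)" for \<psi>
      unfolding \<kappa>_def by (simp only: inner_add_right inner_scaleR_right)
    have k3: "\<kappa> \<in> arc_icone s3" unfolding \<kappa>_def by (rule icone_comb'[OF t3(1) icone_sub_cone[OF b(1)] b(2)]) (use t3 in simp)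
    have k0: "\<kappa> \<noteq> 0" using icone_nonzero[OF valid[OF sD(3)] k3] .
    have kg: "g \<bullet> \<kappa> = 0" and kphi: "0 \<le> \<phi> \<bullet> \<kappa>" unfolding ik using b ph by simp_all
    have m1k: "m1 \<bullet> \<kappa> < 0"
    proof (rule ccontr)
      assume "\<not> m1 \<bullet> \<kappa> < 0"
      then have mk: "0 \<le> m1 \<bullet> \<kappa>" by simp
      define a where "a = (m1 \<bullet> \<kappa>) / (m1 \<bullet> W)"
      have a: "0 \<le> a" "a * (m1 \<bullet> W) = m1 \<bullet> \<kappa>" unfolding a_def using mk EW by auto
      define d where "d = m2 \<bullet> (\<kappa> - a *\<^sub>R W)"
      have "m1 \<bullet> (\<kappa> - a *\<^sub>R W) = 0" "g \<bullet> (\<kappa> - a *\<^sub>R W) = 0" using a kg gEW by (simp_all add: inner_diff_right)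
      then have "\<kappa> - a *\<^sub>R W = d *\<^sub>R x1" using repr[of "\<kappa> - a *\<^sub>R W"] unfolding d_def by simp
      then have kd: "\<kappa> = a *\<^sub>R W + d *\<^sub>R x1" by (simp add: algebra_simps)
      have "0 \<le> a * (\<phi> \<bullet> W) + d * (\<phi> \<bullet> x1)" using kphi unfolding kd by (simp add: inner_add_right)
      moreover have "a * (\<phi> \<bullet> W) \<le> 0" using a ph by (simp add: mult_le_0_iff)
      ultimately have "0 \<le> d * (\<phi> \<bullet> x1)" by linarith
      then have "0 \<le> d" using ph by (simp add: zero_le_mult_iff)
      then have kc: "\<kappa> \<in> arc_cone c" unfolding kd using cone_comb[OF ends_in_cone[OF ends_sym[OF EW(1)]] x1(4) a(1)] by blast
      from cone_cases[OF kc k0] show False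
      proof cases
        case 1 then show False using icone_disjoint[OF D(1) sD(3) _ k3] s3S by blast
      next
        case (2 k e o')
        have "(1/k) *\<^sub>R \<kappa> = e" using 2 by simp
        then have e3: "e \<in> arc_icone s3" using icone_scale[OF k3, of "1/k"] 2(2) by simp
        have "e = E \<or> e = W" using 2(1) EW(1) unfolding ends_def by auto
        then show False using icone_disjoint[OF sD(3) _ e3] sD s1(3) s2(3) s3S by blast
      qed
    qed
    define q where "q = (m1 \<bullet> b) *\<^sub>R \<kappa> + (- (m1 \<bullet> \<kappa>)) *\<^sub>R b"
    have iq: "\<psi> \<bullet> q = (m1 \<bullet> b) * (\<psi> \<bullet> \<kappa>) + (- (m1 \<bullet> \<kappa>)) * (\<psi> \<bullet> b)" for \<psi>
      unfolding q_def by (simp only: inner_add_right inner_scaleR_right)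
    have qs: "q \<in> arc_icone s3" unfolding q_def by (rule icone_comb'[OF k3 icone_sub_cone[OF b(1)] b(3)]) (use m1k in simp)
    have "0 < (- (m1 \<bullet> \<kappa>)) * (g \<bullet> b)" using m1k b by (intro mult_pos_pos) auto
    then have "m1 \<bullet> q = 0" "0 < g \<bullet> q" unfolding iq kg by simp_all
    moreover have "0 \<le> \<phi> \<bullet> q" unfolding iq b(4) using b(3) kphi by simp
    ultimately have "q \<in> arc_icone n1 \<or> q \<in> arc_icone n2" using on_n1[of q \<phi>] ph by blast
    then show False using icone_disjoint[OF sD(3) _ qs] D sn by blast
  qed
  \<comment> \<open>Moving towards p preserves positivity of g and m1, so the upper end of such an
    arc cannot be blocked by c, n1 or s1; n2 is excluded by one-sidedness and the position of
    p.\<close>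
  have top: thesis if A: "A \<in> D" "avoids p A" "b \<in> arc_cone A" "0 < g \<bullet> b" "0 < m1 \<bullet> b"
    and th: "\<And>u v k h. ends A u v \<Longrightarrow> u = k *\<^sub>R b + h *\<^sub>R p \<Longrightarrow> 0 < k \<Longrightarrow> 0 \<le> h \<Longrightarrow> 0 < g \<bullet> u \<Longrightarrow> 0 < m1 \<bullet> u \<Longrightarrow> u \<in> arc_icone s2 \<or> u \<in> arc_icone s3 \<Longrightarrow> thesis" for A b thesis
  proof -
    have "b \<noteq> 0" using A by auto
    from avoids_top[OF valid[OF A(1)] A(2,3) this] obtain u v k h \<alpha> \<beta> where
      u: "ends A u v" "u = k *\<^sub>R b + h *\<^sub>R p" "0 < k" "0 \<le> h" "p = \<alpha> *\<^sub>R u - \<beta> *\<^sub>R v" "0 < \<alpha>" "0 < \<beta>" .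
    have gu: "0 < g \<bullet> u" unfolding u(2) using u(3,4) A(4) p_coords by (simp add: inner_add_right add_pos_nonneg)
    have mu: "0 < m1 \<bullet> u" unfolding u(2) using u(3,4) A(5) p_coords by (simp add: inner_add_right add_pos_nonneg)
    obtain y where y: "y \<in> D" "u \<in> arc_icone y" using blocked[OF A(1) u(1)] .
    have "y \<noteq> c" using is_normal_icone[OF normals(1), of u] y(2) gu by auto
    moreover have "y \<noteq> n1" using is_normal_icone[OF normals(2), of u] y(2) mu by auto
    moreover have "y \<noteq> n2"
    proof
      assume yn: "y = n2"
      then have "m2 \<bullet> u = 0" using is_normal_icone[OF normals(3), of u] y by simp
      then have "m2 \<bullet> p = - (\<beta> * (m2 \<bullet> v))" unfolding u(5) by (simp add: inner_diff_right)
      moreover have "0 < \<beta> * (m2 \<bullet> v)" using u(7) n2_side[OF A(1) u(1)] y yn by simp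
      ultimately show False using p_coords by linarith
    qed
    moreover have "y \<noteq> s1" using s1_nonpos[OF icone_sub_cone gu] y(2) mu by (auto simp: not_less)
    moreover have "\<not> avoids p y" using avoids_no_hit[OF y(1) A(1) u(1) y(2) _ A(2)] by blast
    ultimately have "y = s2 \<or> y = s3" using classes[OF y(1)] by blast
    then show thesis using th[OF u(1-4) gu mu] y by blast
  qed
  obtain y where y: "y \<in> D" "w \<in> arc_icone y" using blocked[OF sD(2) w(1)] .
  have "y \<noteq> c" using is_normal_icone[OF normals(1), of w] y(2) w by auto
  moreover have "y \<noteq> n1" using is_normal_icone[OF normals(2), of w] y(2) m1w by auto
  moreover have "y \<noteq> n2" using is_normal_icone[OF normals(3), of w] y(2) m2w by auto
  moreover have "y \<noteq> s1" using s1_nonpos[OF icone_sub_cone w(2)] y(2) m1w by (auto simp: not_less)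
  moreover have "y \<noteq> s2" using not_self_hit[OF sD(2) w(1) y(2)] .
  ultimately consider "y = s3" | "avoids p y" using classes[OF y(1)] by blast
  then show False
  proof cases
    case 1
    then have "w \<in> arc_icone s3" using y by simp
    then show False using towards[OF _ w(2) m1w tw sT(2)[OF t3(2)] _ tx(1) tP] sE by simp
  next
    case A: 2
    obtain u v k h where u: "ends y u v" "u = k *\<^sub>R w + h *\<^sub>R p" "0 < k" "0 \<le> h" "0 < g \<bullet> u" "0 < m1 \<bullet> u" "u \<in> arc_icone s2 \<or> u \<in> arc_icone s3"
      by (rule top[OF y(1) A icone_sub_cone[OF y(2)] w(2) m1w])
    have "u \<notin> arc_icone s2" using no_mutual_hit[OF y(1) sD(2) u(1) w(1) _ y(2)] by blast
    then have u3: "u \<in> arc_icone s3" using u by blast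
    have yn: "y \<noteq> n1" "y \<noteq> n2" using A not_avoids(1) by blast+
    have m2u: "m2 \<bullet> u < 0"
    proof (rule ccontr)
      assume "\<not> m2 \<bullet> u < 0"
      then have mu: "0 \<le> m2 \<bullet> u" by simp
      define q where "q = (m2 \<bullet> u) *\<^sub>R w + (- (m2 \<bullet> w)) *\<^sub>R u"
      have iq: "\<psi> \<bullet> q = (m2 \<bullet> u) * (\<psi> \<bullet> w) + (- (m2 \<bullet> w)) * (\<psi> \<bullet> u)" for \<psi>
        unfolding q_def by (simp only: inner_add_right inner_scaleR_right)
      have "0 < (- (m2 \<bullet> w)) * (g \<bullet> u)" "0 < (- (m2 \<bullet> w)) * (m1 \<bullet> u)" using m2w u(5,6) by (simp_all add: mult_neg_pos)
      moreover have "0 \<le> (m2 \<bullet> u) * (g \<bullet> w)" "0 \<le> (m2 \<bullet> u) * (m1 \<bullet> w)" using mu w m1w by auto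
      ultimately have "m2 \<bullet> q = 0" "0 < g \<bullet> q" "0 \<le> m1 \<bullet> q" unfolding iq by simp_all
      then have qn: "q \<in> arc_icone n2" using on_n2 by blast
      show False
      proof (cases "m2 \<bullet> u = 0")
        case True
        then have "(1/(- (m2 \<bullet> w))) *\<^sub>R q = u" unfolding q_def using m2w by simp
        then have "u \<in> arc_icone n2" using icone_scale[OF qn, of "1/(- (m2 \<bullet> w))"] m2w by simp
        then show False using icone_disjoint[OF sD(3) D(3) u3] sn by blast
      next
        case False
        then have "0 < m2 \<bullet> u" using mu by simp
        then have "q \<in> arc_icone y" unfolding q_def by (rule icone_comb'[OF y(2) ends_in_cone[OF u(1)]]) (use m2w in simp)
        then show False using icone_disjoint[OF y(1) D(3) _ qn] yn by blast
      qed
    qed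
    obtain \<alpha>0 where a0: "is_normal y \<alpha>0" using is_normal_arc_normal valid y(1) by blast
    have a0W: "\<alpha>0 \<bullet> W \<noteq> 0"
    proof -
      have "\<alpha>0 \<bullet> w = 0" using is_normal_icone[OF a0 y(2)] .
      moreover have "\<alpha>0 \<bullet> o2 \<noteq> 0" using hit_transversal[OF y(1) sD(2) w(1) y(2) a0] .
      ultimately show ?thesis unfolding ij(3) using ij by (simp add: inner_add_right)
    qed
    \<comment> \<open>The sign is fixed at W so that \<alpha> can play the role that \<tau> had in
      the case of s3.\<close>
    obtain \<alpha> where al: "is_normal y \<alpha>" "\<alpha> \<bullet> W < 0"
    proof (cases "\<alpha>0 \<bullet> W < 0")
      case True then show thesis using that a0 by blast
    next
      case False
      then have "(- \<alpha>0) \<bullet> W < 0" using a0W by simp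
      then show thesis using that is_normal_uminus[OF a0] by blast
    qed
    have aw: "\<alpha> \<bullet> w = 0" using is_normal_icone[OF al(1) y(2)] .
    have ap: "\<alpha> \<bullet> p = 0" using avoids_normal[OF A al(1)] .
    have au: "\<alpha> \<bullet> u = 0" using is_normal_ends[OF al(1) u(1)] .
    have ax: "0 < \<alpha> \<bullet> x1" "0 < \<alpha> \<bullet> x2" "\<alpha> \<bullet> P \<le> 0"
    proof -
      define X V Y where "X = \<alpha> \<bullet> x1" and "V = \<alpha> \<bullet> x2" and "Y = \<alpha> \<bullet> P"
      define r where "r = (m2 \<bullet> p) * (g \<bullet> w) + (g \<bullet> p) * - (m2 \<bullet> w)"
      define s where "s = (g \<bullet> p) * (m1 \<bullet> w) - (m1 \<bullet> p) * (g \<bullet> w)"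
      have ep: "(m2 \<bullet> p) * X + (g \<bullet> p) * Y + (m1 \<bullet> p) * V = 0" using inner_repr[of \<alpha> p] ap unfolding X_def V_def Y_def by simp
      have ew: "(m2 \<bullet> w) * X + (g \<bullet> w) * Y + (m1 \<bullet> w) * V = 0" using inner_repr[of \<alpha> w] aw unfolding X_def V_def Y_def by simp
      have eW: "(m2 \<bullet> W) * X + (m1 \<bullet> W) * V < 0" using inner_repr[of \<alpha> W] al(2) gEW unfolding X_def V_def by simp
      have fp: "(m2 \<bullet> p) * (\<tau> \<bullet> x1) + (g \<bullet> p) * (\<tau> \<bullet> P) + (m1 \<bullet> p) * (\<tau> \<bullet> x2) \<le> 0" using inner_repr[of \<tau> p] sT(2)[OF tile_p[OF t']] by simp
      have fw: "(m2 \<bullet> w) * (\<tau> \<bullet> x1) + (g \<bullet> w) * (\<tau> \<bullet> P) + (m1 \<bullet> w) * (\<tau> \<bullet> x2) = 0" using inner_repr[of \<tau> w] tw by simp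
      have fW: "(m2 \<bullet> W) * (\<tau> \<bullet> x1) + (m1 \<bullet> W) * (\<tau> \<bullet> x2) = 0" using inner_repr[of \<tau> W] sE gEW by simp
      have r: "0 < r" unfolding r_def using p_coords w(2) m2w by (intro add_nonneg_pos mult_nonneg_nonneg mult_pos_pos) auto
      \<comment> \<open>Eliminating the value at P from the two relations at p and w;
        \<open>rt\<close> is the same elimination for \<tau>, with an inequality because \<tau> is
        only nonpositive at p.\<close>
      have rX: "r * X = s * V"
      proof -
        have "(g \<bullet> w) * ((m2 \<bullet> p) * X + (g \<bullet> p) * Y + (m1 \<bullet> p) * V) - (g \<bullet> p) * ((m2 \<bullet> w) * X + (g \<bullet> w) * Y + (m1 \<bullet> w) * V) = 0"
          unfolding ep ew by simp
        then show ?thesis unfolding r_def s_def by (simp add: algebra_simps)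
      qed
      have rt: "r * (\<tau> \<bullet> x1) \<le> s * (\<tau> \<bullet> x2)"
      proof -
        have "(g \<bullet> w) * ((m2 \<bullet> p) * (\<tau> \<bullet> x1) + (g \<bullet> p) * (\<tau> \<bullet> P) + (m1 \<bullet> p) * (\<tau> \<bullet> x2)) - (g \<bullet> p) * ((m2 \<bullet> w) * (\<tau> \<bullet> x1) + (g \<bullet> w) * (\<tau> \<bullet> P) + (m1 \<bullet> w) * (\<tau> \<bullet> x2)) \<le> 0"
          unfolding fw using fp w(2) by (simp add: mult_le_0_iff)
        then show ?thesis unfolding r_def s_def by (simp add: algebra_simps)
      qed
      have "0 < r * (\<tau> \<bullet> x1)" using r tx by simp
      then have "0 < s * (\<tau> \<bullet> x2)" using rt by linarith
      then have s: "0 < s" using tx by (simp add: zero_less_mult_iff)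
      \<comment> \<open>Comparison of slopes at W: \<tau> vanishes there, which yields r B' \<le> A'
        s, whereas \<alpha> being negative there with V nonpositive would yield the strict
        converse.\<close>
      have V: "0 < V"
      proof (rule ccontr)
        assume "\<not> 0 < V"
        then have V: "V \<le> 0" by simp
        define A' B' where "A' = - (m2 \<bullet> W)" and "B' = m1 \<bullet> W"
        have AB: "0 < A'" "0 < B'" unfolding A'_def B'_def using m2W EW by auto
        have AX: "A' * (\<tau> \<bullet> x1) = B' * (\<tau> \<bullet> x2)" using fW unfolding A'_def B'_def by simp
        have "B' * V < A' * X" using eW unfolding A'_def B'_def by simp
        then have "r * (B' * V) < r * (A' * X)" using r by simp
        also have "r * (A' * X) = A' * (s * V)" using rX by (metis mult.left_commute)
        finally have "r * (B' * V) < A' * (s * V)" .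
        then have "(A' * s - r * B') * V > 0" by (simp add: algebra_simps)
        then have lt: "A' * s < r * B'" using V by (auto simp: zero_less_mult_iff)
        have "A' * (r * (\<tau> \<bullet> x1)) \<le> A' * (s * (\<tau> \<bullet> x2))" using rt AB by simp
        then have "r * (B' * (\<tau> \<bullet> x2)) \<le> A' * (s * (\<tau> \<bullet> x2))" unfolding AX[symmetric] by (simp add: mult.left_commute)
        then have "(r * B') * (\<tau> \<bullet> x2) \<le> (A' * s) * (\<tau> \<bullet> x2)" by (simp add: mult.assoc)
        then have "r * B' \<le> A' * s" using tx by simp
        then show False using lt by simp
      qed
      have "0 < r * X" using rX s V by simp
      then have X: "0 < X" using r by (simp add: zero_less_mult_iff)
      have "0 \<le> (m2 \<bullet> p) * X" "0 \<le> (m1 \<bullet> p) * V" using p_coords X V by auto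
      then have "(g \<bullet> p) * Y \<le> 0" using ep by linarith
      then have "Y \<le> 0" using p_coords by (simp add: mult_le_0_iff)
      then show "0 < \<alpha> \<bullet> x1" "0 < \<alpha> \<bullet> x2" "\<alpha> \<bullet> P \<le> 0" using X V unfolding X_def V_def Y_def by auto
    qed
    show False
    proof (cases "0 \<le> \<alpha> \<bullet> t3")
      case True
      show False using towards[OF u3 u(5,6) au True _ ax(1,3)] al(2) by simp
    next
      case False
      then have at: "\<alpha> \<bullet> t3 < 0" by simp
      \<comment> \<open>Now s3 crosses the plane of y at u, so it has an end x on the far side of y
        from the contact point t3. The next facts locate x above c, outside n2 and inside
        n1.\<close>
      obtain x o3 where x: "ends s3 x o3" "0 < \<alpha> \<bullet> x" "\<alpha> \<bullet> o3 < 0"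
        using ends_separated[OF u3 au icone_sub_cone[OF t3(1)]] at by auto
      have aN: "\<not> is_normal s3 \<alpha>" using hit_not_normal[OF sD(3) y(1) u(1) u3 al(1)] .
      obtain \<sigma>3 where sg3: "is_normal s3 \<sigma>3" using is_normal_arc_normal valid sD by blast
      have u0: "u \<noteq> 0" using u(5) by auto
      \<comment> \<open>An end x below c would put the intersection of s3 with the plane of y below
        c too, but this intersection is u.\<close>
      have gx: "0 < g \<bullet> x"
      proof (rule ccontr)
        assume ng: "\<not> 0 < g \<bullet> x"
        define \<kappa> where "\<kappa> = (\<alpha> \<bullet> x) *\<^sub>R t3 + (- (\<alpha> \<bullet> t3)) *\<^sub>R x"
        have k3: "\<kappa> \<in> arc_icone s3" unfolding \<kappa>_def by (rule icone_comb'[OF t3(1) ends_in_cone[OF x(1)] x(2)]) (use at in simp)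
        have ak: "\<alpha> \<bullet> \<kappa> = 0" unfolding \<kappa>_def by (simp add: inner_diff_right)
        obtain l where l: "0 < l" "\<kappa> = l *\<^sub>R u"
          using cone_line[OF valid[OF sD(3)] sg3 aN is_normal_nz[OF al(1)] icone_sub_cone[OF u3] icone_sub_cone[OF k3] u0 icone_nonzero[OF valid[OF sD(3)] k3] au ak] .
        have "0 < g \<bullet> \<kappa>" unfolding l(2) using l(1) u(5) by simp
        moreover have "g \<bullet> \<kappa> \<le> 0" unfolding \<kappa>_def using ng t3(3) x(2) at
          by (simp add: inner_diff_right) (smt (verit) mult_nonneg_nonpos mult_nonpos_nonpos)
        ultimately show False by simp
      qed
      have ends3: "u = i' *\<^sub>R x + j' *\<^sub>R o3 \<Longrightarrow> m2 \<bullet> x = 0 \<Longrightarrow> 0 < j' \<Longrightarrow> 0 < m2 \<bullet> o3 \<Longrightarrow> False" for i' j'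
        using m2u by (simp add: inner_add_right) (metis less_asym mult_pos_pos)
      have m2x: "m2 \<bullet> x < 0"
      proof (rule ccontr)
        assume "\<not> m2 \<bullet> x < 0"
        then have mx: "0 \<le> m2 \<bullet> x" by simp
        define q where "q = (m2 \<bullet> x) *\<^sub>R u + (- (m2 \<bullet> u)) *\<^sub>R x"
        have iq: "\<psi> \<bullet> q = (m2 \<bullet> x) * (\<psi> \<bullet> u) + (- (m2 \<bullet> u)) * (\<psi> \<bullet> x)" for \<psi>
          unfolding q_def by (simp only: inner_add_right inner_scaleR_right)
        have "0 < (- (m2 \<bullet> u)) * (g \<bullet> x)" "0 < (- (m2 \<bullet> u)) * (\<alpha> \<bullet> x)" using m2u gx x by (simp_all add: mult_neg_pos)
        moreover have "0 \<le> (m2 \<bullet> x) * (g \<bullet> u)" using mx u(5,6) by auto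
        ultimately have q: "m2 \<bullet> q = 0" "0 < g \<bullet> q" "0 < \<alpha> \<bullet> q" unfolding iq au by simp_all
        have "(g \<bullet> q) * (\<alpha> \<bullet> P) \<le> 0" using q ax by (simp add: mult_le_0_iff)
        then have "0 < (m1 \<bullet> q) * (\<alpha> \<bullet> x2)" using inner_repr[of \<alpha> q] q by simp
        then have "0 < m1 \<bullet> q" using ax by (simp add: zero_less_mult_iff)
        then have qn: "q \<in> arc_icone n2" using in_n2 q by blast
        show False
        proof (cases "m2 \<bullet> x = 0")
          case True
          then have "(1/(- (m2 \<bullet> u))) *\<^sub>R q = x" unfolding q_def using m2u by simp
          then have "x \<in> arc_icone n2" using icone_scale[OF qn, of "1/(- (m2 \<bullet> u))"] m2u by simp
          then have "0 < m2 \<bullet> u" using icone_pos[OF x(1) True _ u3] n2_side[OF sD(3) x(1)] by simp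
          then show False using m2u by simp
        next
          case False
          then have "0 < m2 \<bullet> x" using mx by simp
          then have "q \<in> arc_icone s3" unfolding q_def by (rule icone_comb'[OF u3 ends_in_cone[OF x(1)]]) (use m2u in simp)
          then show False using icone_disjoint[OF sD(3) D(3) _ qn] sn by blast
        qed
      qed
      have m1x: "0 < m1 \<bullet> x"
      proof (rule ccontr)
        assume "\<not> 0 < m1 \<bullet> x"
        then have mx: "m1 \<bullet> x \<le> 0" by simp
        define q where "q = (m1 \<bullet> u) *\<^sub>R x + (- (m1 \<bullet> x)) *\<^sub>R u"
        have iq: "\<psi> \<bullet> q = (m1 \<bullet> u) * (\<psi> \<bullet> x) + (- (m1 \<bullet> x)) * (\<psi> \<bullet> u)" for \<psi>
          unfolding q_def by (simp only: inner_add_right inner_scaleR_right)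
        have "0 < (m1 \<bullet> u) * (g \<bullet> x)" "0 < (m1 \<bullet> u) * (\<alpha> \<bullet> x)" using u(5,6) gx x by simp_all
        moreover have "0 \<le> (- (m1 \<bullet> x)) * (g \<bullet> u)" using mx u(5,6) by (intro mult_nonneg_nonneg) auto
        ultimately have q: "m1 \<bullet> q = 0" "0 < g \<bullet> q" "0 < \<alpha> \<bullet> q" unfolding iq au by simp_all
        have "(g \<bullet> q) * (\<alpha> \<bullet> P) \<le> 0" using q ax by (simp add: mult_le_0_iff)
        then have "0 < (m2 \<bullet> q) * (\<alpha> \<bullet> x1)" using inner_repr[of \<alpha> q] q by simp
        then have "0 < m2 \<bullet> q" using ax by (simp add: zero_less_mult_iff)
        moreover have "(m1 \<bullet> u) * (m2 \<bullet> x) < 0" using u(5,6) m2x by (simp add: mult_pos_neg)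
        moreover have "(- (m1 \<bullet> x)) * (m2 \<bullet> u) \<le> 0" using mx m2u by (intro mult_nonneg_nonpos) auto
        ultimately show False unfolding iq by linarith
      qed
      have s2_below: "\<alpha> \<bullet> q \<le> 0" if "q \<in> arc_cone s2" for q
      proof -
        have "j * (\<alpha> \<bullet> o2) < 0" using al(2) aw unfolding ij(3) by (simp add: inner_add_right)
        then have "\<alpha> \<bullet> o2 < 0" using ij by (simp add: mult_less_0_iff)
        then show ?thesis using cone_nonpos[OF w(1) _ _ that, of \<alpha>] aw by simp
      qed
      obtain z where z: "z \<in> D" "x \<in> arc_icone z" using blocked[OF sD(3) x(1)] .
      have "z \<noteq> c" using is_normal_icone[OF normals(1), of x] z(2) gx by auto
      moreover have "z \<noteq> n1" using is_normal_icone[OF normals(2), of x] z(2) m1x by auto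
      moreover have "z \<noteq> n2" using is_normal_icone[OF normals(3), of x] z(2) m2x by auto
      moreover have "z \<noteq> s1" using s1_nonpos[OF icone_sub_cone gx] z(2) m1x by (auto simp: not_less)
      moreover have "z \<noteq> s2" using s2_below[OF icone_sub_cone, of x] z(2) x(2) by (auto simp: not_less)
      moreover have "z \<noteq> s3" using not_self_hit[OF sD(3) x(1) z(2)] .
      ultimately have B: "avoids p z" using classes[OF z(1)] by blast
      \<comment> \<open>The blocker z of x has pole p. Its upper end is not on s3, by mutual
        blocking, and not on s2, because moving towards p keeps \<alpha> positive while s2 lies
        where \<alpha> is nonpositive.\<close>
      show False
      proof (rule top[OF z(1) B icone_sub_cone[OF z(2)] gx m1x])
        fix u' v' k' h' assume u': "ends z u' v'" "u' = k' *\<^sub>R x + h' *\<^sub>R p" "0 < k'" "0 \<le> h'" "u' \<in> arc_icone s2 \<or> u' \<in> arc_icone s3"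
        have "u' \<notin> arc_icone s3" using no_mutual_hit[OF z(1) sD(3) u'(1) x(1) _ z(2)] by blast
        then have "\<alpha> \<bullet> u' \<le> 0" using s2_below icone_sub_cone u' by blast
        moreover have "0 < \<alpha> \<bullet> u'" unfolding u'(2) using ap x u'(3) by (simp add: inner_add_right)
        ultimately show False by simp
      qed
    qed
  qed
qed

lemma contradiction: False
proof -
  interpret sw: shared_side_above D p \<nu> \<nu>' S c n2 n1 x2 P x1 g m2 m1 by (rule swap_above)
  show False using P_hit contradiction_aux sw.contradiction_aux by blast
qed

end

subsection \<open>Five poles: spherical occlusion diagrams\<close>

context spherical
begin

text \<open>At the common corner either the point is interior to x, so y ends there, or x ends there
  and its blocker is a side of the triangle other than x and d.\<close>

lemma triangle_hit:
  assumes t: "tile D p \<nu> N" and N: "card N = 3" "x \<in> N" "y \<in> N" "x \<noteq> y"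
  shows "(\<exists>e o'. ends x e o' \<and> e \<in> arc_icone y) \<or> (\<exists>e o'. ends y e o' \<and> e \<in> arc_icone x)"
proof -
  have xD: "x \<in> D" and yD: "y \<in> D" using tile_D[OF t] N by auto
  have "card (N - {x, y}) = card N - card {x, y}" by (rule card_Diff_subset) (use N in auto)
  then have "card (N - {x, y}) = 1" using N by simp
  then obtain d where d: "N - {x, y} = {d}" using card_1_singletonE by blast
  have Nd: "N = {x, y, d}" and dd: "y \<noteq> d" "x \<noteq> d" using d N by blast+
  obtain w where w: "\<nu> d \<bullet> w = 1" "w \<in> arc_cone x" "w \<in> arc_cone y" "w \<in> region \<nu> {x, y, d}"
    by (rule tile_triangle[OF t[unfolded Nd] N(4) dd]) blast
  have w0: "w \<noteq> 0" using w by auto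
  from cone_cases[OF w(2) w0] show ?thesis
  proof cases
    case 1
    show ?thesis using touch_hit[OF xD yD N(4) 1 w(3)] by metis
  next
    case (2 k e o')
    have e: "(1/k) *\<^sub>R w = e" using 2 by simp
    then have "e \<in> region \<nu> N" using region_scale[OF w(4), of "1/k"] 2(2) Nd by simp
    then obtain a where a: "a \<in> N" "e \<in> arc_icone a" using tile_blocker[OF t xD 2(1)] by blast
    have "a \<noteq> x" using not_self_hit[OF xD 2(1) a(2)] .
    moreover have "a \<noteq> d"
    proof
      assume "a = d"
      then have "\<nu> d \<bullet> e = 0" using is_normal_icone[OF tile_normal[OF t a(1)] a(2)] by simp
      then show False using w(1) 2(3) by simp
    qed
    ultimately have "a = y" using a Nd by blast
    then show ?thesis using 2(1) a by blast
  qed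
qed

text \<open>Both triangles have the same corner w between x and y; what matters is how the third
  sides C and A lie relative to each other. If neither separates the other from w they cross;
  otherwise p or q would be forced onto the arc that avoids it.\<close>

lemma triangles_share_two_sides:
  assumes t: "tile D p \<nu> {x, y, C}" "x \<noteq> y" "y \<noteq> C" "x \<noteq> C"
    and t': "tile D q \<mu> {x, y, A}" "y \<noteq> A" "x \<noteq> A"
    and pA: "avoids p A" and qC: "avoids q C"
  shows False
proof -
  have D: "x \<in> D" "y \<in> D" "C \<in> D" "A \<in> D" using tile_D[OF t(1)] tile_D[OF t'(1)] by auto
  have CA: "C \<noteq> A" using avoids_notin_tile[OF t(1) pA] by auto
  obtain w Y X where T: "\<nu> x \<bullet> w = 0" "\<nu> y \<bullet> w = 0" "\<nu> C \<bullet> w = 1" "w \<in> arc_cone x" "w \<in> arc_cone y"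
    "\<nu> y \<bullet> Y = 0" "\<nu> C \<bullet> Y = 0" "\<nu> x \<bullet> Y = 1" "Y \<in> arc_cone y" "Y \<in> arc_cone C"
    "\<nu> C \<bullet> X = 0" "\<nu> x \<bullet> X = 0" "\<nu> y \<bullet> X = 1" "X \<in> arc_cone C" "X \<in> arc_cone x"
    "\<And>q. q = (\<nu> C \<bullet> q) *\<^sub>R w + (\<nu> x \<bullet> q) *\<^sub>R Y + (\<nu> y \<bullet> q) *\<^sub>R X"
    by (rule tile_triangle[OF t]) blast
  obtain w' Y' X' where T': "\<mu> x \<bullet> w' = 0" "\<mu> y \<bullet> w' = 0" "\<mu> A \<bullet> w' = 1" "w' \<in> arc_cone x" "w' \<in> arc_cone y"
    "\<mu> y \<bullet> Y' = 0" "\<mu> A \<bullet> Y' = 0" "\<mu> x \<bullet> Y' = 1" "Y' \<in> arc_cone y" "Y' \<in> arc_cone A"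
    "\<mu> A \<bullet> X' = 0" "\<mu> x \<bullet> X' = 0" "\<mu> y \<bullet> X' = 1" "X' \<in> arc_cone A" "X' \<in> arc_cone x"
    "\<And>q. q = (\<mu> A \<bullet> q) *\<^sub>R w' + (\<mu> x \<bullet> q) *\<^sub>R Y' + (\<mu> y \<bullet> q) *\<^sub>R X'"
    by (rule tile_triangle[OF t'(1) t(2) t'(2,3)]) blast
  have nx: "is_normal x (\<nu> x)" and ny: "is_normal y (\<nu> y)" and nC: "is_normal C (\<nu> C)" using tile_normal[OF t(1)] by auto
  have mx: "is_normal x (\<mu> x)" and my: "is_normal y (\<mu> y)" and mA: "is_normal A (\<mu> A)" using tile_normal[OF t'(1)] by auto
  have w0: "w \<noteq> 0" "w' \<noteq> 0" using T(3) T'(3) by auto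
  have xy: "\<not> is_normal x (\<nu> y)" using tile_planes[OF t(1), of y x] t(2) ny by blast
  obtain k where k: "0 < k" "w' = k *\<^sub>R w"
    using cone_line[OF valid[OF D(1)] nx xy is_normal_nz[OF ny] T(4) T'(4) w0 T(2) is_normal_cone[OF ny T'(5)]] .
  define \<alpha> \<kappa> where "\<alpha> = \<mu> A" and "\<kappa> = \<nu> C"
  have aw: "0 < \<alpha> \<bullet> w" using T'(3) k unfolding \<alpha>_def by (metis inner_scaleR_right zero_less_mult_pos zero_less_one)
  \<comment> \<open>Coordinates of the corners X' and Y' on the rays of x and y. A negative a2 or b2
    means lying on the other side of w; the signs of a1 and b1 tell whether A is nearer to w than
    C.\<close>
  define a1 a2 b1 b2 where "a1 = \<kappa> \<bullet> X'" and "a2 = \<nu> y \<bullet> X'" and "b1 = \<kappa> \<bullet> Y'" and "b2 = \<nu> x \<bullet> Y'"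
  have Xr: "X' = a1 *\<^sub>R w + a2 *\<^sub>R X" using T(16)[of X'] is_normal_cone[OF nx T'(15)] unfolding a1_def a2_def \<kappa>_def by simp
  have Yr: "Y' = b1 *\<^sub>R w + b2 *\<^sub>R Y" using T(16)[of Y'] is_normal_cone[OF ny T'(9)] unfolding b1_def b2_def \<kappa>_def by simp
  have a2: "a2 \<noteq> 0"
  proof
    assume "a2 = 0"
    then have "\<mu> y \<bullet> X' = 0" using is_normal_cone[OF my T(5)] unfolding Xr by simp
    then show False using T'(13) by simp
  qed
  have b2: "b2 \<noteq> 0"
  proof
    assume "b2 = 0"
    then have "\<mu> x \<bullet> Y' = 0" using is_normal_cone[OF mx T(4)] unfolding Yr by simp
    then show False using T'(8) by simp
  qed
  have aX: "a1 * (\<alpha> \<bullet> w) + a2 * (\<alpha> \<bullet> X) = 0" using T'(11) unfolding \<alpha>_def Xr by (simp add: inner_add_right)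
  have aY: "b1 * (\<alpha> \<bullet> w) + b2 * (\<alpha> \<bullet> Y) = 0" using T'(7) unfolding \<alpha>_def Yr by (simp add: inner_add_right)
  define pw px py where "pw = \<nu> C \<bullet> p" and "px = \<nu> x \<bullet> p" and "py = \<nu> y \<bullet> p"
  have pn: "0 \<le> pw" "0 \<le> px" "0 \<le> py" unfolding pw_def px_def py_def using tile_nn[OF t(1) _ tile_p[OF t(1)]] by auto
  have pr: "p = pw *\<^sub>R w + px *\<^sub>R Y + py *\<^sub>R X" using T(16)[of p] unfolding pw_def px_def py_def .
  have pa: "pw * (\<alpha> \<bullet> w) + px * (\<alpha> \<bullet> Y) + py * (\<alpha> \<bullet> X) = 0"
    using avoids_normal[OF pA mA] unfolding \<alpha>_def[symmetric] by (subst (asm) pr) (simp add: inner_add_right)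
  define qw qx qy where "qw = \<mu> A \<bullet> q" and "qx = \<mu> x \<bullet> q" and "qy = \<mu> y \<bullet> q"
  have qn: "0 \<le> qw" "0 \<le> qx" "0 \<le> qy" unfolding qw_def qx_def qy_def using tile_nn[OF t'(1) _ tile_p[OF t'(1)]] by auto
  have qr: "q = qw *\<^sub>R w' + qx *\<^sub>R Y' + qy *\<^sub>R X'" using T'(16)[of q] unfolding qw_def qx_def qy_def .
  have qk: "qw * k + qx * b1 + qy * a1 = 0"
    using avoids_normal[OF qC nC] unfolding \<kappa>_def[symmetric] b1_def a1_def
    by (subst (asm) qr) (simp add: inner_add_right k(2) \<kappa>_def T(3))
  have p0: "p \<noteq> 0" and q0: "q \<noteq> 0" using pA qC unfolding avoids_def by auto
  \<comment> \<open>If the two corners on an arc lie on different sides of v, then v is interior to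
    that arc; this can happen for only one of x and y at their common corner.\<close>
  have beyond: "v \<in> arc_cone z \<Longrightarrow> V \<in> arc_cone z \<Longrightarrow> V' \<in> arc_cone z \<Longrightarrow> V' = c1 *\<^sub>R v + c2 *\<^sub>R V \<Longrightarrow> c2 < 0 \<Longrightarrow>
      is_normal z m \<Longrightarrow> n \<bullet> v = 0 \<Longrightarrow> n \<bullet> V \<noteq> 0 \<Longrightarrow> v \<noteq> 0 \<Longrightarrow> z \<in> D \<Longrightarrow> \<phi> \<bullet> V' = 0 \<Longrightarrow> 0 < \<phi> \<bullet> v \<Longrightarrow> 0 < c1 \<and> v \<in> arc_icone z \<and> 0 < \<phi> \<bullet> V"
    for z v V V' c1 c2 m n \<phi>
  proof -
    assume h: "v \<in> arc_cone z" "V \<in> arc_cone z" "V' \<in> arc_cone z" "V' = c1 *\<^sub>R v + c2 *\<^sub>R V" "c2 < 0"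
      "n \<bullet> v = 0" "n \<bullet> V \<noteq> 0" "v \<noteq> 0" "z \<in> D" "\<phi> \<bullet> V' = 0" "0 < \<phi> \<bullet> v"
    have "cross3 v V \<noteq> 0" using cross_nonzero_functional h by blast
    then have "cross3 V' V \<noteq> 0 \<or> c1 = 0" unfolding h(4) by (simp add: cross_add_left cross_mult_left)
    moreover have "c1 \<noteq> 0"
    proof
      assume "c1 = 0"
      then have "V' = c2 *\<^sub>R V" using h by simp
      then have "- ((- c2) *\<^sub>R V) \<in> arc_cone z" "(- c2) *\<^sub>R V \<in> arc_cone z" using h cone_scale[OF h(2), of "- c2"] by auto
      then have "(- c2) *\<^sub>R V = 0" using cone_pointed valid[OF h(9)] by blast
      then show False using h by auto
    qed
    ultimately have c: "cross3 V' V \<noteq> 0" by blast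
    have i: "c1 *\<^sub>R v \<in> arc_icone z" using cone_sum_icone[OF valid[OF h(9)] h(3,2) c, of 1 "- c2"] h(5) unfolding h(4) by simp
    have c1: "0 < c1"
    proof (rule ccontr)
      assume "\<not> 0 < c1"
      then have "- (c1 *\<^sub>R v) \<in> arc_cone z" using cone_scale[OF h(1), of "- c1"] by simp
      then have "c1 *\<^sub>R v = 0" using cone_pointed[OF valid[OF h(9)] icone_sub_cone[OF i]] by blast
      then show False using icone_nonzero[OF valid[OF h(9)] i] by simp
    qed
    have "c1 * (\<phi> \<bullet> v) + c2 * (\<phi> \<bullet> V) = 0" using h(10) unfolding h(4) by (simp add: inner_add_right)
    moreover have "0 < c1 * (\<phi> \<bullet> v)" using c1 h by simp
    ultimately have "c2 * (\<phi> \<bullet> V) < 0" by linarith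
    then have "0 < \<phi> \<bullet> V" using h(5) by (simp add: mult_less_0_iff)
    moreover have "v \<in> arc_icone z" using icone_scale[OF i, of "1/c1"] c1 by simp
    ultimately show ?thesis using c1 by blast
  qed
  \<comment> \<open>With one corner beyond w, the vanishing of \<alpha> at p makes the remaining
    coefficient d1 positive, and then the vanishing of \<kappa> at q leaves only q = 0.\<close>
  have neg_case: False
    if h: "0 < \<alpha> \<bullet> V1" "0 < c1" "d2 > 0" "W' = d1 *\<^sub>R w + d2 *\<^sub>R V2" "d1 * (\<alpha> \<bullet> w) + d2 * (\<alpha> \<bullet> V2) = 0" "W' \<in> arc_cone A"
      and p: "p = pw *\<^sub>R w + r2 *\<^sub>R V2 + r1 *\<^sub>R V1" "0 \<le> r1" "0 \<le> r2"
      and q: "q = qw *\<^sub>R w' + q2 *\<^sub>R W' + q1 *\<^sub>R W" "0 \<le> q1" "0 \<le> q2" "qw * k + q2 * d1 + q1 * c1 = 0"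
    for V1 c1 d1 d2 W' V2 r1 r2 q1 q2 W
  proof -
    have e: "pw * (\<alpha> \<bullet> w) + r2 * (\<alpha> \<bullet> V2) + r1 * (\<alpha> \<bullet> V1) = 0"
      using avoids_normal[OF pA mA] unfolding \<alpha>_def[symmetric] by (subst (asm) p(1)) (simp add: inner_add_right)
    have "\<alpha> \<bullet> V2 < 0"
    proof (rule ccontr)
      assume "\<not> \<alpha> \<bullet> V2 < 0"
      then have n: "0 \<le> pw * (\<alpha> \<bullet> w)" "0 \<le> r2 * (\<alpha> \<bullet> V2)" "0 \<le> r1 * (\<alpha> \<bullet> V1)" using pn aw h p by auto
      then have "pw * (\<alpha> \<bullet> w) = 0" "r1 * (\<alpha> \<bullet> V1) = 0" "r2 * (\<alpha> \<bullet> V2) = 0" using e by linarith+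
      then have z: "pw = 0" "r1 = 0" "r2 = 0 \<or> \<alpha> \<bullet> V2 = 0" using aw h by auto
      then have pp: "p = r2 *\<^sub>R V2" using p by simp
      then have "\<alpha> \<bullet> V2 = 0" using z p0 by auto
      then have "d1 = 0" using h(5) aw by simp
      then have "V2 = (1/d2) *\<^sub>R W'" using h(3,4) by simp
      then have "V2 \<in> arc_cone A" using cone_scale[OF h(6), of "1/d2"] h(3) by simp
      then have "p \<in> arc_cone A" unfolding pp using cone_scale p by blast
      then show False using pA unfolding avoids_def by simp
    qed
    then have "d2 * (\<alpha> \<bullet> V2) < 0" using h(3) by (simp add: mult_pos_neg)
    then have "0 < d1 * (\<alpha> \<bullet> w)" using h(5) by linarith
    then have d1: "0 < d1" using aw by (simp add: zero_less_mult_iff)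
    have "0 \<le> qw * k" "0 \<le> q2 * d1" "0 \<le> q1 * c1" using qn k q d1 h by auto
    then have "qw * k = 0" "q2 * d1 = 0" "q1 * c1 = 0" using q(4) by linarith+
    then have "q = 0" using q(1) k d1 h by auto
    then show False using q0 by simp
  qed
  have wx: "0 < a1 \<and> w \<in> arc_icone x \<and> 0 < \<alpha> \<bullet> X" if "a2 < 0"
    by (rule beyond[OF T(4,15) T'(15) Xr that nx T(2) _ w0(1) D(1) _ aw]) (use T T' \<alpha>_def in auto)
  have wy: "0 < b1 \<and> w \<in> arc_icone y \<and> 0 < \<alpha> \<bullet> Y" if "b2 < 0"
    by (rule beyond[OF T(5,9) T'(9) Yr that ny T(1) _ w0(1) D(2) _ aw]) (use T T' \<alpha>_def in auto)
  have both: "\<not> (a2 < 0 \<and> b2 < 0)" using wx wy icone_disjoint[OF D(1,2)] t(2) by blast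
  consider "a2 < 0" "0 < b2" | "b2 < 0" "0 < a2" | "0 < a2" "0 < b2" using both a2 b2 by linarith
  then show False
  proof cases
    case 1
    have x: "0 < \<alpha> \<bullet> X" "0 < a1" using wx[OF 1(1)] by auto
    show False by (rule neg_case[OF x 1(2) Yr aY T'(10) pr pn(3,2) qr qn(3,2) qk])
  next
    case 2
    have y: "0 < \<alpha> \<bullet> Y" "0 < b1" using wy[OF 2(1)] by auto
    have pr': "p = pw *\<^sub>R w + py *\<^sub>R X + px *\<^sub>R Y" using pr by (simp add: add_ac)
    have qr': "q = qw *\<^sub>R w' + qy *\<^sub>R X' + qx *\<^sub>R Y'" using qr by (simp add: add_ac)
    have qk': "qw * k + qy * a1 + qx * b1 = 0" using qk by simp
    show False by (rule neg_case[OF y 2(2) Xr aX T'(14) pr' pn(2,3) qr' qn(2,3) qk'])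
  next
    case 3
    have Xs: "\<alpha> \<bullet> X = - (a1 * (\<alpha> \<bullet> w)) / a2" and Ys: "\<alpha> \<bullet> Y = - (b1 * (\<alpha> \<bullet> w)) / b2" using aX aY 3 by (simp_all add: field_simps)
    have XA: "X \<in> arc_cone A" if "a1 = 0"
    proof -
      have "X = (1/a2) *\<^sub>R X'" using Xr that 3 by simp
      then show ?thesis using cone_scale[OF T'(14), of "1/a2"] 3 by simp
    qed
    have YA: "Y \<in> arc_cone A" if "b1 = 0"
    proof -
      have "Y = (1/b2) *\<^sub>R Y'" using Yr that 3 by simp
      then show ?thesis using cone_scale[OF T'(10), of "1/b2"] 3 by simp
    qed
    \<comment> \<open>Here \<alpha> would be nonnegative at all corners of the first triangle. As it
      vanishes at p, the point p would be a combination of corners lying on A.\<close>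
    have n1: "\<not> (a1 \<le> 0 \<and> b1 \<le> 0)"
    proof
      assume n: "a1 \<le> 0 \<and> b1 \<le> 0"
      have "0 \<le> - (a1 * (\<alpha> \<bullet> w))" "0 \<le> - (b1 * (\<alpha> \<bullet> w))" using n aw by (auto simp: mult_le_0_iff)
      then have nn: "0 \<le> \<alpha> \<bullet> X" "0 \<le> \<alpha> \<bullet> Y" unfolding Xs Ys using 3 by (simp_all add: divide_nonpos_pos)
      have "0 \<le> pw * (\<alpha> \<bullet> w)" "0 \<le> px * (\<alpha> \<bullet> Y)" "0 \<le> py * (\<alpha> \<bullet> X)" using pn aw nn by auto
      then have "pw * (\<alpha> \<bullet> w) = 0" "px * (\<alpha> \<bullet> Y) = 0" "py * (\<alpha> \<bullet> X) = 0" using pa by linarith+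
      then have z: "pw = 0" "px = 0 \<or> b1 = 0" "py = 0 \<or> a1 = 0" unfolding Xs Ys using aw 3 by auto
      have "px *\<^sub>R Y \<in> arc_cone A" "py *\<^sub>R X \<in> arc_cone A" using z XA YA pn cone_scale zero_in_cone by (metis scaleR_zero_left)+
      then have "p \<in> arc_cone A" using pr z cone_add by simp
      then show False using pA unfolding avoids_def by simp
    qed
    have n2: "\<not> (0 \<le> a1 \<and> 0 \<le> b1)"
    proof
      assume n: "0 \<le> a1 \<and> 0 \<le> b1"
      have "0 \<le> qw * k" "0 \<le> qx * b1" "0 \<le> qy * a1" using qn k n by auto
      then have "qw * k = 0" "qx * b1 = 0" "qy * a1 = 0" using qk by linarith+
      then have z: "qw = 0" "qx = 0 \<or> b1 = 0" "qy = 0 \<or> a1 = 0" using k by auto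
      have "X' \<in> arc_cone C" if "a1 = 0" using that Xr cone_scale[OF T(14), of a2] 3 by simp
      moreover have "Y' \<in> arc_cone C" if "b1 = 0" using that Yr cone_scale[OF T(10), of b2] 3 by simp
      ultimately have "qx *\<^sub>R Y' \<in> arc_cone C" "qy *\<^sub>R X' \<in> arc_cone C" using z qn cone_scale zero_in_cone by (metis scaleR_zero_left)+
      then have "q \<in> arc_cone C" using qr z cone_add by simp
      then show False using qC unfolding avoids_def by simp
    qed
    have cXY: "cross3 X Y \<noteq> 0" by (rule cross_nonzero_functional[of _ "\<nu> x"]) (use T in auto)
    have cXY': "cross3 X' Y' \<noteq> 0" by (rule cross_nonzero_functional[of _ "\<mu> x"]) (use T' in auto)
    \<comment> \<open>The combination that eliminates w: with a1 and b1 of opposite signs, it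
      describes a point interior to both A and C.\<close>
    have e: "(- b1) *\<^sub>R X' + a1 *\<^sub>R Y' = (- b1 * a2) *\<^sub>R X + (a1 * b2) *\<^sub>R Y" unfolding Xr Yr by (simp add: algebra_simps)
    have e': "b1 *\<^sub>R X' + (- a1) *\<^sub>R Y' = (b1 * a2) *\<^sub>R X + (- a1 * b2) *\<^sub>R Y" unfolding Xr Yr by (simp add: algebra_simps)
    consider "0 < a1" "b1 < 0" | "a1 < 0" "0 < b1" using n1 n2 by linarith
    then show False
    proof cases
      case ab: 1
      have "(- b1) *\<^sub>R X' + a1 *\<^sub>R Y' \<in> arc_icone A" by (rule cone_sum_icone[OF valid[OF D(4)] T'(14,10) cXY']) (use ab in auto)
      moreover have "(- b1 * a2) *\<^sub>R X + (a1 * b2) *\<^sub>R Y \<in> arc_icone C" by (rule cone_sum_icone[OF valid[OF D(3)] T(14,10) cXY]) (use ab 3 in \<open>auto simp: mult_neg_pos\<close>)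
      ultimately show False using icone_disjoint[OF D(3,4)] e CA by simp
    next
      case ab: 2
      have "b1 *\<^sub>R X' + (- a1) *\<^sub>R Y' \<in> arc_icone A" by (rule cone_sum_icone[OF valid[OF D(4)] T'(14,10) cXY']) (use ab in auto)
      moreover have "(b1 * a2) *\<^sub>R X + (- a1 * b2) *\<^sub>R Y \<in> arc_icone C" by (rule cone_sum_icone[OF valid[OF D(3)] T(14,10) cXY]) (use ab 3 in \<open>auto simp: mult_neg_pos\<close>)
      ultimately show False using icone_disjoint[OF D(3,4)] e' CA by simp
    qed
  qed
qed

definition hit_pairs :: "(arc \<times> arc) set" where
  "hit_pairs = {(a, b). a \<in> D \<and> b \<in> D \<and> (fst b \<in> arc_icone a \<or> snd b \<in> arc_icone a)}"

text \<open>Interiors of arcs are disjoint, so each of the two ends of an arc determines its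
  blocker.\<close>

lemma card_hit_pairs: "finite hit_pairs" "card hit_pairs \<le> 2 * card D"
proof -
  define k where "k e = (SOME a. a \<in> D \<and> e \<in> arc_icone a)" for e
  have k: "k e = a" if "a \<in> D" "e \<in> arc_icone a" for e a
  proof -
    have "k e \<in> D \<and> e \<in> arc_icone (k e)" unfolding k_def by (rule someI[of _ a]) (use that in blast)
    then show ?thesis using icone_disjoint that by blast
  qed
  have sub: "hit_pairs \<subseteq> (\<lambda>b. (k (fst b), b)) ` D \<union> (\<lambda>b. (k (snd b), b)) ` D"
    using k unfolding hit_pairs_def by blast
  show "finite hit_pairs" by (rule finite_subset[OF sub]) (use fin in auto)
  have "card hit_pairs \<le> card ((\<lambda>b. (k (fst b), b)) ` D \<union> (\<lambda>b. (k (snd b), b)) ` D)" by (rule card_mono[OF _ sub]) (use fin in auto)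
  also have "\<dots> \<le> card ((\<lambda>b. (k (fst b), b)) ` D) + card ((\<lambda>b. (k (snd b), b)) ` D)" by (rule card_Un_le)
  also have "\<dots> \<le> card D + card D" by (intro add_mono card_image_le fin)
  finally show "card hit_pairs \<le> 2 * card D" by simp
qed

lemma triangle_hit_pairs:
  assumes "tile D p \<nu> N" "card N = 3" "e \<subseteq> N" "card e = 2"
  shows "e \<in> (\<lambda>(a, b). {a, b}) ` hit_pairs"
proof -
  obtain x y where xy: "e = {x, y}" "x \<noteq> y" using assms(4) card_2_iff by metis
  have D: "x \<in> D" "y \<in> D" using xy assms(3) tile_D[OF assms(1)] by auto
  have "(y, x) \<in> hit_pairs \<or> (x, y) \<in> hit_pairs"
    using triangle_hit[OF assms(1,2), of x y] xy assms(3) D unfolding hit_pairs_def ends_def by blast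
  then show ?thesis using xy by (metis (mono_tags, lifting) case_prod_conv image_eqI insert_commute)
qed

end

section \<open>Opposite tiles of an occlusion diagram\<close>

context occlusion
begin

text \<open>If c is not hit from the first tile, both ends of c lie in that tile, where the
  functional of d is nonnegative. But it is nonpositive at an interior point of c touched by the
  other tile, so it vanishes on c, and two sides would be coplanar.\<close>

lemma unhit_side_common:
  assumes t: "tile D p \<nu> N" and t': "tile D (- p) \<nu>' S" and p0: "p \<noteq> 0"
    and c: "c \<in> N" "c \<in> S" and d: "d \<in> N" "d \<in> S" and cd: "c \<noteq> d"
    and unhit: "\<And>b e o'. b \<in> D \<Longrightarrow> ends b e o' \<Longrightarrow> e \<in> arc_icone c \<Longrightarrow> \<not> 0 < \<nu> c \<bullet> o'"
  shows False
proof -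
  have cD: "c \<in> D" using tile_D[OF t c(1)] .
  have nc: "is_normal c (\<nu> c)" using tile_normal[OF t c(1)] .
  have full: "e \<in> region \<nu> N" if e: "ends c e o'" for e o'
  proof -
    obtain b r where b: "b \<in> N" "b \<noteq> c" "r \<in> region \<nu> N" "r \<in> arc_cone b" "r = e \<and> e \<in> arc_icone b \<or> r \<in> arc_icone c"
      by (rule tile_neighbour[OF t c(1) e])
    have bD: "b \<in> D" using tile_D[OF t b(1)] .
    have "r \<notin> arc_icone c"
    proof
      assume "r \<in> arc_icone c"
      then obtain k f o'' where f: "ends b f o''" "f \<in> arc_icone c" using touch_hit[OF cD bD b(2)[symmetric] _ b(4)] by metis
      have "\<nu> c \<bullet> o'' < 0" using unhit[OF bD f] hit_transversal[OF cD bD f nc] by linarith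
      moreover obtain w where w: "w \<in> region \<nu> N" "w \<in> arc_icone b" using tile_contact[OF t b(1)] by blast
      ultimately have "\<nu> c \<bullet> w < 0" using icone_neg[OF f(1) is_normal_icone[OF nc f(2)] _ w(2)] by blast
      then show False using tile_nn[OF t c(1) w(1)] by simp
    qed
    then show ?thesis using b by blast
  qed
  have nn: "0 \<le> \<nu> d \<bullet> fst c" "0 \<le> \<nu> d \<bullet> snd c" using tile_nn[OF t d(1)] full ends_fst ends_snd by blast+
  obtain w where w: "w \<in> region \<nu>' S" "w \<in> arc_icone c" using tile_contact[OF t' c(2)] by blast
  obtain s u where su: "0 < s" "0 < u" "w = s *\<^sub>R fst c + u *\<^sub>R snd c" using w(2) unfolding arc_icone_def by auto
  have "s * (\<nu> d \<bullet> fst c) + u * (\<nu> d \<bullet> snd c) \<le> 0" using common_side_nonpos[OF t t' p0 d w(1)] unfolding su(3) by (simp add: inner_add_right)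
  moreover have "0 \<le> s * (\<nu> d \<bullet> fst c)" "0 \<le> u * (\<nu> d \<bullet> snd c)" using su nn by auto
  ultimately have "s * (\<nu> d \<bullet> fst c) = 0" "u * (\<nu> d \<bullet> snd c) = 0" by linarith+
  then have "is_normal c (\<nu> d)" using su is_normal_nz[OF tile_normal[OF t d(1)]] unfolding is_normal_def by auto
  then show False using tile_planes[OF t d(1) c(1) cd[symmetric] tile_normal[OF t d(1)]] by blast
qed

text \<open>By one-sidedness at least one of the two tiles has no arc hitting c from its side;
  \<open>unhit_side_common\<close> is applied to that tile.\<close>

lemma one_common_side:
  assumes t: "tile D p \<nu> N" and t': "tile D (- p) \<nu>' S" and p0: "p \<noteq> 0"
  shows "card (N \<inter> S) \<le> 1"
proof (rule ccontr)
  assume "\<not> card (N \<inter> S) \<le> 1"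
  then obtain c d where cd: "c \<in> N" "c \<in> S" "d \<in> N" "d \<in> S" "c \<noteq> d"
    using card_le_Suc0_iff_eq[of "N \<inter> S"] tile_finite[OF t] by auto
  have cD: "c \<in> D" using tile_D[OF t cd(1)] .
  show False
  proof (cases "\<exists>b e o'. b \<in> D \<and> ends b e o' \<and> e \<in> arc_icone c \<and> 0 < \<nu> c \<bullet> o'")
    case False
    show False by (rule unhit_side_common[OF t t' p0 cd]) (use False in blast)
  next
    case True
    then obtain b e o' where b: "b \<in> D" "ends b e o'" "e \<in> arc_icone c" "0 < \<nu> c \<bullet> o'" by blast
    have pos: "0 < \<nu> c \<bullet> o2" if "b2 \<in> D" "ends b2 e2 o2" "e2 \<in> arc_icone c" for b2 e2 o2
      using one_sided[OF cD b(1) that(1) b(2,3) that(2,3) tile_normal[OF t cd(1)] b(4)] .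
    have t2: "tile D (- (- p)) \<nu> N" using t by simp
    show False
      by (rule unhit_side_common[OF t' t2 _ cd(2,1,4,3,5)]) (use p0 pos common_side(2)[OF t t' p0 cd(1,2)] in force)+
  qed
qed

lemma shared_triangle:
  assumes t: "tile D p \<nu> N" and t': "tile D (- p) \<nu>' S" and p0: "p \<noteq> 0" and k: "card N = 3" "card S = 4" "N \<inter> S = {c}"
    and rest: "\<And>a. a \<in> D \<Longrightarrow> a \<notin> N \<Longrightarrow> a \<notin> S \<Longrightarrow> avoids p a"
  shows False
proof -
  have cN: "c \<in> N" and cS: "c \<in> S" using k by auto
  have "card (N - {c}) = 2" using k cN by simp
  then obtain n1 n2 where n: "N - {c} = {n1, n2}" "n1 \<noteq> n2" using card_2_iff by metis
  have N: "N = {c, n1, n2}" and d: "c \<noteq> n1" "c \<noteq> n2" using n cN by blast+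
  have nS: "n1 \<notin> S" "n2 \<notin> S" using k(3) n by blast+
  note tN = t[unfolded N]
  obtain x P z where T: "\<nu> c \<bullet> x = 0" "\<nu> n1 \<bullet> x = 0" "\<nu> n2 \<bullet> x = 1" "x \<in> arc_cone c" "x \<in> arc_cone n1" "x \<in> region \<nu> {c, n1, n2}"
    "\<nu> n1 \<bullet> P = 0" "\<nu> n2 \<bullet> P = 0" "\<nu> c \<bullet> P = 1" "P \<in> arc_cone n1" "P \<in> arc_cone n2" "P \<in> region \<nu> {c, n1, n2}"
    "\<nu> n2 \<bullet> z = 0" "\<nu> c \<bullet> z = 0" "\<nu> n1 \<bullet> z = 1" "z \<in> arc_cone n2" "z \<in> arc_cone c" "z \<in> region \<nu> {c, n1, n2}"
    "\<And>q. q = (\<nu> n2 \<bullet> q) *\<^sub>R x + (\<nu> c \<bullet> q) *\<^sub>R P + (\<nu> n1 \<bullet> q) *\<^sub>R z"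
    by (rule tile_triangle[OF tN d(1) n(2) d(2)]) blast
  have rest': "a \<in> D \<Longrightarrow> a \<noteq> c \<Longrightarrow> a \<noteq> n1 \<Longrightarrow> a \<noteq> n2 \<Longrightarrow> a \<notin> S \<Longrightarrow> avoids p a" for a using rest N by blast
  have ss: "shared_side D p \<nu> \<nu>' S c n1 n2 x P z (\<nu> c) (\<nu> n1) (\<nu> n2)"
    by unfold_locales (fact tN d n(2) t' p0 cS nS k(2) rest' T refl)+
  have cD: "c \<in> D" using tile_D[OF t cN] .
  have nc: "is_normal c (\<nu> c)" using tile_normal[OF t cN] .
  show False
  proof (cases "\<exists>b e o'. b \<in> D \<and> ends b e o' \<and> e \<in> arc_icone c \<and> 0 < \<nu> c \<bullet> o'")
    case True
    then obtain b e o' where b: "b \<in> D" "ends b e o'" "e \<in> arc_icone c" "0 < \<nu> c \<bullet> o'" by blast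
    have "0 < \<nu> c \<bullet> o2" if "b2 \<in> D" "ends b2 e2 o2" "e2 \<in> arc_icone c" for b2 e2 o2
      using one_sided[OF cD b(1) that(1) b(2,3) that(2,3) nc b(4)] .
    then have "shared_side_above D p \<nu> \<nu>' S c n1 n2 x P z (\<nu> c) (\<nu> n1) (\<nu> n2)"
      unfolding shared_side_above_def shared_side_above_axioms_def using ss by blast
    then show False by (rule shared_side_above.contradiction)
  next
    case False
    have "\<nu> c \<bullet> o2 < 0" if "b2 \<in> D" "ends b2 e2 o2" "e2 \<in> arc_icone c" for b2 e2 o2
    proof -
      have "\<not> 0 < \<nu> c \<bullet> o2" using False that by blast
      then show ?thesis using hit_transversal[OF cD that nc] by linarith
    qed
    then have "shared_side_below D p \<nu> \<nu>' S c n1 n2 x P z (\<nu> c) (\<nu> n1) (\<nu> n2)"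
      unfolding shared_side_below_def shared_side_below_axioms_def using ss by blast
    then show False by (rule shared_side_below.contradiction)
  qed
qed

end

section \<open>Excluding eight arcs\<close>

locale coloured_occlusion = coloured + occlusion
begin

text \<open>The six arcs not of pole p are exactly the sides of the two tiles. With at least three
  sides each and at most one in common, the sizes are 3 + 3, or 3 + 4 with a common side, which
  \<open>shared_triangle\<close> rules out.\<close>

lemma pole_triangles:
  assumes D8: "card D = 8" and f2: "card (fibre p) = 2"
  obtains T :: "bool \<Rightarrow> arc set" where "\<And>b. \<exists>\<nu>. tile D (if b then p else - p) \<nu> (T b)" "\<And>b. card (T b) = 3"
    "T True \<inter> T False = {}" "T True \<union> T False = D - fibre p"
proof -
  have "fibre p \<noteq> {}" using f2 by auto
  then obtain a0 where a0: "a0 \<in> fibre p" by blast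
  have p0: "p \<noteq> 0" using a0 f_nonzero unfolding fibre_def by blast
  obtain \<nu> N where t: "tile D p \<nu> N" using tile_exists .
  obtain \<nu>' S where t': "tile D (- p) \<nu>' S" using tile_exists .
  have fN: "finite N" "finite S" using tile_finite t t' by blast+
  have sub: "N \<union> S \<subseteq> D - fibre p" using tile_D t t' fibre_disjoint[OF t t'] by blast
  have fD: "fibre p \<subseteq> D" by (auto simp: fibre_def)
  have c6: "card (D - fibre p) = 6" using D8 f2 fD fin by (simp add: card_Diff_subset finite_subset)
  have NS: "N \<union> S = D - fibre p" by (rule card_seteq) (use fin sub c6 six_sides[OF a0 t t'] in auto)
  have u: "card N + card S = 6 + card (N \<inter> S)" using card_Un_Int[OF fN] NS c6 by simp
  have k: "3 \<le> card N" "3 \<le> card S" using tile_card t t' by blast+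
  have x: "card (N \<inter> S) \<le> 1" using one_common_side[OF t t' p0] .
  have rest: "avoids p a" if "a \<in> D" "a \<notin> N" "a \<notin> S" for a using that NS fibre_avoids by blast
  have x0: "card (N \<inter> S) \<noteq> 1"
  proof
    assume x1: "card (N \<inter> S) = 1"
    then obtain c where c: "N \<inter> S = {c}" using card_1_singletonE by blast
    consider "card N = 3" "card S = 4" | "card N = 4" "card S = 3" using u x1 k by linarith
    then show False
    proof cases
      case 1 show False using shared_triangle[OF t t' p0 1 c rest] .
    next
      case 2
      show False by (rule shared_triangle[of "- p" \<nu>' S \<nu> N c]) (use t t' p0 2 c rest avoids_uminus in auto)
    qed
  qed
  then have "card (N \<inter> S) = 0" using x by linarith
  then have disj: "N \<inter> S = {}" using fN by simp
  have "card N = 3" "card S = 3" using u k disj by auto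
  show thesis
  proof (rule that[of "\<lambda>b. if b then N else S"])
    show "\<exists>\<nu>. tile D (if b then p else - p) \<nu> (if b then N else S)" for b using t t' by (cases b) auto
    show "card (if b then N else S) = 3" for b using \<open>card N = 3\<close> \<open>card S = 3\<close> by simp
  qed (use disj NS in auto)
qed

text \<open>The arc C of pole q in N is not a side of M, and the arc A of pole p in M is not a side
  of N. So two common sides would leave exactly the configuration of
  \<open>triangles_share_two_sides\<close>.\<close>

lemma triangles_meet:
  assumes p: "card (fibre p) = 2" "p' = p \<or> p' = - p" "tile D p' \<nu> N" "card N = 3" "N \<inter> fibre q \<noteq> {}"
    and q: "card (fibre q) = 2" "q' = q \<or> q' = - q" "tile D q' \<mu> M" "card M = 3" "M \<inter> fibre p \<noteq> {}"
    and e: "e \<subseteq> N" "e \<subseteq> M" "card e = 2"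
  shows False
proof -
  obtain x y where xy: "e = {x, y}" "x \<noteq> y" using e(3) card_2_iff by metis
  have m: "x \<in> N" "y \<in> N" "x \<in> M" "y \<in> M" using xy e by auto
  have av: "avoids q' a" if "a \<in> fibre q" for a using fibre_avoids[OF that] avoids_uminus q(2) by blast
  have av': "avoids p' a" if "a \<in> fibre p" for a using fibre_avoids[OF that] avoids_uminus p(2) by blast
  obtain C where C: "C \<in> N" "C \<in> fibre q" using p by blast
  obtain A where A: "A \<in> M" "A \<in> fibre p" using q by blast
  have CM: "C \<notin> M" using avoids_notin_tile[OF q(3) av[OF C(2)]] .
  have AN: "A \<notin> N" using avoids_notin_tile[OF p(3) av'[OF A(2)]] .
  have d: "y \<noteq> C" "x \<noteq> C" "y \<noteq> A" "x \<noteq> A" using m CM AN by auto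
  have "N = {x, y, C}" "M = {x, y, A}"
    using card_subset_eq[of N "{x, y, C}"] card_subset_eq[of M "{x, y, A}"] tile_finite[OF p(3)] tile_finite[OF q(3)] p(4) q(4) xy d m C A by auto
  then show False using triangles_share_two_sides[of p' \<nu> x y C q' \<mu> A] p q xy d av[OF C(2)] av'[OF A(2)] by auto
qed

text \<open>If there were only eight arcs, three poles would each be used by two arcs. Their six triangular tiles
have 18 distinct pairs of touching sides, but eight arcs have only 16 ends.\<close>
lemma occlusion_bound: "9 \<le> card D"
proof (rule ccontr)
  assume "\<not> 9 \<le> card D"
  then have D8: "card D = 8" using sd_bound by simp
  define R where "R = {p \<in> Q. card (fibre p) = 2}"
  have le2: "card (fibre p) \<le> 2" for p using fibre_card[of p] D8 by (cases "fibre p = {}") auto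
  \<comment> \<open>Classes have at most two arcs, so 8 \<le> 5 + r, where r counts the poles
    serving exactly two arcs.\<close>
  have "card D \<le> (\<Sum>p\<in>Q. 1 + (if card (fibre p) = 2 then 1 else 0))"
    unfolding card_fibres
  proof (rule sum_mono)
    fix p show "card (fibre p) \<le> 1 + (if card (fibre p) = 2 then 1 else 0)" using le2[of p] by auto
  qed
  also have "\<dots> = card Q + (\<Sum>p\<in>Q. if card (fibre p) = 2 then 1 else 0)"
    by (simp only: sum.distrib card_eq_sum)
  also have "(\<Sum>p\<in>Q. if card (fibre p) = 2 then 1 else 0) = card R"
    unfolding R_def card_eq_sum by (rule sum.inter_filter[OF finQ, symmetric])
  finally have "3 \<le> card R" using D8 cardQ by simp
  then obtain R3 where R3: "R3 \<subseteq> R" "card R3 = 3" by (meson obtain_subset_with_card_n)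
  have finR: "finite R3" by (rule card_ge_0_finite) (simp add: R3(2))
  have R2: "card (fibre p) = 2" if "p \<in> R3" for p using that R3 unfolding R_def by auto
  have "\<exists>T :: bool \<Rightarrow> arc set. (\<forall>b. \<exists>\<nu>. tile D (if b then p else - p) \<nu> (T b)) \<and> (\<forall>b. card (T b) = 3) \<and>
    T True \<inter> T False = {} \<and> T True \<union> T False = D - fibre p" if "p \<in> R3" for p
    using pole_triangles[OF D8 R2[OF that]] by metis
  then obtain T where T: "\<And>p b. p \<in> R3 \<Longrightarrow> \<exists>\<nu>. tile D (if b then p else - p) \<nu> (T p b)" "\<And>p b. p \<in> R3 \<Longrightarrow> card (T p b) = 3"
    "\<And>p. p \<in> R3 \<Longrightarrow> T p True \<inter> T p False = {}" "\<And>p. p \<in> R3 \<Longrightarrow> T p True \<union> T p False = D - fibre p"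
    by metis
  \<comment> \<open>Otherwise both arcs of pole q would be sides of the other triangle at p; sides
    of a triangle touch, arcs with a common pole do not.\<close>
  have meets: "T p b \<inter> fibre q \<noteq> {}" if pq: "p \<in> R3" "q \<in> R3" "p \<noteq> q" for p q b
  proof
    assume n: "T p b \<inter> fibre q = {}"
    have "fibre q \<subseteq> D - fibre p" using pq by (auto simp: fibre_def)
    then have sub: "fibre q \<subseteq> T p (\<not> b)" using n T(4)[OF pq(1)] by (cases b) auto
    obtain a a' where a: "fibre q = {a, a'}" "a \<noteq> a'" using R2[OF pq(2)] card_2_iff by metis
    obtain \<nu> where t: "tile D (if \<not> b then p else - p) \<nu> (T p (\<not> b))" using T(1)[OF pq(1)] by blast
    show False using triangle_avoids[OF t T(2)[OF pq(1)] _ _ a(2)] fibre_avoids a sub by blast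
  qed
  \<comment> \<open>The three pairs of sides of each triangle. As the families are disjoint, their 6
    times 3 pairs all have to arise from different blockings.\<close>
  define E where "E i = {e. e \<subseteq> T (fst i) (snd i) \<and> card e = 2}" for i :: "pt \<times> bool"
  define I where "I = R3 \<times> (UNIV :: bool set)"
  have finI: "finite I" and cI: "card I = 6" unfolding I_def using finR R3(2) by (auto simp: card_cartesian_product)
  have finT: "finite (T p b)" if "p \<in> R3" for p b by (rule card_ge_0_finite) (simp add: T(2)[OF that])
  have cE: "card (E i) = 3" and finE: "finite (E i)" if "i \<in> I" for i
  proof -
    have i: "fst i \<in> R3" using that unfolding I_def by auto
    show "card (E i) = 3" unfolding E_def n_subsets[OF finT[OF i]] T(2)[OF i] by (simp add: choose_two)
    then show "finite (E i)" by (intro card_ge_0_finite) simp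
  qed
  have disj: "E i \<inter> E j = {}" if ij: "i \<in> I" "j \<in> I" "i \<noteq> j" for i j
  proof (rule ccontr)
    assume "E i \<inter> E j \<noteq> {}"
    then obtain e where e: "e \<subseteq> T (fst i) (snd i)" "e \<subseteq> T (fst j) (snd j)" "card e = 2" unfolding E_def by auto
    have i: "fst i \<in> R3" and j: "fst j \<in> R3" using ij unfolding I_def by auto
    show False
    proof (cases "fst i = fst j")
      case True
      then have "snd i \<noteq> snd j" using ij(3) by (simp add: prod_eq_iff)
      then have "e \<subseteq> T (fst i) True \<inter> T (fst i) False" using e True by (cases "snd i"; cases "snd j") auto
      then show False using T(3)[OF i] e(3) by simp
    next
      case False
      obtain \<nu> where t: "tile D (if snd i then fst i else - fst i) \<nu> (T (fst i) (snd i))" using T(1)[OF i] by blast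
      obtain \<mu> where t': "tile D (if snd j then fst j else - fst j) \<mu> (T (fst j) (snd j))" using T(1)[OF j] by blast
      show False
        by (rule triangles_meet[OF R2[OF i] _ t T(2)[OF i] meets[OF i j False] R2[OF j] _ t' T(2)[OF j] meets[OF j i False[symmetric]] e]) auto
    qed
  qed
  have "card (\<Union>i\<in>I. E i) = (\<Sum>i\<in>I. card (E i))" by (rule card_UN_disjoint) (use finI finE disj in auto)
  also have "\<dots> = 18" using cE cI by simp
  finally have c18: "card (\<Union>i\<in>I. E i) = 18" .
  have "(\<Union>i\<in>I. E i) \<subseteq> (\<lambda>(a, b). {a, b}) ` hit_pairs"
  proof (rule UN_least, rule subsetI)
    fix i e assume i: "i \<in> I" and e: "e \<in> E i"
    then have iR: "fst i \<in> R3" unfolding I_def by auto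
    obtain \<nu> where t: "tile D (if snd i then fst i else - fst i) \<nu> (T (fst i) (snd i))" using T(1)[OF iR] by blast
    show "e \<in> (\<lambda>(a, b). {a, b}) ` hit_pairs" using triangle_hit_pairs[OF t T(2)[OF iR]] e unfolding E_def by blast
  qed
  then have "18 \<le> card ((\<lambda>(a, b). {a, b}) ` hit_pairs)" unfolding c18[symmetric] by (rule card_mono[rotated]) (use card_hit_pairs in auto)
  also have "\<dots> \<le> card hit_pairs" by (rule card_image_le[OF card_hit_pairs(1)])
  also have "\<dots> \<le> 16" using card_hit_pairs(2) D8 by simp
  finally show False by simp
qed

end

lemma occlusion_exists:
  assumes "spherical_occlusion_diagram D"
  shows "occlusion D"
proof
  show "spherical_diagram D" using assms by (simp add: spherical_occlusion_diagram_def)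
  then interpret spherical D by unfold_locales
  fix a b b' e o' e2 o2 m
  assume h: "a \<in> D" "b \<in> D" "b' \<in> D" "ends b e o'" "e \<in> arc_icone a" "ends b' e2 o2" "e2 \<in> arc_icone a" "is_normal a m" "0 < m \<bullet> o'"
  obtain s where s: "\<forall>b\<in>D. (fst b \<in> arc_relint a \<longrightarrow> sgn (arc_normal a \<bullet> snd b) = s) \<and> (snd b \<in> arc_relint a \<longrightarrow> sgn (arc_normal a \<bullet> fst b) = s)"
    using assms h(1) unfolding spherical_occlusion_diagram_def by blast
  have side: "sgn (arc_normal a \<bullet> v) = s" if "d \<in> D" "ends d u v" "u \<in> arc_icone a" for d u v
  proof -
    have "norm u = 1" using valid[OF that(1)] that(2) unfolding valid_arc_def ends_def by auto
    then have "sgn u = u" by (simp add: sgn_div_norm)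
    then have "u \<in> arc_relint a" using icone_relint[OF that(3)] by simp
    then show ?thesis using s that unfolding ends_def by blast
  qed
  obtain k where k: "k \<noteq> 0" "m = k *\<^sub>R arc_normal a" using is_normal_multiple[OF valid[OF h(1)] h(8)] .
  have "sgn (m \<bullet> o') = sgn k * s" "sgn (m \<bullet> o2) = sgn k * s"
    using side[OF h(2,4,5)] side[OF h(3,6,7)] unfolding k(2) by (simp_all add: sgn_mult)
  then show "0 < m \<bullet> o2" using h(9) by (metis sgn_greater)
qed

theorem mainTheorem6:
  shows "(\<forall>D. spherical_diagram D \<and> k_oriented 5 D \<longrightarrow> card D \<ge> 8) \<and>
         (\<forall>D. spherical_occlusion_diagram D \<and> k_oriented 5 D \<longrightarrow> card D \<ge> 9)"
proof (intro conjI allI impI; elim conjE)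
  fix D assume D: "spherical_diagram D" "k_oriented 5 D"
  obtain f Q where "coloured D f Q" using coloured_exists[OF D] .
  then show "card D \<ge> 8" by (rule coloured.sd_bound)
next
  fix D assume D: "spherical_occlusion_diagram D" "k_oriented 5 D"
  obtain f Q where "coloured D f Q" using coloured_exists[OF _ D(2)] D(1) by (auto simp: spherical_occlusion_diagram_def)
  then have "coloured_occlusion D f Q" using occlusion_exists[OF D(1)] by (simp add: coloured_occlusion_def)
  then show "card D \<ge> 9" by (rule coloured_occlusion.occlusion_bound)
qed

end
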